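(* Let $\sigma_0>0$ and let $u_0\in G^{\sigma_0}(\mathbb{R})$ be real-valued. Then the Benjamin-Bona-Mahony (BBM) equation $$u_t-u_{txx}+u_x+uu_x=0,\qquad u(0,x)=u_0(x),\qquad x\in\mathbb{R},$$ has a global solution $u\in C([0,\infty);G^{\sigma(t)}(\mathbb{R}))$ for some non-increasing function $\sigma:[0,\infty)\to(0,\infty)$ with $$\sigma(t)\ge c\,t^{-\frac23}\qquad\text{as } t\to\infty \text{ (i.e. for all sufficiently large } t),$$ where $c>0$ is a constant depending only on $\sigma_0$ and $\|u_0\|_{G^{\sigma_0}}$.
   Context: The Fourier transform is $\widehat f(\xi)=\int_{\mathbb{R}}e^{-ix\xi}f(x)\,dx$. For $\sigma>0$, $G^\sigma(\mathbb{R})$ is the Banach space with norm $\|u\|_{G^\sigma}=\left(\int_{\mathbb{R}}e^{2\sigma|\xi|}|\widehat u(\xi)|^2\,d\xi\right)^{1/2}$. Note $G^{\sigma}\subset G^{\sigma'}$ if $\sigma'\le\sigma$. The equation is understood in the equivalent form $u_t+\varphi(D)u+\frac12\varphi(D)(u^2)=0$, $u(0)=u_0$, where $\varphi(D)=\partial_x(1-\partial_x^2)^{-1}$ is the Fourier multiplier with symbol $i\xi/(1+\xi^2)$; equivalently $u(t)=e^{-t\varphi(D)}u_0-\frac12\int_0^te^{-(t-\tau)\varphi(D)}\varphi(D)(u^2)(\tau)\,d\tau$. The notation $u\in C([0,\infty);G^{\sigma(t)})$ with $\sigma$ non-increasing means: $u(t)\in G^{\sigma(t)}$ for all $t\ge0$,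 and for every $T>0$ the map $t\mapsto u(t)$ is continuous from $[0,T]$ into $G^{\sigma(T)}$. *)

theory Defs
  imports "HOL-Analysis.Analysis"
begin

text \<open>
  Elements of \<open>L\<^sup>2(\<real>)\<close>, and hence of the spaces \<open>G\<^sup>\<sigma>\<close> below, are represented by Borel measurable
  functions; two functions represent the same element iff they agree almost everywhere.
\<close>

definition L2 :: "(real \<Rightarrow> complex) set" where
  "L2 = {f. f \<in> borel_measurable lborel \<and> integrable lborel (\<lambda>x. (norm (f x))\<^sup>2)}"

text \<open>
  A function in \<open>G\<^sup>\<sigma>\<close> need not be integrable, so the Fourier transform is the one on \<open>L\<^sup>2\<close>:
  the \<open>L\<^sup>2\<close>-limit of the transforms of the truncations to \<open>[-R, R]\<close>. It agrees almost everywhere with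
  \<open>\<integral> exp(-ix\<xi>) f(x) dx\<close> for \<open>f\<close> in \<open>L\<^sup>1 \<inter> L\<^sup>2\<close>. The squared \<open>L\<^sup>2\<close>-distance is a nonnegative integral,
  so that it cannot vanish merely because the integrand fails to be integrable.
\<close>

definition has_fourier :: "(real \<Rightarrow> complex) \<Rightarrow> (real \<Rightarrow> complex) \<Rightarrow> bool" where
  "has_fourier f g \<longleftrightarrow> f \<in> L2 \<and> g \<in> L2 \<and>
    ((\<lambda>R. \<integral>\<^sup>+\<xi>. ennreal ((norm (g \<xi> -
        (LINT x:{-R..R}|lborel. exp (- (\<i> * complex_of_real x * complex_of_real \<xi>)) * f x)))\<^sup>2)
      \<partial>lborel) \<longlongrightarrow> 0) at_top"

text \<open>The choice made here is unique up to a null set.\<close>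

definition fourier :: "(real \<Rightarrow> complex) \<Rightarrow> real \<Rightarrow> complex" where
  "fourier f = (SOME g. has_fourier f g)"

definition inv_fourier :: "(real \<Rightarrow> complex) \<Rightarrow> real \<Rightarrow> complex" where
  "inv_fourier g x = fourier g (- x) / complex_of_real (2 * pi)"

definition fourier_multiplier :: "(real \<Rightarrow> complex) \<Rightarrow> (real \<Rightarrow> complex) \<Rightarrow> real \<Rightarrow> complex" where
  "fourier_multiplier m f = inv_fourier (\<lambda>\<xi>. m \<xi> * fourier f \<xi>)"

definition phi_D :: "(real \<Rightarrow> complex) \<Rightarrow> real \<Rightarrow> complex" where
  "phi_D = fourier_multiplier (\<lambda>\<xi>. \<i> * complex_of_real \<xi> / complex_of_real (1 + \<xi>\<^sup>2))"

definition gevrey :: "real \<Rightarrow> (real \<Rightarrow> complex) set" where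
  "gevrey \<sigma> = {f \<in> L2. integrable lborel (\<lambda>\<xi>. exp (2 * \<sigma> * \<bar>\<xi>\<bar>) * (norm (fourier f \<xi>))\<^sup>2)}"

definition gevrey_norm :: "real \<Rightarrow> (real \<Rightarrow> complex) \<Rightarrow> real" where
  "gevrey_norm \<sigma> f = sqrt (LINT \<xi>|lborel. exp (2 * \<sigma> * \<bar>\<xi>\<bar>) * (norm (fourier f \<xi>))\<^sup>2)"

definition real_valued :: "(real \<Rightarrow> complex) \<Rightarrow> bool" where
  "real_valued f \<longleftrightarrow> (AE x in lborel. f x \<in> \<real>)"

definition gevrey_continuous_on :: "real \<Rightarrow> real set \<Rightarrow> (real \<Rightarrow> real \<Rightarrow> complex) \<Rightarrow> bool" where
  "gevrey_continuous_on \<sigma> S u \<longleftrightarrow> (\<forall>t\<in>S. u t \<in> gevrey \<sigma>) \<and>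
    (\<forall>t\<in>S. ((\<lambda>s. gevrey_norm \<sigma> (\<lambda>x. u s x - u t x)) \<longlongrightarrow> 0) (at t within S))"

text \<open>
  \<open>C([0,\<infinity>); G\<^bsup>\<sigma>(t)\<^esup>)\<close> for non-increasing \<open>\<sigma>\<close>: the target space varies with \<open>t\<close>, so continuity
  on \<open>[0, T]\<close> is required in the largest of these spaces, \<open>G\<^bsup>\<sigma>(T)\<^esup>\<close>.
\<close>

definition C_gevrey :: "(real \<Rightarrow> real) \<Rightarrow> (real \<Rightarrow> real \<Rightarrow> complex) \<Rightarrow> bool" where
  "C_gevrey \<sigma> u \<longleftrightarrow> (\<forall>t\<ge>0. u t \<in> gevrey (\<sigma> t)) \<and> (\<forall>T>0. gevrey_continuous_on (\<sigma> T) {0..T} u)"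

text \<open>
  Membership is demanded because \<open>gevrey_norm\<close> is meaningful only on \<open>gevrey \<sigma>\<close>: the Bochner
  integral of a non-integrable function is 0.
\<close>

definition has_gevrey_derivative ::
    "real \<Rightarrow> (real \<Rightarrow> real \<Rightarrow> complex) \<Rightarrow> (real \<Rightarrow> complex) \<Rightarrow> real \<Rightarrow> real set \<Rightarrow> bool" where
  "has_gevrey_derivative \<sigma> u v t S \<longleftrightarrow> v \<in> gevrey \<sigma> \<and> (\<forall>s\<in>S. u s \<in> gevrey \<sigma>) \<and>
    ((\<lambda>s. gevrey_norm \<sigma> (\<lambda>x. (u s x - u t x) / complex_of_real (s - t) - v x)) \<longlongrightarrow> 0) (at t within S)"

text \<open>
  The equation \<open>u\<^sub>t - u\<^sub>t\<^sub>x\<^sub>x + u\<^sub>x + u u\<^sub>x = 0\<close>, \<open>u(0) = u\<^sub>0\<close>, in the form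
  \<open>u\<^sub>t + \<phi>(D) u + (1/2) \<phi>(D) (u\<^sup>2) = 0\<close> with \<open>\<phi>(D) = \<partial>\<^sub>x (1 - \<partial>\<^sub>x\<^sup>2)\<^bsup>-1\<^esup>\<close>. On each \<open>[0, T]\<close>, the time
  derivative is taken in the space \<open>G\<^bsup>\<sigma>(T)\<^esup>\<close> in which \<open>u\<close> is continuous there.
\<close>

definition BBM_solution ::
    "(real \<Rightarrow> real) \<Rightarrow> (real \<Rightarrow> complex) \<Rightarrow> (real \<Rightarrow> real \<Rightarrow> complex) \<Rightarrow> bool" where
  "BBM_solution \<sigma> u0 u \<longleftrightarrow>
    (AE x in lborel. u 0 x = u0 x) \<and>
    (\<forall>T>0. \<forall>t\<in>{0..T}. \<exists>u\<^sub>t. has_gevrey_derivative (\<sigma> T) u u\<^sub>t t {0..T} \<and>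
      (AE x in lborel. u\<^sub>t x + phi_D (u t) x + 1 / 2 * phi_D (\<lambda>y. (u t y)\<^sup>2) x = 0))"

end

theory Submission
  imports Defs "HOL-Probability.Probability"
begin

text \<open>
  For the Fourier transform \<open>w\<close> of \<open>u\<close> the equation is the ordinary differential equation
  \<open>w' = - m w - m (w * w) / (4 \<pi>)\<close> in \<open>L\<^sup>2\<close>, with \<open>m(\<xi>) = i \<xi> / (1 + \<xi>\<^sup>2)\<close>. Analyticity of
  width \<open>\<sigma>\<close> is measured by the norm of \<open>v = w / p\<close> in \<open>L\<^sup>2\<close>, where
  \<open>1 / p(\<xi>)\<^sup>2 = (1 + \<xi>\<^sup>2) sinh (2 \<sigma> \<xi>) / (2 \<sigma> \<xi>)\<close>; the equation for \<open>v\<close> again has a bounded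
  quadratic nonlinearity. Since \<open>m / p\<^sup>2 = i sinh (2 \<sigma> \<xi>) / (2 \<sigma>)\<close>, and since the sum of the
  values of this function at three frequencies with sum zero is, up to a factor of order
  \<open>1 / \<sigma>\<close>, the product of the \<open>sinh (\<sigma> \<xi>\<^sub>j)\<close>, the derivative of \<open>\<parallel>v\<parallel>\<^sup>2\<close> is at most
  \<open>C \<sigma>\<^bsup>3/2\<^esup> \<parallel>v\<parallel>\<^sup>3\<close>. The initial norm is bounded uniformly for \<open>\<sigma> \<le> \<sigma>\<^sub>0 / 2\<close>, so \<open>v\<close> exists
  on \<open>[0, T]\<close> if \<open>\<sigma>\<close> is a small multiple of \<open>T\<^bsup>-2/3\<^esup>\<close>. Uniqueness in \<open>L\<^sup>2\<close> shows that the
  solutions \<open>w\<close> obtained for different \<open>T\<close> agree.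
\<close>

section \<open>Ordinary differential equations in Hilbert space\<close>

text \<open>The estimate perturbs a conservation law. At \<sigma> = 0 the weight
  \<open>1 / p^2\<close> is 1 + \<xi>^2, and the norm of v is, up to a constant, the H1 norm of the
  solution. It is conserved: \<open>m / p^2\<close> is then i \<xi>, whose values at three
  frequencies with sum zero add up to 0. For \<sigma> > 0 the same sum is an exact product of three
  small factors; a plain exponential weight would instead leave differences of exponentials to
  estimate. The power 3/2 comes from scaling. After division by the weights the defect is controlled
  by a kernel of size \<sigma>^2 that begins to decay at |\<xi>| of order 1 / \<sigma>; its L2 norm
  is of order \<sigma>^2 \<sigma>^(-1/2). Keeping \<sigma>^(3/2) T bounded gives the rate T^(-2/3).
  Two constants are kept apart. The Lipschitz bound obtained for the weighted nonlinearity
  degenerates as \<sigma> tends to 0, so a contraction argument by itself would give too short a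
  time. It enters only qualitatively, and the length of the interval is decided by the energy
  inequality alone.\<close>

lemma global_Picard:
  fixes G :: "'a::banach \<Rightarrow> 'a"
  assumes L: "L > 0" and lip: "\<And>x y. norm (G x - G y) \<le> L * norm (x - y)" and T: "T \<ge> 0"
  obtains y where "y 0 = x0" "\<And>t. t \<in> {0..T} \<Longrightarrow> (y has_vector_derivative G (y t)) (at t within {0..T})"
proof -
  \<comment> \<open>Clamping time to [0, T] turns curves on the interval into bounded continuous
    functions on the whole line, the complete space in which the fixed point is found.\<close>
  define c where "c t = max 0 (min T t)" for t :: real
  have c: "0 \<le> c t" "c t \<le> T" for t using T by (auto simp: c_def)
  have cont_c: "continuous_on UNIV c" unfolding c_def by (intro continuous_intros)
  \<comment> \<open>The unknown is written as y t = exp (l t) z t. In the sup norm of z the integral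
    operator then has Lipschitz constant L / l = 1 / 2, so a single contraction covers the interval,
    however long it is.\<close>
  define l where "l = 2 * L"
  have contG: "continuous_on S G" for S
  proof (rule continuous_on_subset)
    show "continuous_on UNIV G"
      by (rule lipschitz_on_continuous_on[of L]) (use L lip in \<open>auto intro!: lipschitz_onI simp: dist_norm\<close>)
  qed auto
  define I where "I z t = x0 + integral {0..t} (\<lambda>s. G (exp (l * s) *\<^sub>R z s))" for z :: "real \<Rightarrow> 'a" and t
  have cint: "continuous_on {0..T} (\<lambda>s. G (exp (l * s) *\<^sub>R z s))" if "continuous_on UNIV z" for z
    by (intro continuous_on_compose2[OF contG[of UNIV]] continuous_intros continuous_on_subset[OF that]) auto
  have contI: "continuous_on {0..T} (I z)" if "continuous_on UNIV z" for z
    unfolding I_def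
    by (intro continuous_intros indefinite_integral_continuous_1 integrable_continuous_real cint that)
  define \<Phi> where "\<Phi> z t = exp (- l * c t) *\<^sub>R I z (c t)" for z t
  have \<Phi>b: "\<Phi> z \<in> bcontfun" if z: "continuous_on UNIV z" for z
  proof -
    have 1: "continuous_on {0..T} (\<lambda>t. exp (- l * t) *\<^sub>R I z t)"
      by (intro continuous_intros contI z)
    have eq: "\<Phi> z = (\<lambda>t. exp (- l * t) *\<^sub>R I z t) \<circ> c" by (auto simp: \<Phi>_def)
    have "continuous_on UNIV (\<Phi> z)"
      unfolding eq by (rule continuous_on_compose[OF cont_c continuous_on_subset[OF 1]]) (use c in auto)
    moreover have "bounded (range (\<Phi> z))"
      by (rule bounded_subset[OF compact_imp_bounded[OF compact_continuous_image[OF 1 compact_Icc]]])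
         (use c in \<open>auto simp: eq\<close>)
    ultimately show ?thesis by (auto simp: bcontfun_def)
  qed
  have \<Phi>_ac: "apply_bcontfun (Bcontfun (\<Phi> z)) = \<Phi> z" if "continuous_on UNIV z" for z
    using \<Phi>b[OF that] by (simp add: Bcontfun_inverse)
  have contr: "norm (\<Phi> z1 t - \<Phi> z2 t) \<le> 1 / 2 * d"
    if z: "continuous_on UNIV z1" "continuous_on UNIV z2" and d: "\<And>t. norm (z1 t - z2 t) \<le> d" for z1 z2 t d
  proof -
    have lp: "l > 0" using L by (simp add: l_def)
    have dp: "d \<ge> 0" using d[of 0] norm_ge_zero order_trans by blast
    let ?g = "\<lambda>z s. G (exp (l * s) *\<^sub>R z s)"
    have int: "?g z integrable_on {0..c t}" if "continuous_on UNIV z" for z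
      by (intro integrable_continuous_real continuous_on_subset[OF cint[OF that]]) (use c in auto)
    have e: "((\<lambda>s. L * d * exp (l * s)) has_integral (L * d * exp (l * c t) / l - L * d * exp (l * 0) / l)) {0..c t}"
      by (rule fundamental_theorem_of_calculus)
         (use c lp in \<open>auto intro!: derivative_eq_intros simp: has_real_derivative_iff_has_vector_derivative[symmetric]\<close>)
    have "norm (integral {0..c t} (\<lambda>s. ?g z1 s - ?g z2 s)) \<le> integral {0..c t} (\<lambda>s. L * d * exp (l * s))"
    proof (rule integral_norm_bound_integral)
      show "(\<lambda>s. ?g z1 s - ?g z2 s) integrable_on {0..c t}" by (intro integrable_diff int z)
      show "(\<lambda>s. L * d * exp (l * s)) integrable_on {0..c t}" using e by blast
      fix s assume "s \<in> {0..c t}"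
      have "norm (?g z1 s - ?g z2 s) \<le> L * norm (exp (l * s) *\<^sub>R z1 s - exp (l * s) *\<^sub>R z2 s)" by (rule lip)
      also have "\<dots> = L * (exp (l * s) * norm (z1 s - z2 s))"
        by (simp flip: scaleR_diff_right)
      also have "\<dots> \<le> L * (exp (l * s) * d)" using L d by (intro mult_left_mono) auto
      finally show "norm (?g z1 s - ?g z2 s) \<le> L * d * exp (l * s)" by (simp add: mult_ac)
    qed
    also have "\<dots> = L * d * exp (l * c t) / l - L * d * exp (l * 0) / l" using e by blast
    also have "\<dots> \<le> L * d * exp (l * c t) / l" using L dp lp by simp
    also have "\<dots> = 1 / 2 * d * exp (l * c t)" using L by (simp add: l_def)
    finally have b: "norm (integral {0..c t} (\<lambda>s. ?g z1 s - ?g z2 s)) \<le> 1 / 2 * d * exp (l * c t)" .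
    have "\<Phi> z1 t - \<Phi> z2 t = exp (- l * c t) *\<^sub>R integral {0..c t} (\<lambda>s. ?g z1 s - ?g z2 s)"
      unfolding \<Phi>_def I_def integral_diff[OF int[OF z(1)] int[OF z(2)]] by (simp add: algebra_simps)
    then have "norm (\<Phi> z1 t - \<Phi> z2 t) \<le> exp (- l * c t) * (1 / 2 * d * exp (l * c t))"
      using b by simp
    also have "\<dots> = 1 / 2 * d" by (simp add: exp_minus field_simps)
    finally show ?thesis .
  qed
  have "\<exists>!z. Bcontfun (\<Phi> (apply_bcontfun z)) = z"
  proof (rule banach_fix_type[where c="1/2"])
    show "\<forall>x y. dist (Bcontfun (\<Phi> (apply_bcontfun x))) (Bcontfun (\<Phi> (apply_bcontfun y))) \<le> 1 / 2 * dist x y"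
    proof (intro allI dist_bound)
      fix z1 z2 :: "real \<Rightarrow>\<^sub>C 'a" and t
      show "dist (apply_bcontfun (Bcontfun (\<Phi> (apply_bcontfun z1))) t) (apply_bcontfun (Bcontfun (\<Phi> (apply_bcontfun z2))) t) \<le> 1 / 2 * dist z1 z2"
        by (simp only: \<Phi>_ac[OF continuous_on_apply_bcontfun] dist_norm[of "\<Phi> _ _"], rule contr)
           (auto simp: dist_norm[symmetric] dist_bounded)
    qed
  qed auto
  then obtain z where "Bcontfun (\<Phi> (apply_bcontfun z)) = z" by auto
  then have fz: "apply_bcontfun z = \<Phi> (apply_bcontfun z)" using \<Phi>_ac[OF continuous_on_apply_bcontfun] by metis
  define y where "y t = I z t" for t
  have y: "y t = exp (l * t) *\<^sub>R z t" if "t \<in> {0..T}" for t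
    using that by (subst fz) (auto simp: y_def \<Phi>_def c_def exp_minus)
  show ?thesis
  proof (rule that[of y])
    show "y 0 = x0" by (simp add: y_def I_def)
    fix t assume t: "t \<in> {0..T}"
    have "((\<lambda>t. integral {0..t} (\<lambda>s. G (exp (l * s) *\<^sub>R z s))) has_vector_derivative G (exp (l * t) *\<^sub>R z t)) (at t within {0..T})"
      by (rule integral_has_vector_derivative[OF cint t]) auto
    then show "(y has_vector_derivative G (y t)) (at t within {0..T})"
      unfolding y[OF t] by (auto simp: y_def[abs_def] I_def[abs_def] intro!: derivative_eq_intros)
  qed
qed

section \<open>Gronwall's inequality and uniqueness\<close>

lemma differential_Gronwall:
  fixes f :: "real \<Rightarrow> real"
  assumes f: "\<And>t. t \<in> {0..T} \<Longrightarrow> (f has_real_derivative f' t) (at t within {0..T})"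
    and le: "\<And>t. t \<in> {0..T} \<Longrightarrow> f' t \<le> a * f t" and t: "t \<in> {0..T}"
  shows "f t \<le> f 0 * exp (a * t)"
proof -
  have "f t * exp (- a * t) \<le> f 0 * exp (- a * 0)"
  proof (rule DERIV_nonpos_imp_decreasing_open[where f="\<lambda>t. f t * exp (- a * t)" and a=0 and b=t])
    show "0 \<le> t" using t by simp
    have "continuous_on {0..T} f"
      using f by (meson has_field_derivative_imp_has_derivative has_derivative_continuous_on)
    then show "continuous_on {0..t} (\<lambda>t. f t * exp (- a * t))"
      using t by (intro continuous_intros) (auto elim: continuous_on_subset)
    fix x assume x: "0 < x" "x < t"
    then have "(f has_real_derivative f' x) (at x within {0<..<T})"
      using f[of x] t by (auto intro: DERIV_subset)
    then have "(f has_real_derivative f' x) (at x)"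
      using x t by (subst (asm) at_within_open) auto
    then have "((\<lambda>t. f t * exp (- a * t)) has_real_derivative f' x * exp (- a * x) + f x * (- a * exp (- a * x))) (at x)"
      by (auto intro!: derivative_eq_intros)
    moreover have "f' x * exp (- a * x) + f x * (- a * exp (- a * x)) \<le> 0"
      using le[of x] x t by (simp add: algebra_simps)
    ultimately show "\<exists>y. ((\<lambda>t. f t * exp (- a * t)) has_real_derivative y) (at x) \<and> y \<le> 0" by blast
  qed
  then show ?thesis by (simp add: exp_minus field_simps)
qed

lemma has_real_derivative_norm_square:
  fixes y :: "real \<Rightarrow> 'a::real_inner"
  assumes "(y has_vector_derivative y') (at t within S)"
  shows "((\<lambda>t. (norm (y t))\<^sup>2) has_real_derivative 2 * inner (y t) y') (at t within S)"
proof -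
  have "((\<lambda>t. inner (y t) (y t)) has_derivative (\<lambda>h. inner (y t) (h *\<^sub>R y') + inner (h *\<^sub>R y') (y t))) (at t within S)"
    using assms unfolding has_vector_derivative_def by (auto intro!: derivative_eq_intros)
  then show ?thesis
    by (auto simp: has_field_derivative_def power2_norm_eq_inner inner_commute algebra_simps
        elim!: has_derivative_eq_rhs)
qed

text \<open>By compactness both solutions stay in one ball, where \<open>F\<close> has a single
  Lipschitz constant, and Gronwall's inequality applies to the squared distance. It serves to
  identify, in the unweighted equation, the solutions constructed for different end times.\<close>

lemma ODE_unique:
  fixes y1 :: "real \<Rightarrow> 'a::real_inner"
  assumes y1: "\<And>t. t \<in> {0..T} \<Longrightarrow> (y1 has_vector_derivative F (y1 t)) (at t within {0..T})"
    and y2: "\<And>t. t \<in> {0..T} \<Longrightarrow> (y2 has_vector_derivative F (y2 t)) (at t within {0..T})"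
    and lip: "\<And>R. \<exists>L. \<forall>x y. norm x \<le> R \<longrightarrow> norm y \<le> R \<longrightarrow> norm (F x - F y) \<le> L * norm (x - y)"
    and eq: "y1 0 = y2 0" and t: "t \<in> {0..T}"
  shows "y1 t = y2 t"
proof -
  have "continuous_on {0..T} y1" "continuous_on {0..T} y2"
    unfolding continuous_on_eq_continuous_within using has_vector_derivative_continuous y1 y2 by blast+
  then have "bounded (y1 ` {0..T})" "bounded (y2 ` {0..T})"
    by (auto intro!: compact_imp_bounded compact_continuous_image)
  then have "bounded (y1 ` {0..T} \<union> y2 ` {0..T})" by simp
  then obtain R where R: "\<And>t. t \<in> {0..T} \<Longrightarrow> norm (y1 t) \<le> R \<and> norm (y2 t) \<le> R"
    unfolding bounded_iff by blast
  obtain L where L: "\<And>x y. norm x \<le> R \<Longrightarrow> norm y \<le> R \<Longrightarrow> norm (F x - F y) \<le> L * norm (x - y)"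
    using lip by blast
  have "(norm (y1 t - y2 t))\<^sup>2 \<le> (norm (y1 0 - y2 0))\<^sup>2 * exp (2 * L * t)"
  proof (rule differential_Gronwall[OF has_real_derivative_norm_square _ t])
    fix s assume s: "s \<in> {0..T}"
    show "((\<lambda>t. y1 t - y2 t) has_vector_derivative F (y1 s) - F (y2 s)) (at s within {0..T})"
      by (intro has_vector_derivative_diff y1 y2 s)
    have "inner (y1 s - y2 s) (F (y1 s) - F (y2 s)) \<le> norm (y1 s - y2 s) * norm (F (y1 s) - F (y2 s))"
      by (rule norm_cauchy_schwarz)
    also have "\<dots> \<le> norm (y1 s - y2 s) * (L * norm (y1 s - y2 s))"
      using R[OF s] by (intro mult_left_mono L) auto
    finally show "2 * inner (y1 s - y2 s) (F (y1 s) - F (y2 s)) \<le> 2 * L * (norm (y1 s - y2 s))\<^sup>2"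
      by (simp add: power2_eq_square algebra_simps)
  qed
  then show ?thesis by (simp add: eq)
qed

section \<open>Projection onto a ball, and existence under an energy bound\<close>

definition radial_projection :: "real \<Rightarrow> 'a::real_normed_vector \<Rightarrow> 'a" where
  "radial_projection R x = (if norm x \<le> R then x else (R / norm x) *\<^sub>R x)"

lemma norm_radial_projection: "R > 0 \<Longrightarrow> norm (radial_projection R x) \<le> R"
  by (auto simp: radial_projection_def)

lemma radial_projection_scale:
  assumes "R > 0"
  obtains k where "0 < k" "k \<le> 1" "radial_projection R x = k *\<^sub>R x" "k * norm x \<le> R"
proof (cases "norm x \<le> R")
  case True
  then show ?thesis by (intro that[of 1]) (auto simp: radial_projection_def)
next
  case False
  then have "0 < norm x" using assms by linarith
  with False assms show ?thesis by (intro that[of "R / norm x"]) (auto simp: radial_projection_def)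
qed

text \<open>The triangle inequality alone gives the constant 2, in any normed space: the radial part
  of the displacement is paid for by a difference of norms, which is again at most norm (x -
  y).\<close>

lemma radial_projection_lipschitz:
  assumes R: "R > 0"
  shows "norm (radial_projection R x - radial_projection R y) \<le> 2 * norm (x - y)"
proof -
  have *: "norm (radial_projection R x - radial_projection R y) \<le> 2 * norm (x - y)"
    if le: "norm x \<le> norm y" for x y :: 'a
  proof (cases "norm y \<le> R")
    case True with le show ?thesis by (simp add: radial_projection_def)
  next
    case y: False
    show ?thesis
    proof (cases "norm x \<le> R")
      case True
      have "norm (x - (R / norm y) *\<^sub>R y) \<le> norm (x - y) + norm (y - (R / norm y) *\<^sub>R y)"
        by (rule order_trans[OF _ norm_triangle_ineq]) simp
      also have "y - (R / norm y) *\<^sub>R y = (1 - R / norm y) *\<^sub>R y" by (simp add: algebra_simps)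
      also have "norm \<dots> = (1 - R / norm y) * norm y"
      proof -
        have "norm y > 0" using y R by linarith
        then have "R / norm y \<le> 1" using y by (subst divide_le_eq) auto
        then show ?thesis by simp
      qed
      also have "\<dots> = norm y - R" using y R by (cases "y = 0") (auto simp: field_simps)
      also have "norm y - R \<le> norm (x - y)"
        using True norm_triangle_ineq3[of y x] by (simp add: norm_minus_commute)
      finally show ?thesis using True y by (simp add: radial_projection_def)
    next
      case False
      have xp: "norm x > 0" "norm y > 0" using False y R by linarith+
      then have q: "R / norm x \<le> 1" using False by (simp add: divide_le_eq)
      have "(R / norm x) *\<^sub>R x - (R / norm y) *\<^sub>R y = (R / norm x) *\<^sub>R (x - y) + (R / norm x - R / norm y) *\<^sub>R y"
        by (simp add: algebra_simps)
      then have "norm ((R / norm x) *\<^sub>R x - (R / norm y) *\<^sub>R y) \<le> R / norm x * norm (x - y) + \<bar>R / norm x - R / norm y\<bar> * norm y"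
        using R by (metis (mono_tags, lifting) norm_triangle_ineq norm_scaleR abs_of_nonneg divide_nonneg_nonneg less_imp_le norm_ge_zero)
      also have "\<bar>R / norm x - R / norm y\<bar> * norm y = R / norm x * (norm y - norm x)"
        using xp R le by (subst abs_of_nonneg) (auto simp: field_simps frac_le)
      also have "R / norm x * norm (x - y) + R / norm x * (norm y - norm x) \<le> 1 * norm (x - y) + 1 * norm (x - y)"
        using q R le norm_triangle_ineq3[of y x] by (intro add_mono mult_mono) (auto simp: norm_minus_commute)
      finally show ?thesis using False y by (simp add: radial_projection_def)
    qed
  qed
  show ?thesis using *[of x y] *[of y x] by (cases "norm x \<le> norm y") (auto simp: norm_minus_commute)
qed

text \<open>The field is composed with the projection onto a ball, which makes the equation globally
  solvable. By Gronwall's inequality the solution stays in the ball, where nothing has been changed.\<close>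

lemma ODE_exists:
  fixes F :: "'a::{real_inner, banach} \<Rightarrow> 'a"
  assumes lip: "\<And>R. \<exists>L. \<forall>x y. norm x \<le> R \<longrightarrow> norm y \<le> R \<longrightarrow> norm (F x - F y) \<le> L * norm (x - y)"
    and energy: "\<And>x. inner x (F x) \<le> K * norm x ^ 3"
    and K: "K \<ge> 0" and R: "R > 0" "3 * norm x0 \<le> R" and T: "T \<ge> 0" "K * R * T \<le> 1"
  obtains y where "y 0 = x0" "\<And>t. t \<in> {0..T} \<Longrightarrow> (y has_vector_derivative F (y t)) (at t within {0..T})"
proof -
  obtain L0 where L0: "\<And>x y. norm x \<le> R \<Longrightarrow> norm y \<le> R \<Longrightarrow> norm (F x - F y) \<le> L0 * norm (x - y)"
    using lip by blast
  define L where "L = \<bar>L0\<bar> + 1"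
  let ?P = "radial_projection R :: 'a \<Rightarrow> 'a"
  have lipG: "norm (F (?P x) - F (?P y)) \<le> (2 * L) * norm (x - y)" for x y
  proof -
    have "norm (F (?P x) - F (?P y)) \<le> L0 * norm (?P x - ?P y)"
      using R by (intro L0 norm_radial_projection)
    also have "\<dots> \<le> L * norm (?P x - ?P y)" by (intro mult_right_mono) (auto simp: L_def)
    also have "\<dots> \<le> L * (2 * norm (x - y))"
      by (intro mult_left_mono radial_projection_lipschitz R) (auto simp: L_def)
    finally show ?thesis by simp
  qed
  have "2 * L > 0" by (simp add: L_def)
  then obtain y where y0: "y 0 = x0"
    and y: "\<And>t. t \<in> {0..T} \<Longrightarrow> (y has_vector_derivative F (?P (y t))) (at t within {0..T})"
    using global_Picard[where G="\<lambda>x. F (?P x)" and L="2 * L" and T=T] lipG T(1) by metis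
  \<comment> \<open>Pairing with \<open>x\<close> is 1 / k times pairing with \<open>?P x\<close> =
    k x, so the cubic bound becomes K k^2 (norm x)^3. With k <= 1 and k norm x <= R it turns into a
    quadratic bound, to which the linear Gronwall inequality applies.\<close>
  have en: "inner x (F (?P x)) \<le> K * R * (norm x)\<^sup>2" for x
  proof -
    obtain k where l: "0 < k" "k \<le> 1" "?P x = k *\<^sub>R x" "k * norm x \<le> R"
      using radial_projection_scale[OF R(1)] by blast
    have "k * inner x (F (?P x)) = inner (?P x) (F (?P x))" by (simp add: l)
    also have "\<dots> \<le> K * norm (?P x) ^ 3" by (rule energy)
    also have "\<dots> = k * (K * (k * (k * norm x)) * (norm x)\<^sup>2)"
      using l by (simp add: power3_eq_cube power2_eq_square)
    finally have "inner x (F (?P x)) \<le> K * (k * (k * norm x)) * (norm x)\<^sup>2"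
      using l(1) by simp
    also have "\<dots> \<le> K * R * (norm x)\<^sup>2"
    proof (intro mult_right_mono mult_left_mono K)
      have "k * (k * norm x) \<le> 1 * (k * norm x)" using l by (intro mult_right_mono) auto
      then show "k * (k * norm x) \<le> R" using l(4) by simp
    qed auto
    finally show ?thesis .
  qed
  have bd: "norm (y t) \<le> R" if t: "t \<in> {0..T}" for t
  proof -
    have "(norm (y t))\<^sup>2 \<le> (norm (y 0))\<^sup>2 * exp (2 * K * R * t)"
      by (rule differential_Gronwall[OF has_real_derivative_norm_square[OF y] _ t])
         (use en in \<open>auto simp: mult.assoc\<close>)
    also have "exp (2 * K * R * t) \<le> exp 2"
    proof -
      have "K * R * t \<le> K * R * T" using t K R by (intro mult_left_mono) auto
      then show ?thesis using T by simp
    qed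
    \<comment> \<open>The squared norm grows at rate at most 2 K R, and K R T <= 1, so it gains at
      most a factor exp 2 <= 9. This is the origin of the 3 in
      \<open>3 * norm x0 \<le> R\<close>.\<close>
    also have "exp 2 \<le> (3::real)\<^sup>2"
      using exp_le power_mono[of "exp 1" "3::real" 2] by (simp flip: exp_of_nat_mult)
    finally have "(norm (y t))\<^sup>2 \<le> (3 * norm x0)\<^sup>2"
      by (simp add: y0 power_mult_distrib mult_left_mono)
    then have "norm (y t) \<le> 3 * norm x0" by (rule power2_le_imp_le) simp
    then show ?thesis using R by simp
  qed
  show ?thesis
    by (rule that[of y, OF y0]) (use y bd in \<open>auto simp: radial_projection_def\<close>)
qed

section \<open>Square integrable functions\<close>

lemma integrable_inverse_1_plus_square_lborel: "integrable lborel (\<lambda>x::real. 1 / (1 + x\<^sup>2))"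
  using integrable_inverse_1_plus_square by (simp add: set_integrable_def einterval_def divide_inverse)

text \<open>A Bochner integral, hence 0 for a measurable function outside \<open>L2\<close>; for
  this reason the triangle inequalities below assume membership in \<open>L2\<close>.\<close>

definition l2n :: "(real \<Rightarrow> complex) \<Rightarrow> real" where
  "l2n f = sqrt (LINT x|lborel. (norm (f x))\<^sup>2)"

lemma l2n_nonneg [simp]: "l2n f \<ge> 0" by (simp add: l2n_def)

lemma l2n_square: "(l2n f)\<^sup>2 = (LINT x|lborel. (norm (f x))\<^sup>2)"
  by (simp add: l2n_def)

lemma L2_measurable [measurable_dest]: "f \<in> L2 \<Longrightarrow> f \<in> borel_measurable borel"
  by (simp add: L2_def)

lemma L2_integrable: "f \<in> L2 \<Longrightarrow> integrable lborel (\<lambda>x. (norm (f x))\<^sup>2)"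
  by (simp add: L2_def)

lemma L2_iff: "f \<in> L2 \<longleftrightarrow> f \<in> borel_measurable borel \<and> (\<integral>\<^sup>+x. ennreal ((norm (f x))\<^sup>2) \<partial>lborel) < \<infinity>"
  by (auto simp: L2_def integrable_iff_bounded)

lemma L2_nn: "f \<in> L2 \<Longrightarrow> (\<integral>\<^sup>+x. ennreal ((norm (f x))\<^sup>2) \<partial>lborel) = ennreal ((l2n f)\<^sup>2)"
  unfolding l2n_square by (intro nn_integral_eq_integral L2_integrable) auto

lemma L2_bound:
  assumes "g \<in> L2" "f \<in> borel_measurable borel" "AE x in lborel. norm (f x) \<le> C * norm (g x)"
  shows "f \<in> L2"
  unfolding L2_def
proof (intro CollectI conjI)
  show "integrable lborel (\<lambda>x. (norm (f x))\<^sup>2)"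
  proof (rule Bochner_Integration.integrable_bound)
    show "integrable lborel (\<lambda>x. C\<^sup>2 * (norm (g x))\<^sup>2)" using assms by (auto intro: L2_integrable)
    show "AE x in lborel. norm ((norm (f x))\<^sup>2) \<le> norm (C\<^sup>2 * (norm (g x))\<^sup>2)"
      using assms(3) by eventually_elim (auto simp flip: power_mult_distrib intro!: power_mono)
  qed (use assms in simp)
qed (use assms in simp)

lemma L2_AE_cong: "g \<in> L2 \<Longrightarrow> f \<in> borel_measurable borel \<Longrightarrow> AE x in lborel. f x = g x \<Longrightarrow> f \<in> L2"
  by (rule L2_bound[of g f 1]) auto

lemma L2_zero [simp]: "(\<lambda>x. 0) \<in> L2" by (simp add: L2_def)

lemma L2_add: assumes f: "f \<in> L2" and g: "g \<in> L2" shows "(\<lambda>x. f x + g x) \<in> L2"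
  unfolding L2_def
proof (intro CollectI conjI)
  have [measurable]: "f \<in> borel_measurable borel" "g \<in> borel_measurable borel" using f g by (auto intro: L2_measurable)
  show "(\<lambda>x. f x + g x) \<in> borel_measurable lborel" by simp
  show "integrable lborel (\<lambda>x. (norm (f x + g x))\<^sup>2)"
  proof (rule Bochner_Integration.integrable_bound)
    show "integrable lborel (\<lambda>x. 2 * (norm (f x))\<^sup>2 + 2 * (norm (g x))\<^sup>2)"
      by (intro Bochner_Integration.integrable_add integrable_mult_right L2_integrable f g)
    have "(norm (f x + g x))\<^sup>2 \<le> 2 * (norm (f x))\<^sup>2 + 2 * (norm (g x))\<^sup>2" for x
    proof -
      have "(norm (f x + g x))\<^sup>2 \<le> (norm (f x) + norm (g x))\<^sup>2" by (intro power_mono norm_triangle_ineq) auto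
      also have "\<dots> \<le> 2 * (norm (f x))\<^sup>2 + 2 * (norm (g x))\<^sup>2"
        using sum_squares_bound[of "norm (f x)" "norm (g x)"] by (simp add: power2_sum)
      finally show ?thesis .
    qed
    then show "AE x in lborel. norm ((norm (f x + g x))\<^sup>2) \<le> norm (2 * (norm (f x))\<^sup>2 + 2 * (norm (g x))\<^sup>2)"
      by (intro AE_I2) auto
  qed simp
qed

lemma L2_cmult: "f \<in> L2 \<Longrightarrow> (\<lambda>x. c * f x) \<in> L2"
  by (rule L2_bound[of f _ "norm c"]) (auto simp: norm_mult)

lemma L2_bounded_mult:
  assumes "f \<in> L2" "a \<in> borel_measurable borel" "\<And>x. norm (a x) \<le> C"
  shows "(\<lambda>x. a x * f x) \<in> L2"
  by (rule L2_bound[of f _ C])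
     (use L2_measurable[of f] assms in \<open>auto simp: norm_mult intro!: mult_right_mono\<close>)

lemma L2_diff: "f \<in> L2 \<Longrightarrow> g \<in> L2 \<Longrightarrow> (\<lambda>x. f x - g x) \<in> L2"
  using L2_add[of f "\<lambda>x. -1 * g x"] L2_cmult[of g "-1"] by simp

lemma cnj_measurable [measurable]: "cnj \<in> borel_measurable borel"
  by (intro borel_measurable_continuous_onI continuous_intros)

lemma L2_cnj: "f \<in> L2 \<Longrightarrow> (\<lambda>x. cnj (f x)) \<in> L2"
  by (rule L2_bound[of f _ 1]) auto

lemma L2_affine: assumes f: "f \<in> L2" and c: "c \<noteq> 0" shows "(\<lambda>x. f (t + c * x)) \<in> L2"
  using L2_measurable[OF f] lborel_integrable_real_affine[OF L2_integrable[OF f] c, of t] by (simp add: L2_def)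

lemma L2_shift: "f \<in> L2 \<Longrightarrow> (\<lambda>x. f (x + t)) \<in> L2"
  using L2_affine[of f 1 t] by (simp add: add.commute)

lemma l2n_affine: "\<bar>c\<bar> = 1 \<Longrightarrow> l2n (\<lambda>x. f (t + c * x)) = l2n f"
  using lborel_integral_real_affine[of c "\<lambda>x. (norm (f x))\<^sup>2" t] by (auto simp: l2n_def)

lemma l2n_shift: "l2n (\<lambda>x. f (x + t)) = l2n f"
  using l2n_affine[of 1 f t] by (simp add: add.commute)

lemma L2_mult_integrable:
  assumes f: "f \<in> L2" and g: "g \<in> L2" shows "integrable lborel (\<lambda>x. f x * g x)"
proof (rule Bochner_Integration.integrable_bound)
  have [measurable]: "f \<in> borel_measurable borel" "g \<in> borel_measurable borel" using f g by (auto intro: L2_measurable)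
  show "integrable lborel (\<lambda>x. (norm (f x))\<^sup>2 + (norm (g x))\<^sup>2)"
    using f g by (auto intro: L2_integrable)
  have "2 * (norm (f x) * norm (g x)) \<le> (norm (f x))\<^sup>2 + (norm (g x))\<^sup>2" for x
    using sum_squares_bound[of "norm (f x)" "norm (g x)"] by simp
  moreover have "0 \<le> norm (f x) * norm (g x)" for x by simp
  ultimately have "norm (f x) * norm (g x) \<le> (norm (f x))\<^sup>2 + (norm (g x))\<^sup>2" for x
    by (smt (verit))
  then show "AE x in lborel. norm (f x * g x) \<le> norm ((norm (f x))\<^sup>2 + (norm (g x))\<^sup>2)"
    by (intro AE_I2) (auto simp: norm_mult)
  show "(\<lambda>x. f x * g x) \<in> borel_measurable lborel" by simp
qed

lemma L2_Cauchy_Schwarz: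
  assumes f: "f \<in> L2" and g: "g \<in> L2"
  shows "(LINT x|lborel. norm (f x) * norm (g x)) \<le> l2n f * l2n g"
proof -
  have [measurable]: "f \<in> borel_measurable borel" "g \<in> borel_measurable borel" using f g by (auto intro: L2_measurable)
  have int: "integrable lborel (\<lambda>x. norm (f x) * norm (g x))"
    using integrable_norm[OF L2_mult_integrable[OF f g]] by (simp add: norm_mult)
  have "(\<integral>\<^sup>+x. ennreal (norm (f x)) * ennreal (norm (g x)) \<partial>lborel)\<^sup>2
     \<le> (\<integral>\<^sup>+x. ennreal (norm (f x)) ^ 2 \<partial>lborel) * (\<integral>\<^sup>+x. ennreal (norm (g x)) ^ 2 \<partial>lborel)"
    by (rule Cauchy_Schwarz_nn_integral) auto
  also have "\<dots> = ennreal ((l2n f)\<^sup>2 * (l2n g)\<^sup>2)"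
    using L2_nn[OF f] L2_nn[OF g] by (simp add: ennreal_power ennreal_mult)
  also have "(\<integral>\<^sup>+x. ennreal (norm (f x)) * ennreal (norm (g x)) \<partial>lborel) = ennreal (LINT x|lborel. norm (f x) * norm (g x))"
    by (subst nn_integral_eq_integral[OF int, symmetric]) (auto simp: ennreal_mult)
  finally have "(LINT x|lborel. norm (f x) * norm (g x))\<^sup>2 \<le> (l2n f * l2n g)\<^sup>2"
    by (simp add: ennreal_power power_mult_distrib)
  then show ?thesis by (rule power2_le_imp_le) simp
qed

lemma L2_Cauchy_Schwarz':
  assumes f: "f \<in> L2" and g: "g \<in> L2"
  shows "norm (LINT x|lborel. f x * g x) \<le> l2n f * l2n g"
  using integral_norm_bound[of lborel "\<lambda>x. f x * g x"] L2_Cauchy_Schwarz[OF f g]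
  by (simp add: norm_mult)

text \<open>Multiplying by \<open>1 / (1 + x\<^sup>2)\<close> turns an \<open>L\<^sup>2\<close>-Cauchy sequence into an \<open>L\<^sup>1\<close>-Cauchy one, for which
  the library provides an almost everywhere convergent subsequence.\<close>

lemma Riesz_Fischer:
  fixes f :: "nat \<Rightarrow> real \<Rightarrow> complex"
  assumes f: "\<And>n. f n \<in> L2"
    and cauchy: "\<And>e. e > 0 \<Longrightarrow> \<exists>N. \<forall>i\<ge>N. \<forall>j\<ge>N. l2n (\<lambda>x. f i x - f j x) < e"
  obtains g where "g \<in> L2" "(\<lambda>n. l2n (\<lambda>x. f n x - g x)) \<longlonglongrightarrow> 0"
proof -
  have [measurable]: "f n \<in> borel_measurable borel" for n using f by (rule L2_measurable)
  define k :: "real \<Rightarrow> complex" where "k x = complex_of_real (1 / (1 + x\<^sup>2))" for x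
  have [measurable]: "k \<in> borel_measurable borel" unfolding k_def by measurable
  have pos: "1 + x\<^sup>2 > 0" for x :: real by (simp add: add_pos_nonneg)
  have k0: "k x \<noteq> 0" for x unfolding k_def of_real_eq_0_iff using pos[of x] by auto
  have k2: "k \<in> L2"
    unfolding L2_def
  proof (intro CollectI conjI)
    show "integrable lborel (\<lambda>x. (norm (k x))\<^sup>2)"
    proof (rule Bochner_Integration.integrable_bound[OF integrable_inverse_1_plus_square_lborel])
      have "(norm (k x))\<^sup>2 \<le> 1 / (1 + x\<^sup>2)" for x
        unfolding k_def norm_of_real using pos[of x] power_decreasing[of 1 2 "1 / (1 + x\<^sup>2)"] by (simp add: abs_of_pos)
      then show "AE x in lborel. norm ((norm (k x))\<^sup>2) \<le> norm (1 / (1 + x\<^sup>2))" using pos by (intro AE_I2) auto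
    qed simp
  qed simp
  define s where "s n x = k x * f n x" for n x
  have sint: "integrable lborel (s n)" for n unfolding s_def by (rule L2_mult_integrable[OF k2 f])
  have "\<exists>N. \<forall>i\<ge>N. \<forall>j\<ge>N. LINT x|lborel. norm (s i x - s j x) < e" if "e > 0" for e
  proof -
    have "e / (l2n k + 1) > 0" using that by (simp add: add_nonneg_pos)
    then obtain N where N: "\<And>i j. i \<ge> N \<Longrightarrow> j \<ge> N \<Longrightarrow> l2n (\<lambda>x. f i x - f j x) < e / (l2n k + 1)"
      using cauchy by meson
    show ?thesis
    proof (intro exI allI impI)
      fix i j assume ij: "i \<ge> N" "j \<ge> N"
      have "(LINT x|lborel. norm (s i x - s j x)) = (LINT x|lborel. norm (k x) * norm (f i x - f j x))"
        by (simp add: s_def flip: norm_mult right_diff_distrib)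
      also have "\<dots> \<le> l2n k * l2n (\<lambda>x. f i x - f j x)"
        by (intro L2_Cauchy_Schwarz k2 L2_diff f)
      also have "\<dots> \<le> l2n k * (e / (l2n k + 1))" using N[OF ij] by (intro mult_left_mono) auto
      also have "\<dots> < e"
        using that add_nonneg_pos[OF l2n_nonneg[of k] zero_less_one] by (simp add: pos_divide_less_eq algebra_simps)
      finally show "(LINT x|lborel. norm (s i x - s j x)) < e" .
    qed
  qed
  then obtain r where r: "strict_mono r" and ae: "AE x in lborel. Cauchy (\<lambda>i. s (r i) x)"
    by (rule cauchy_L1_AE_cauchy_subseq[of lborel s, OF sint]) auto
  define g where "g x = lim (\<lambda>i. f (r i) x)" for x
  have [measurable]: "g \<in> borel_measurable borel" unfolding g_def by measurable
  have lim: "AE x in lborel. (\<lambda>i. f (r i) x) \<longlonglongrightarrow> g x"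
    using ae
  proof eventually_elim
    case (elim x)
    then have "convergent (\<lambda>i. s (r i) x)" by (rule Cauchy_convergent)
    then have "convergent (\<lambda>i. inverse (k x) * s (r i) x)" by (intro convergent_mult convergent_const)
    then have "convergent (\<lambda>i. f (r i) x)" by (simp add: s_def k0 flip: mult.assoc)
    then show ?case by (simp add: convergent_LIMSEQ_iff g_def)
  qed
  \<comment> \<open>Fatou's lemma along the subsequence: the distance from \<open>f n\<close> to the
    pointwise limit is at most the liminf of its distances to \<open>f (r i)\<close>. The integral
    is the nonnegative one because it is not yet known that the limit lies in
    \<open>L2\<close>.\<close>
  have fatou: "\<exists>N. \<forall>n\<ge>N. (\<integral>\<^sup>+x. ennreal ((norm (f n x - g x))\<^sup>2) \<partial>lborel) \<le> ennreal (e\<^sup>2)" if e: "e > 0" for e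
  proof -
    obtain N where N: "\<And>i j. i \<ge> N \<Longrightarrow> j \<ge> N \<Longrightarrow> l2n (\<lambda>x. f i x - f j x) < e"
      using cauchy[OF e] by blast
    show ?thesis
    proof (intro exI allI impI)
      fix n assume n: "n \<ge> N"
      have "(\<integral>\<^sup>+x. ennreal ((norm (f n x - g x))\<^sup>2) \<partial>lborel)
        = (\<integral>\<^sup>+x. liminf (\<lambda>i. ennreal ((norm (f n x - f (r i) x))\<^sup>2)) \<partial>lborel)"
      proof (rule nn_integral_cong_AE, use lim in eventually_elim)
        case (elim x)
        then have "(\<lambda>i. ennreal ((norm (f n x - f (r i) x))\<^sup>2)) \<longlonglongrightarrow> ennreal ((norm (f n x - g x))\<^sup>2)"
          by (intro tendsto_intros)
        then show ?case by (intro lim_imp_Liminf[symmetric]) auto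
      qed
      also have "\<dots> \<le> liminf (\<lambda>i. \<integral>\<^sup>+x. ennreal ((norm (f n x - f (r i) x))\<^sup>2) \<partial>lborel)"
        by (rule nn_integral_liminf) simp
      also have "\<dots> \<le> limsup (\<lambda>i. \<integral>\<^sup>+x. ennreal ((norm (f n x - f (r i) x))\<^sup>2) \<partial>lborel)"
        by (rule Liminf_le_Limsup) simp
      also have "\<dots> \<le> ennreal (e\<^sup>2)"
      proof (rule Limsup_bounded, rule eventually_sequentiallyI[of N])
        fix i assume "N \<le> i"
        then have "N \<le> r i" using seq_suble[OF r, of i] by linarith
        then have "(l2n (\<lambda>x. f n x - f (r i) x))\<^sup>2 \<le> e\<^sup>2" using N[OF n] by (intro power_mono) (auto simp: less_imp_le)
        then show "(\<integral>\<^sup>+x. ennreal ((norm (f n x - f (r i) x))\<^sup>2) \<partial>lborel) \<le> ennreal (e\<^sup>2)"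
          by (simp add: L2_nn[OF L2_diff[OF f f]] ennreal_leI)
      qed
      finally show "(\<integral>\<^sup>+x. ennreal ((norm (f n x - g x))\<^sup>2) \<partial>lborel) \<le> ennreal (e\<^sup>2)" .
    qed
  qed
  obtain N0 where "(\<integral>\<^sup>+x. ennreal ((norm (f N0 x - g x))\<^sup>2) \<partial>lborel) \<le> ennreal (1\<^sup>2)"
    using fatou[of 1] by auto
  then have "(\<lambda>x. f N0 x - g x) \<in> L2" unfolding L2_iff by (auto intro: order.strict_trans1)
  from L2_diff[OF f this, of N0] have g: "g \<in> L2" by simp
  have "(\<lambda>n. l2n (\<lambda>x. f n x - g x)) \<longlonglongrightarrow> 0"
  proof (rule LIMSEQ_I)
    fix e :: real assume e: "e > 0"
    obtain N where "\<forall>n\<ge>N. (\<integral>\<^sup>+x. ennreal ((norm (f n x - g x))\<^sup>2) \<partial>lborel) \<le> ennreal ((e / 2)\<^sup>2)"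
      using fatou[of "e / 2"] e by auto
    then have "\<forall>n\<ge>N. (l2n (\<lambda>x. f n x - g x))\<^sup>2 \<le> (e / 2)\<^sup>2"
      by (simp add: L2_nn[OF L2_diff[OF f g]])
    then have "\<forall>n\<ge>N. l2n (\<lambda>x. f n x - g x) \<le> e / 2"
      using e by (auto intro: power2_le_imp_le)
    then show "\<exists>no. \<forall>n\<ge>no. norm (l2n (\<lambda>x. f n x - g x) - 0) < e" using e by force
  qed
  with g show ?thesis by (rule that)
qed

section \<open>The Fourier transform\<close>

lemma
  fixes f :: "real \<Rightarrow> 'a::{banach, second_countable_topology}"
  shows integrable_shift: "integrable lborel f \<Longrightarrow> integrable lborel (\<lambda>x. f (x + t))"
    and integral_shift: "(LINT x|lborel. f (x + t)) = (LINT x|lborel. f x)"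
  using lborel_integrable_real_affine[of f 1 t] lborel_integral_real_affine[of 1 f t]
  by (simp_all add: add.commute)

text \<open>The induction rule for integrable functions reduces this to indicators. There the Borel
  set is replaced by an open superset of nearly the same measure: a point of an open set stays
  inside under small shifts.\<close>

lemma translation_continuous_L1:
  fixes f :: "real \<Rightarrow> 'a::{banach, second_countable_topology}"
  assumes f: "integrable lborel f" and X: "X \<longlonglongrightarrow> 0"
  shows "(\<lambda>n. LINT x|lborel. norm (f (x + X n) - f x)) \<longlonglongrightarrow> 0"
  using f
proof (induction f rule: integrable_induct)
  case (base A c)
  have A[measurable]: "A \<in> sets borel" using base by simp
  note sh = integrable_shift integral_shift
  have "(\<lambda>n. LINT x|lborel. \<bar>indicat_real A (x + X n) - indicat_real A x\<bar>) \<longlonglongrightarrow> 0"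
  proof (rule LIMSEQ_I)
    fix e :: real assume e: "e > 0"
    obtain U where U: "open U" "A \<subseteq> U" and mU: "emeasure lborel (U - A) < ennreal (e / 4)"
      using outer_regular_lborel[OF A, of "e / 4"] e by auto
    have [measurable]: "U \<in> sets borel" using U(1) by simp
    have "emeasure lborel (U - A) < \<infinity>" using mU by (rule order.strict_trans) simp
    then have iUA: "integrable lborel (indicat_real (U - A))" by simp
    have iA: "integrable lborel (indicat_real A)" using base by auto
    have eqU: "indicat_real U x = indicat_real A x + indicat_real (U - A) x" for x
      using U(2) by (auto simp: indicator_def)
    have iU: "integrable lborel (indicat_real U)"
      unfolding eqU[abs_def] using iA iUA by (rule Bochner_Integration.integrable_add)
    have mUA: "(LINT x|lborel. indicat_real (U - A) x) < e / 4"
    proof -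
      have "ennreal (measure lborel (U - A)) < ennreal (e / 4)"
        using mU by (subst emeasure_eq_ennreal_measure[symmetric]) (auto simp: less_top[symmetric])
      then show ?thesis using e by (simp add: ennreal_less_iff)
    qed
    have "(\<lambda>n. LINT x|lborel. indicat_real U x * (1 - indicat_real U (x + X n))) \<longlonglongrightarrow> integral\<^sup>L lborel (\<lambda>x::real. 0::real)"
    proof (rule integral_dominated_convergence[where w="indicat_real U"])
      show "AE x in lborel. (\<lambda>n. indicat_real U x * (1 - indicat_real U (x + X n))) \<longlonglongrightarrow> 0"
      proof (intro AE_I2)
        fix x
        have "\<forall>\<^sub>F n in sequentially. indicat_real U x * (1 - indicat_real U (x + X n)) = 0"
        proof (cases "x \<in> U")
          case True
          have "(\<lambda>n. x + X n) \<longlonglongrightarrow> x + 0" using X by (intro tendsto_intros)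
          then have "\<forall>\<^sub>F n in sequentially. x + X n \<in> U" using U(1) True by (auto dest: topological_tendstoD)
          then show ?thesis by eventually_elim auto
        qed auto
        then show "(\<lambda>n. indicat_real U x * (1 - indicat_real U (x + X n))) \<longlonglongrightarrow> 0" by (rule tendsto_eventually)
      qed
    qed (use iU in \<open>auto simp: indicator_def\<close>)
    then have "\<forall>\<^sub>F n in sequentially. (LINT x|lborel. indicat_real U x * (1 - indicat_real U (x + X n))) < e / 4"
      using e by (intro order_tendstoD) auto
    then obtain N where N: "\<And>n. n \<ge> N \<Longrightarrow> (LINT x|lborel. indicat_real U x * (1 - indicat_real U (x + X n))) < e / 4"
      unfolding eventually_sequentially by blast
    show "\<exists>N. \<forall>n\<ge>N. norm ((LINT x|lborel. \<bar>indicat_real A (x + X n) - indicat_real A x\<bar>) - 0) < e"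
    proof (intro exI allI impI)
      fix n assume n: "n \<ge> N"
      let ?U = "\<lambda>x. indicat_real U x * (1 - indicat_real U (x + X n))"
      have iq: "integrable lborel ?U"
        by (rule Bochner_Integration.integrable_bound[OF iU]) (auto simp: indicator_def)
      \<comment> \<open>With p and q the values of the indicator of \<open>U\<close> at
        \<open>x + X n\<close> and at \<open>x\<close>, |p - q| = 2 q (1 - p) + (p - q), and p - q
        integrates to 0. The last two terms pay for replacing \<open>A\<close> by
        \<open>U\<close>.\<close>
      let ?R = "\<lambda>x. 2 * ?U x + (indicat_real U (x + X n) - indicat_real U x) + indicat_real (U - A) (x + X n) + indicat_real (U - A) x"
      have "(LINT x|lborel. \<bar>indicat_real A (x + X n) - indicat_real A x\<bar>) \<le> (LINT x|lborel. ?R x)"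
      proof (rule integral_mono_AE)
        show "integrable lborel ?R" using iq iU iUA sh(1)[OF iU] sh(1)[OF iUA] by auto
        show "integrable lborel (\<lambda>x. \<bar>indicat_real A (x + X n) - indicat_real A x\<bar>)"
          using iA sh(1)[OF iA] by auto
        show "AE x in lborel. \<bar>indicat_real A (x + X n) - indicat_real A x\<bar> \<le> ?R x"
          using U(2) by (intro AE_I2) (auto simp: indicator_def)
      qed
      also have "\<dots> = 2 * (LINT x|lborel. ?U x) + 2 * (LINT x|lborel. indicat_real (U - A) x)"
        using iq iU iUA sh(1)[OF iU] sh(1)[OF iUA] by (simp add: sh(2)[of "indicat_real U"] sh(2)[of "indicat_real (U - A)"])
      also have "\<dots> < e" using N[OF n] mUA by linarith
      finally have "(LINT x|lborel. \<bar>indicat_real A (x + X n) - indicat_real A x\<bar>) < e" .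
      moreover have "(LINT x|lborel. \<bar>indicat_real A (x + X n) - indicat_real A x\<bar>) \<ge> 0" by simp
      ultimately show "norm ((LINT x|lborel. \<bar>indicat_real A (x + X n) - indicat_real A x\<bar>) - 0) < e" by simp
    qed
  qed
  then have "(\<lambda>n. (LINT x|lborel. \<bar>indicat_real A (x + X n) - indicat_real A x\<bar>) * norm c) \<longlonglongrightarrow> 0 * norm c"
    by (intro tendsto_intros)
  then show ?case by (simp flip: scaleR_diff_left)
next
  case (add f g)
  show ?case
  proof (rule tendsto_sandwich[OF _ _ tendsto_const])
    show "(\<lambda>n. (LINT x|lborel. norm (f (x + X n) - f x)) + (LINT x|lborel. norm (g (x + X n) - g x))) \<longlonglongrightarrow> 0"
      using tendsto_add[OF add(3,4)] by simp
    show "\<forall>\<^sub>F n in sequentially. (LINT x|lborel. norm (f (x + X n) + g (x + X n) - (f x + g x)))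
        \<le> (LINT x|lborel. norm (f (x + X n) - f x)) + (LINT x|lborel. norm (g (x + X n) - g x))"
    proof (intro always_eventually allI)
      fix n
      have i: "integrable lborel (\<lambda>x. norm (f (x + X n) - f x))" "integrable lborel (\<lambda>x. norm (g (x + X n) - g x))"
        by (intro integrable_norm Bochner_Integration.integrable_diff integrable_shift add(1,2))+
      show "(LINT x|lborel. norm (f (x + X n) + g (x + X n) - (f x + g x)))
        \<le> (LINT x|lborel. norm (f (x + X n) - f x)) + (LINT x|lborel. norm (g (x + X n) - g x))"
        unfolding Bochner_Integration.integral_add[OF i, symmetric]
      proof (rule integral_mono)
        show "norm (f (x + X n) + g (x + X n) - (f x + g x)) \<le> norm (f (x + X n) - f x) + norm (g (x + X n) - g x)" for x
          by (rule order_trans[OF _ norm_triangle_ineq]) (simp add: algebra_simps)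
      qed (intro integrable_norm Bochner_Integration.integrable_diff Bochner_Integration.integrable_add integrable_shift add(1,2))+
    qed
  qed auto
next
  case (lim f s)
  note sh = integrable_shift
  have s0: "(\<lambda>i. LINT x|lborel. norm (s i x - f x)) \<longlonglongrightarrow> integral\<^sup>L lborel (\<lambda>x::real. norm (0::'a))"
  proof (rule integral_dominated_convergence[where w="\<lambda>x. 3 * norm (f x)"])
    show "AE x in lborel. (\<lambda>i. norm (s i x - f x)) \<longlonglongrightarrow> norm (0::'a)"
    proof (intro AE_I2 tendsto_norm)
      fix x show "(\<lambda>i. s i x - f x) \<longlonglongrightarrow> 0" using lim(2)[of x] by (simp add: LIM_zero)
    qed
    show "AE x in lborel. norm (norm (s i x - f x)) \<le> 3 * norm (f x)" for i
    proof (intro AE_I2)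
      fix x show "norm (norm (s i x - f x)) \<le> 3 * norm (f x)"
        using lim(3)[of x i] norm_triangle_ineq4[of "s i x" "f x"] by simp
    qed
    show "integrable lborel (\<lambda>x. 3 * norm (f x))" using lim(4) by simp
    show "(\<lambda>x. norm (s i x - f x)) \<in> borel_measurable lborel" for i
      using borel_measurable_integrable[OF lim(1)] borel_measurable_integrable[OF lim(4)] by measurable
  qed auto
  show ?case
  proof (rule LIMSEQ_I)
    fix e :: real assume e: "e > 0"
    have "\<forall>\<^sub>F i in sequentially. (LINT x|lborel. norm (s i x - f x)) < e / 3"
      using s0 e by (intro order_tendstoD) auto
    then obtain i where i: "(LINT x|lborel. norm (s i x - f x)) < e / 3"
      by (auto simp: eventually_sequentially)
    have "\<forall>\<^sub>F n in sequentially. (LINT x|lborel. norm (s i (x + X n) - s i x)) < e / 3"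
      using lim(5)[of i] e by (intro order_tendstoD) auto
    then obtain N where N: "\<And>n. n \<ge> N \<Longrightarrow> (LINT x|lborel. norm (s i (x + X n) - s i x)) < e / 3"
      by (auto simp: eventually_sequentially)
    have id: "integrable lborel (\<lambda>x. s i x - f x)" using lim(1,4) by auto
    show "\<exists>N. \<forall>n\<ge>N. norm ((LINT x|lborel. norm (f (x + X n) - f x)) - 0) < e"
    proof (intro exI allI impI)
      fix n assume n: "n \<ge> N"
      let ?R = "\<lambda>x. norm (s i (x + X n) - f (x + X n)) + norm (s i (x + X n) - s i x) + norm (s i x - f x)"
      have "(LINT x|lborel. norm (f (x + X n) - f x)) \<le> (LINT x|lborel. ?R x)"
      proof (rule integral_mono)
        fix x
        have eq: "f (x + X n) - f x = (s i (x + X n) - s i x) - (s i (x + X n) - f (x + X n)) + (s i x - f x)" by simp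
        show "norm (f (x + X n) - f x) \<le> ?R x"
          unfolding eq using norm_triangle_ineq[of "(s i (x + X n) - s i x) - (s i (x + X n) - f (x + X n))" "s i x - f x"]
            norm_triangle_ineq4[of "s i (x + X n) - s i x" "s i (x + X n) - f (x + X n)"] by linarith
      qed (use sh[OF lim(1)] sh[OF lim(4)] lim(1,4) in auto)
      also have "\<dots> = (LINT x|lborel. norm (s i (x + X n) - f (x + X n))) + (LINT x|lborel. norm (s i (x + X n) - s i x))
           + (LINT x|lborel. norm (s i x - f x))"
        using sh[OF lim(1)] sh[OF lim(4)] lim(1,4) by simp
      also have "(LINT x|lborel. norm (s i (x + X n) - f (x + X n))) = (LINT x|lborel. norm (s i x - f x))"
        by (rule integral_shift)
      also have "(LINT x|lborel. norm (s i x - f x)) + (LINT x|lborel. norm (s i (x + X n) - s i x))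
           + (LINT x|lborel. norm (s i x - f x)) < e" using N[OF n] i by linarith
      finally show "norm ((LINT x|lborel. norm (f (x + X n) - f x)) - 0) < e" by simp
    qed
  qed
qed

section \<open>The transform of integrable functions and its Gaussian means\<close>

abbreviation wave :: "real \<Rightarrow> real \<Rightarrow> complex" where
  "wave x \<xi> \<equiv> exp (\<i> * complex_of_real x * complex_of_real \<xi>)"

abbreviation wave_inv :: "real \<Rightarrow> real \<Rightarrow> complex" where
  "wave_inv x \<xi> \<equiv> exp (- (\<i> * complex_of_real x * complex_of_real \<xi>))"

text \<open>The integral formula, meant for integrable arguments; general elements of
  \<open>L2\<close> are reached only through \<open>has_fourier\<close>.\<close>

definition FT :: "(real \<Rightarrow> complex) \<Rightarrow> real \<Rightarrow> complex" where
  "FT f \<xi> = (LINT x|lborel. wave_inv x \<xi> * f x)"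

lemma norm_exp_imag [simp]:
  "norm (wave_inv x y) = 1"
  "norm (wave x y) = 1"
  by (simp_all add: norm_exp_eq_Re)

lemma FT_integrable:
  assumes "integrable lborel f"
  shows "integrable lborel (\<lambda>x. wave_inv x \<xi> * f x)"
    and "integrable lborel (\<lambda>x. wave x \<xi> * f x)"
  using borel_measurable_integrable[OF assms]
  by (auto intro!: Bochner_Integration.integrable_bound[OF assms] simp: norm_mult)

lemma FT_measurable [measurable]:
  assumes [measurable]: "f \<in> borel_measurable borel" shows "FT f \<in> borel_measurable borel"
  unfolding FT_def[abs_def] by measurable

lemma FT_norm_le: "norm (FT f \<xi>) \<le> (LINT x|lborel. norm (f x))"
  unfolding FT_def by (rule order_trans[OF integral_norm_bound]) (simp add: norm_mult)

lemma FT_cnj: "cnj (FT f \<xi>) = (LINT x|lborel. wave x \<xi> * cnj (f x))"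
proof -
  have "cnj (FT f \<xi>) = (LINT x|lborel. cnj (wave_inv x \<xi> * f x))"
    unfolding FT_def by (rule Bochner_Integration.integral_cnj[symmetric])
  then show ?thesis by (simp only: complex_cnj_mult exp_cnj) simp
qed

text \<open>The common hypothesis for Fubini's theorem: \<open>c = 1\<close> serves the
  autocorrelation, \<open>c = -1\<close> the convolution, and \<open>c = 0\<close> plain products of
  a function of \<open>x\<close> and a function of \<open>z\<close>.\<close>

lemma integrable_prod_shift:
  fixes f g :: "real \<Rightarrow> complex"
  assumes f: "integrable lborel f" and g: "integrable lborel g"
  shows "integrable (lborel \<Otimes>\<^sub>M lborel) (\<lambda>(x, z). f x * g (c * x + z))"
proof (rule lborel_pair.Fubini_integrable)
  have [measurable]: "f \<in> borel_measurable borel" "g \<in> borel_measurable borel" using f g by auto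
  show "(\<lambda>(x, z). f x * g (c * x + z)) \<in> borel_measurable (lborel \<Otimes>\<^sub>M lborel)" by measurable
  have sh: "integrable lborel (\<lambda>z. g (t + z))" "(LINT z|lborel. norm (g (t + z))) = (LINT z|lborel. norm (g z))" for t
    using lborel_integrable_real_affine[OF g, of 1 t] lborel_integral_real_affine[of 1 "\<lambda>x. norm (g x)" t] by simp_all
  show "integrable lborel (\<lambda>x. LINT z|lborel. norm (case (x, z) of (x, z) \<Rightarrow> f x * g (c * x + z)))"
    using f by (simp add: norm_mult sh)
  show "AE x in lborel. integrable lborel (\<lambda>z. case (x, z) of (x, z) \<Rightarrow> f x * g (c * x + z))"
    by (simp add: sh)
qed

text \<open>This is the characteristic function of the standard normal law, rescaled by \<delta>. It
  is the summability kernel behind Plancherel's theorem.\<close>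

lemma std_normal_density_FT:
  assumes d: "\<delta> > 0"
  shows "(LINT \<xi>|lborel. wave z \<xi> * complex_of_real (std_normal_density (\<delta> * \<xi>)))
    = complex_of_real (sqrt (2 * pi) / \<delta> * std_normal_density (z / \<delta>))"
proof -
  let ?G = "\<lambda>x. std_normal_density x *\<^sub>R exp (\<i> * complex_of_real (z / \<delta> * x))"
  have "complex_of_real (exp (- ((z / \<delta>)\<^sup>2) / 2)) = char std_normal_distribution (z / \<delta>)"
    by (simp add: char_std_normal_distribution)
  also have "\<dots> = (LINT x|lborel. ?G x)"
    unfolding char_def by (subst integral_density) (auto simp: normal_density_nonneg)
  also have "\<dots> = \<bar>\<delta>\<bar> *\<^sub>R (LINT x|lborel. ?G (0 + \<delta> * x))"
    using d by (intro lborel_integral_real_affine) auto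
  also have "(\<lambda>x. ?G (0 + \<delta> * x)) = (\<lambda>\<xi>. wave z \<xi> * complex_of_real (std_normal_density (\<delta> * \<xi>)))"
    using d by (auto simp: fun_eq_iff scaleR_conv_of_real mult_ac)
  finally show ?thesis
    using d by (simp add: std_normal_density_def scaleR_conv_of_real field_simps power_divide)
qed

text \<open>Its value at 0 is the squared norm of \<open>f\<close> and its transform is |FT f|^2, so
  Plancherel's theorem for \<open>f\<close> is the inversion formula for this function at the single
  point 0.\<close>

definition autocorrelation :: "(real \<Rightarrow> complex) \<Rightarrow> real \<Rightarrow> complex" where
  "autocorrelation f z = (LINT x|lborel. f x * cnj (f (x + z)))"

lemma l2n_cnj: "l2n (\<lambda>x. cnj (f x)) = l2n f" by (simp add: l2n_def)

lemma autocorrelation_0: "autocorrelation f 0 = complex_of_real ((l2n f)\<^sup>2)"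
  unfolding l2n_square integral_complex_of_real[symmetric] autocorrelation_def
  by (simp only: complex_norm_square add_0_right)

lemma norm_autocorrelation_le: "f \<in> L2 \<Longrightarrow> norm (autocorrelation f z) \<le> (l2n f)\<^sup>2"
  using L2_Cauchy_Schwarz'[OF _ L2_cnj[OF L2_shift], of f f z]
  by (simp add: autocorrelation_def power2_eq_square l2n_cnj l2n_shift)

text \<open>Continuity of translations in L1 suffices when the unshifted factor is cut at a height
  m. Where it is at most m, the L1 statement applies directly; the part above m has small L2 norm,
  and there the Cauchy-Schwarz inequality is enough.\<close>

lemma autocorrelation_continuous:
  assumes f1: "integrable lborel f" and f2: "f \<in> L2" and X: "X \<longlonglongrightarrow> 0"
  shows "(\<lambda>n. autocorrelation f (X n)) \<longlonglongrightarrow> autocorrelation f 0"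
proof (rule LIMSEQ_I)
  fix e :: real assume e: "e > 0"
  note [measurable] = L2_measurable[OF f2]
  let ?g = "\<lambda>m::nat. \<lambda>x. if norm (f x) \<le> real m then 0 else f x"
  have g2: "?g m \<in> L2" for m by (rule L2_bound[OF f2, of _ 1]) auto
  have "(\<lambda>m. LINT x|lborel. (norm (?g m x))\<^sup>2) \<longlonglongrightarrow> integral\<^sup>L lborel (\<lambda>x::real. 0::real)"
  proof (rule integral_dominated_convergence[OF _ _ L2_integrable[OF f2]])
    show "AE x in lborel. (\<lambda>m. (norm (?g m x))\<^sup>2) \<longlonglongrightarrow> 0"
    proof (intro AE_I2 tendsto_eventually)
      fix x
      obtain m0 where "norm (f x) \<le> real m0" using real_arch_simple by blast
      then show "\<forall>\<^sub>F m in sequentially. (norm (?g m x))\<^sup>2 = 0"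
        by (intro eventually_sequentiallyI[of m0]) auto
    qed
  qed auto
  then have "(\<lambda>m. l2n (?g m)) \<longlonglongrightarrow> sqrt 0" unfolding l2n_def by (intro tendsto_intros) simp
  then have "(\<lambda>m. 2 * (l2n (?g m) * l2n f)) \<longlonglongrightarrow> 2 * (sqrt 0 * l2n f)" by (intro tendsto_intros)
  then have "\<forall>\<^sub>F m in sequentially. 2 * (l2n (?g m) * l2n f) < e / 2"
    by (rule order_tendstoD(2)) (use e in simp)
  then obtain m where m0: "2 * (l2n (?g m) * l2n f) < e / 2" unfolding eventually_sequentially by blast
  define g where "g = ?g m"
  have m: "2 * (l2n g * l2n f) < e / 2" using m0 unfolding g_def .
  have gL2: "g \<in> L2" unfolding g_def by (rule g2)
  have "(\<lambda>n. real m * (LINT x|lborel. norm (f (x + X n) - f x))) \<longlonglongrightarrow> real m * 0"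
    by (intro tendsto_intros translation_continuous_L1 f1 X)
  then have "\<forall>\<^sub>F n in sequentially. real m * (LINT x|lborel. norm (f (x + X n) - f x)) < e / 2"
    using e by (intro order_tendstoD) auto
  then obtain N where N: "\<And>n. n \<ge> N \<Longrightarrow> real m * (LINT x|lborel. norm (f (x + X n) - f x)) < e / 2"
    by (auto simp: eventually_sequentially)
  show "\<exists>N. \<forall>n\<ge>N. norm (autocorrelation f (X n) - autocorrelation f 0) < e"
  proof (intro exI allI impI)
    fix n assume n: "n \<ge> N"
    have sh: "integrable lborel (\<lambda>x. f (x + X n))"
      using lborel_integrable_real_affine[OF f1, of 1 "X n"] by (simp add: add.commute)
    have i1: "integrable lborel (\<lambda>x. norm (g x) * norm (f (x + X n)))"
      "integrable lborel (\<lambda>x. norm (g x) * norm (f x))"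
      using integrable_norm[OF L2_mult_integrable[OF gL2 L2_shift[OF f2, of "X n"]]]
        integrable_norm[OF L2_mult_integrable[OF gL2 f2]] by (simp_all add: norm_mult)
    have i2: "integrable lborel (\<lambda>x. real m * norm (f (x + X n) - f x))" using sh f1 by auto
    let ?R = "\<lambda>x. real m * norm (f (x + X n) - f x) + norm (g x) * norm (f (x + X n)) + norm (g x) * norm (f x)"
    have "autocorrelation f (X n) - autocorrelation f 0 = (LINT x|lborel. f x * cnj (f (x + X n)) - f x * cnj (f x))"
      unfolding autocorrelation_def
      by (subst Bochner_Integration.integral_diff)
         (auto intro!: L2_mult_integrable f2 L2_cnj L2_shift)
    also have "norm \<dots> \<le> (LINT x|lborel. ?R x)"
    proof (rule Bochner_Integration.integral_norm_bound_integral)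
      show "integrable lborel (\<lambda>x. f x * cnj (f (x + X n)) - f x * cnj (f x))"
        by (intro Bochner_Integration.integrable_diff L2_mult_integrable f2 L2_cnj L2_shift)
      show "integrable lborel ?R" using i1 i2 by auto
      fix x
      have "norm (f x * cnj (f (x + X n)) - f x * cnj (f x)) = norm (f x) * norm (f (x + X n) - f x)"
        by (metis complex_cnj_diff complex_mod_cnj norm_mult right_diff_distrib)
      also have "\<dots> \<le> ?R x"
      proof (cases "norm (f x) \<le> real m")
        case True
        then have "norm (f x) * norm (f (x + X n) - f x) \<le> real m * norm (f (x + X n) - f x)"
          by (rule mult_right_mono) simp
        with True show ?thesis by (simp add: g_def)
      next
        case False
        have "norm (f x) * norm (f (x + X n) - f x) \<le> norm (f x) * (norm (f (x + X n)) + norm (f x))"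
          by (intro mult_left_mono norm_triangle_ineq4) auto
        moreover have "0 \<le> real m * norm (f (x + X n) - f x)" by simp
        moreover have gx: "g x = f x" using False by (simp add: g_def)
        ultimately show ?thesis unfolding distrib_left gx by linarith
      qed
      finally show "norm (f x * cnj (f (x + X n)) - f x * cnj (f x)) \<le> ?R x" .
    qed
    also have "\<dots> = (LINT x|lborel. real m * norm (f (x + X n) - f x)) + (LINT x|lborel. norm (g x) * norm (f (x + X n)))
      + (LINT x|lborel. norm (g x) * norm (f x))"
      unfolding Bochner_Integration.integral_add[OF Bochner_Integration.integrable_add[OF i2 i1(1)] i1(2)]
        Bochner_Integration.integral_add[OF i2 i1(1)] by (rule refl)
    also have "\<dots> \<le> real m * (LINT x|lborel. norm (f (x + X n) - f x)) + l2n (g) * l2n f + l2n (g) * l2n f"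
    proof (intro add_mono)
      show "(LINT x|lborel. norm (g x) * norm (f (x + X n))) \<le> l2n (g) * l2n f"
        using L2_Cauchy_Schwarz[OF gL2 L2_shift[OF f2, of "X n"]] unfolding l2n_shift .
      show "(LINT x|lborel. norm (g x) * norm (f x)) \<le> l2n (g) * l2n f"
        by (rule L2_Cauchy_Schwarz[OF gL2 f2])
    qed (simp only: integral_mult_right_zero order_refl)
    also have "\<dots> < e" using N[OF n] m by linarith
    finally show "norm (autocorrelation f (X n) - autocorrelation f 0) < e" .
  qed
qed

lemma autocorrelation_measurable [measurable]:
  assumes [measurable]: "f \<in> borel_measurable borel" shows "autocorrelation f \<in> borel_measurable borel"
  unfolding autocorrelation_def[abs_def] by measurable

lemma FT_norm_square:
  assumes f: "integrable lborel f"
  shows "integrable lborel (autocorrelation f)"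
    and "complex_of_real ((norm (FT f \<xi>))\<^sup>2)
      = (LINT z|lborel. wave z \<xi> * autocorrelation f z)"
proof -
  have [measurable]: "f \<in> borel_measurable borel" using f by auto
  have fc: "integrable lborel (\<lambda>x. cnj (f x))" using f by (rule integrable_cnj)
  have int: "integrable (lborel \<Otimes>\<^sub>M lborel) (\<lambda>(x, z). f x * cnj (f (x + z)))"
    using integrable_prod_shift[OF f fc, of 1] by simp
  show "integrable lborel (autocorrelation f)"
    unfolding autocorrelation_def[abs_def] by (rule lborel_pair.integrable_snd[OF int])
  have int': "integrable (lborel \<Otimes>\<^sub>M lborel)
      (\<lambda>(x, z). wave z \<xi> * (f x * cnj (f (x + z))))"
    by (rule Bochner_Integration.integrable_bound[OF int]) (auto simp: norm_mult)
  have "(LINT z|lborel. wave z \<xi> * autocorrelation f z)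
    = (LINT z|lborel. LINT x|lborel. wave z \<xi> * (f x * cnj (f (x + z))))"
    unfolding autocorrelation_def by simp
  also have "\<dots> = (LINT x|lborel. LINT z|lborel. wave z \<xi> * (f x * cnj (f (x + z))))"
    by (rule lborel_pair.Fubini_integral[OF int'])
  also have "\<dots> = (LINT x|lborel. wave_inv x \<xi> * f x * cnj (FT f \<xi>))"
  proof (rule Bochner_Integration.integral_cong[OF refl])
    fix x
    have "cnj (FT f \<xi>) = (LINT z|lborel. wave (x + z) \<xi> * cnj (f (x + z)))"
      unfolding FT_cnj by (subst lborel_integral_real_affine[of 1 _ x]) auto
    also have "\<dots> = (LINT z|lborel. wave x \<xi>
        * (wave z \<xi> * cnj (f (x + z))))"
      by (simp add: algebra_simps exp_add)
    also have "\<dots> = wave x \<xi>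
        * (LINT z|lborel. wave z \<xi> * cnj (f (x + z)))"
      by (rule integral_mult_right_zero)
    finally have eq: "cnj (FT f \<xi>) = \<dots>" .
    have "(LINT z|lborel. wave z \<xi> * (f x * cnj (f (x + z))))
      = f x * (LINT z|lborel. wave z \<xi> * cnj (f (x + z)))"
      by (subst integral_mult_right_zero[symmetric]) (simp add: mult_ac)
    then show "(LINT z|lborel. wave z \<xi> * (f x * cnj (f (x + z))))
      = wave_inv x \<xi> * f x * cnj (FT f \<xi>)"
      unfolding eq by (simp add: exp_minus)
  qed
  also have "\<dots> = FT f \<xi> * cnj (FT f \<xi>)" by (simp add: FT_def)
  finally show "complex_of_real ((norm (FT f \<xi>))\<^sup>2)
      = (LINT z|lborel. wave z \<xi> * autocorrelation f z)"
    by (simp only: complex_norm_square)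
qed

text \<open>The Gaussian factor makes Fubini's theorem applicable before |FT f|^2 is known to be
  integrable. On the right stands, after rescaling, an average of the autocorrelation over a normal
  law of width \<delta>, which concentrates at 0.\<close>

lemma FT_Gaussian_mean:
  assumes f: "integrable lborel f" and d: "\<delta> > 0"
  shows "complex_of_real (LINT \<xi>|lborel. (norm (FT f \<xi>))\<^sup>2 * std_normal_density (\<delta> * \<xi>))
    = complex_of_real (sqrt (2 * pi)) * (LINT z|lborel. autocorrelation f (\<delta> * z) * complex_of_real (std_normal_density z))"
proof -
  have [measurable]: "f \<in> borel_measurable borel" using f by auto
  have n: "integrable lborel (\<lambda>\<xi>. complex_of_real (std_normal_density (\<delta> * \<xi>)))"
    using lborel_integrable_real_affine[of "\<lambda>x. complex_of_real (std_normal_density x)" \<delta> 0] d by simp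
  have int: "integrable (lborel \<Otimes>\<^sub>M lborel) (\<lambda>(\<xi>, z). complex_of_real (std_normal_density (\<delta> * \<xi>)) * autocorrelation f (0 * \<xi> + z))"
    by (rule integrable_prod_shift[OF n FT_norm_square(1)[OF f]])
  have int': "integrable (lborel \<Otimes>\<^sub>M lborel)
      (\<lambda>(\<xi>, z). complex_of_real (std_normal_density (\<delta> * \<xi>)) * (wave z \<xi> * autocorrelation f z))"
    by (rule Bochner_Integration.integrable_bound[OF int]) (auto simp: norm_mult)
  have "complex_of_real (LINT \<xi>|lborel. (norm (FT f \<xi>))\<^sup>2 * std_normal_density (\<delta> * \<xi>))
    = (LINT \<xi>|lborel. complex_of_real (std_normal_density (\<delta> * \<xi>)) * complex_of_real ((norm (FT f \<xi>))\<^sup>2))"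
    by (subst integral_complex_of_real[symmetric]) (simp add: mult_ac)
  also have "\<dots> = (LINT \<xi>|lborel. LINT z|lborel. complex_of_real (std_normal_density (\<delta> * \<xi>))
      * (wave z \<xi> * autocorrelation f z))"
    unfolding FT_norm_square(2)[OF f] by simp
  also have "\<dots> = (LINT z|lborel. LINT \<xi>|lborel. complex_of_real (std_normal_density (\<delta> * \<xi>))
      * (wave z \<xi> * autocorrelation f z))"
    by (rule lborel_pair.Fubini_integral[OF int', symmetric])
  also have "\<dots> = (LINT z|lborel. autocorrelation f z * complex_of_real (sqrt (2 * pi) / \<delta> * std_normal_density (z / \<delta>)))"
  proof (rule Bochner_Integration.integral_cong[OF refl])
    fix z
    show "(LINT \<xi>|lborel. complex_of_real (std_normal_density (\<delta> * \<xi>)) * (wave z \<xi> * autocorrelation f z))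
      = autocorrelation f z * complex_of_real (sqrt (2 * pi) / \<delta> * std_normal_density (z / \<delta>))"
      unfolding std_normal_density_FT[OF d, symmetric]
      by (subst integral_mult_right_zero[symmetric]) (simp add: mult_ac)
  qed
  also have "\<dots> = \<bar>\<delta>\<bar> *\<^sub>R (LINT z|lborel. autocorrelation f (0 + \<delta> * z) * complex_of_real (sqrt (2 * pi) / \<delta> * std_normal_density ((0 + \<delta> * z) / \<delta>)))"
    using d by (intro lborel_integral_real_affine) auto
  also have "\<dots> = (LINT z|lborel. complex_of_real (sqrt (2 * pi)) * (autocorrelation f (\<delta> * z) * complex_of_real (std_normal_density z)))"
    using d by (subst integral_scaleR_right[symmetric]) (simp add: scaleR_conv_of_real field_simps)
  also have "\<dots> = complex_of_real (sqrt (2 * pi)) * (LINT z|lborel. autocorrelation f (\<delta> * z) * complex_of_real (std_normal_density z))"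
    by (rule integral_mult_right_zero)
  finally show ?thesis .
qed

text \<open>The Gaussian means are evaluated in the limit \<delta> to 0 in two ways: by monotone
  convergence on the frequency side, which also yields \<open>FT f \<in> L2\<close>, and by
  dominated convergence on the side of the autocorrelation. The factor 2 pi combines sqrt (2 pi)
  from the Gaussian mean with \<open>std_normal_density 0\<close> = 1 / sqrt (2 pi).\<close>

theorem Plancherel_L1_L2:
  assumes f1: "integrable lborel f" and f2: "f \<in> L2"
  shows "FT f \<in> L2" "l2n (FT f) = sqrt (2 * pi) * l2n f"
proof -
  have [measurable]: "f \<in> borel_measurable borel" using f1 by auto
  define d :: "nat \<Rightarrow> real" where "d n = inverse (real (Suc n))" for n
  have d0: "d n > 0" for n by (simp add: d_def)
  have dlim: "d \<longlonglongrightarrow> 0" unfolding d_def by (rule LIMSEQ_inverse_real_of_nat)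
  let ?I = "\<lambda>n. LINT \<xi>|lborel. (norm (FT f \<xi>))\<^sup>2 * std_normal_density (d n * \<xi>)"
  have "(\<lambda>n. LINT z|lborel. autocorrelation f (d n * z) * complex_of_real (std_normal_density z))
     \<longlonglongrightarrow> (LINT z|lborel. autocorrelation f 0 * complex_of_real (std_normal_density z))"
  proof (rule integral_dominated_convergence[where w="\<lambda>z. (l2n f)\<^sup>2 * std_normal_density z"])
    show "AE z in lborel. (\<lambda>n. autocorrelation f (d n * z) * complex_of_real (std_normal_density z))
      \<longlonglongrightarrow> autocorrelation f 0 * complex_of_real (std_normal_density z)"
    proof (intro AE_I2 tendsto_mult tendsto_const autocorrelation_continuous f1 f2)
      fix z show "(\<lambda>n. d n * z) \<longlonglongrightarrow> 0" using tendsto_mult_right[OF dlim, of z] by simp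
    qed
    show "AE z in lborel. norm (autocorrelation f (d n * z) * complex_of_real (std_normal_density z)) \<le> (l2n f)\<^sup>2 * std_normal_density z" for n
      using norm_autocorrelation_le[OF f2] by (auto simp: norm_mult normal_density_nonneg intro!: mult_right_mono)
  qed auto
  then have "(\<lambda>n. complex_of_real (?I n)) \<longlonglongrightarrow>
     complex_of_real (sqrt (2 * pi)) * (LINT z|lborel. autocorrelation f 0 * complex_of_real (std_normal_density z))"
    unfolding FT_Gaussian_mean[OF f1 d0] by (intro tendsto_intros)
  also have "(LINT z|lborel. autocorrelation f 0 * complex_of_real (std_normal_density z)) = complex_of_real ((l2n f)\<^sup>2)"
    using integral_std_normal_moment_even[of 0] by (simp add: autocorrelation_0)
  finally have "(\<lambda>n. complex_of_real (?I n)) \<longlonglongrightarrow> complex_of_real (sqrt (2 * pi) * (l2n f)\<^sup>2)" by simp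
  then have Ilim: "?I \<longlonglongrightarrow> sqrt (2 * pi) * (l2n f)\<^sup>2" by (simp only: tendsto_of_real_iff)
  let ?F = "\<lambda>n \<xi>. ennreal ((norm (FT f \<xi>))\<^sup>2 * std_normal_density (d n * \<xi>))"
  have "(\<lambda>n. \<integral>\<^sup>+\<xi>. ?F n \<xi> \<partial>lborel) \<longlonglongrightarrow> (\<integral>\<^sup>+\<xi>. ennreal ((norm (FT f \<xi>))\<^sup>2 * std_normal_density 0) \<partial>lborel)"
  proof (rule nn_integral_LIMSEQ)
    show "incseq ?F"
    proof (intro incseq_SucI le_funI ennreal_leI mult_left_mono)
      fix n \<xi>
      have "\<bar>d (Suc n) * \<xi>\<bar> \<le> \<bar>d n * \<xi>\<bar>"
        unfolding abs_mult by (intro mult_right_mono) (auto simp: d_def field_simps)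
      then have "(d (Suc n) * \<xi>)\<^sup>2 \<le> (d n * \<xi>)\<^sup>2" by (simp add: abs_le_square_iff)
      then show "std_normal_density (d n * \<xi>) \<le> std_normal_density (d (Suc n) * \<xi>)"
        by (simp add: std_normal_density_def divide_right_mono)
    qed auto
    show "(\<lambda>n. ?F n \<xi>) \<longlonglongrightarrow> ennreal ((norm (FT f \<xi>))\<^sup>2 * std_normal_density 0)" for \<xi>
    proof (intro tendsto_ennrealI tendsto_mult tendsto_const)
      have "(\<lambda>n. d n * \<xi>) \<longlonglongrightarrow> 0" using tendsto_mult_right[OF dlim, of \<xi>] by simp
      moreover have "isCont std_normal_density 0"
        unfolding std_normal_density_def[abs_def] by (intro continuous_intros) auto
      ultimately show "(\<lambda>n. std_normal_density (d n * \<xi>)) \<longlonglongrightarrow> std_normal_density 0"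
        by (rule isCont_tendsto_compose[rotated])
    qed
  qed simp
  moreover have "(\<lambda>n. \<integral>\<^sup>+\<xi>. ?F n \<xi> \<partial>lborel) = (\<lambda>n. ennreal (?I n))"
  proof
    fix n
    have "integrable lborel (\<lambda>\<xi>. (norm (FT f \<xi>))\<^sup>2 * std_normal_density (d n * \<xi>))"
    proof (rule Bochner_Integration.integrable_bound)
      show "integrable lborel (\<lambda>\<xi>. (LINT x|lborel. norm (f x))\<^sup>2 * std_normal_density (0 + d n * \<xi>))"
        using d0[of n] by (intro integrable_mult_right lborel_integrable_real_affine) auto
      show "AE \<xi> in lborel. norm ((norm (FT f \<xi>))\<^sup>2 * std_normal_density (d n * \<xi>))
          \<le> norm ((LINT x|lborel. norm (f x))\<^sup>2 * std_normal_density (0 + d n * \<xi>))"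
        using FT_norm_le[of f] by (auto simp: abs_mult normal_density_nonneg intro!: mult_right_mono power_mono)
    qed simp
    then show "(\<integral>\<^sup>+\<xi>. ?F n \<xi> \<partial>lborel) = ennreal (?I n)"
      by (intro nn_integral_eq_integral) (auto simp: normal_density_nonneg)
  qed
  ultimately have "(\<lambda>n. ennreal (?I n)) \<longlonglongrightarrow> (\<integral>\<^sup>+\<xi>. ennreal ((norm (FT f \<xi>))\<^sup>2 * std_normal_density 0) \<partial>lborel)"
    by simp
  moreover have "(\<lambda>n. ennreal (?I n)) \<longlonglongrightarrow> ennreal (sqrt (2 * pi) * (l2n f)\<^sup>2)"
    using Ilim by (rule tendsto_ennrealI)
  ultimately have "(\<integral>\<^sup>+\<xi>. ennreal ((norm (FT f \<xi>))\<^sup>2 * std_normal_density 0) \<partial>lborel) = ennreal (sqrt (2 * pi) * (l2n f)\<^sup>2)"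
    by (rule LIMSEQ_unique)
  then have eq: "(\<integral>\<^sup>+\<xi>. ennreal ((norm (FT f \<xi>))\<^sup>2) \<partial>lborel) * ennreal (1 / sqrt (2 * pi)) = ennreal (sqrt (2 * pi) * (l2n f)\<^sup>2)"
    by (subst (asm) ennreal_mult) (auto simp: normal_density_nonneg nn_integral_multc std_normal_density_def)
  have "(\<integral>\<^sup>+\<xi>. ennreal ((norm (FT f \<xi>))\<^sup>2) \<partial>lborel)
      = (\<integral>\<^sup>+\<xi>. ennreal ((norm (FT f \<xi>))\<^sup>2) \<partial>lborel) * ennreal (1 / sqrt (2 * pi)) * ennreal (sqrt (2 * pi))"
    by (simp add: mult.assoc flip: ennreal_mult)
  also have "\<dots> = ennreal (2 * pi * (l2n f)\<^sup>2)"
    unfolding eq by (simp add: mult_ac flip: ennreal_mult)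
  finally have eq: "(\<integral>\<^sup>+\<xi>. ennreal ((norm (FT f \<xi>))\<^sup>2) \<partial>lborel) = ennreal (2 * pi * (l2n f)\<^sup>2)" .
  then show FT2: "FT f \<in> L2" by (simp add: L2_iff)
  have "(l2n (FT f))\<^sup>2 = (sqrt (2 * pi) * l2n f)\<^sup>2"
    using eq unfolding L2_nn[OF FT2] by (subst (asm) ennreal_inj) (auto simp: power_mult_distrib)
  then show "l2n (FT f) = sqrt (2 * pi) * l2n f" by (subst (asm) power2_eq_iff_nonneg) auto
qed

lemma l2n_triangle:
  assumes f: "f \<in> L2" and g: "g \<in> L2" shows "l2n (\<lambda>x. f x + g x) \<le> l2n f + l2n g"
proof (rule power2_le_imp_le)
  have i: "integrable lborel (\<lambda>x. (norm (f x))\<^sup>2)" "integrable lborel (\<lambda>x. (norm (g x))\<^sup>2)"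
    using f g by (auto intro: L2_integrable)
  have i2: "integrable lborel (\<lambda>x. norm (f x) * norm (g x))"
    using integrable_norm[OF L2_mult_integrable[OF f g]] by (simp add: norm_mult)
  have "(l2n (\<lambda>x. f x + g x))\<^sup>2 = (LINT x|lborel. (norm (f x + g x))\<^sup>2)" by (rule l2n_square)
  also have "\<dots> \<le> (LINT x|lborel. (norm (f x))\<^sup>2 + 2 * (norm (f x) * norm (g x)) + (norm (g x))\<^sup>2)"
  proof (rule integral_mono)
    show "integrable lborel (\<lambda>x. (norm (f x + g x))\<^sup>2)" by (rule L2_integrable[OF L2_add[OF f g]])
    show "integrable lborel (\<lambda>x. (norm (f x))\<^sup>2 + 2 * (norm (f x) * norm (g x)) + (norm (g x))\<^sup>2)"
      by (intro Bochner_Integration.integrable_add integrable_mult_right i i2)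
    fix x
    have "(norm (f x + g x))\<^sup>2 \<le> (norm (f x) + norm (g x))\<^sup>2" by (intro power_mono norm_triangle_ineq) auto
    then show "(norm (f x + g x))\<^sup>2 \<le> (norm (f x))\<^sup>2 + 2 * (norm (f x) * norm (g x)) + (norm (g x))\<^sup>2"
      by (simp add: power2_sum)
  qed
  also have "\<dots> = (l2n f)\<^sup>2 + 2 * (LINT x|lborel. norm (f x) * norm (g x)) + (l2n g)\<^sup>2"
    using i i2 by (simp add: l2n_square)
  also have "\<dots> \<le> (l2n f)\<^sup>2 + 2 * (l2n f * l2n g) + (l2n g)\<^sup>2"
    using L2_Cauchy_Schwarz[OF f g] by simp
  finally show "(l2n (\<lambda>x. f x + g x))\<^sup>2 \<le> (l2n f + l2n g)\<^sup>2" by (simp add: power2_sum)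
qed simp

lemma l2n_cmult: "l2n (\<lambda>x. c * f x) = norm c * l2n f"
  by (simp add: l2n_def norm_mult power_mult_distrib real_sqrt_mult)

lemma l2n_minus_commute: "l2n (\<lambda>x. f x - g x) = l2n (\<lambda>x. g x - f x)"
  by (simp add: l2n_def norm_minus_commute)

lemma l2n_triangle_diff:
  assumes f: "f \<in> L2" and g: "g \<in> L2" and h: "h \<in> L2"
  shows "l2n (\<lambda>x. f x - h x) \<le> l2n (\<lambda>x. f x - g x) + l2n (\<lambda>x. g x - h x)"
  using l2n_triangle[OF L2_diff[OF f g] L2_diff[OF g h]] by simp

lemma l2n_diff_abs:
  assumes f: "f \<in> L2" and g: "g \<in> L2"
  shows "\<bar>l2n f - l2n g\<bar> \<le> l2n (\<lambda>x. f x - g x)"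
  using l2n_triangle_diff[OF f g L2_zero] l2n_triangle_diff[OF g f L2_zero] l2n_minus_commute[of f g] by simp

lemma l2n_cong_AE:
  assumes "f \<in> borel_measurable borel" "g \<in> borel_measurable borel" "AE x in lborel. f x = g x"
  shows "l2n f = l2n g"
  unfolding l2n_def using assms by (intro arg_cong[where f=sqrt] integral_cong_AE) auto

lemma l2n_eq_0: assumes f: "f \<in> L2" shows "l2n f = 0 \<longleftrightarrow> (AE x in lborel. f x = 0)"
  using integral_nonneg_eq_0_iff_AE[OF L2_integrable[OF f]] by (simp add: l2n_def)

lemma l2n_square_diff:
  assumes f: "f \<in> L2" and g: "g \<in> L2"
  shows "(l2n (\<lambda>x. f x - g x))\<^sup>2 = (l2n f)\<^sup>2 - 2 * Re (LINT x|lborel. g x * cnj (f x)) + (l2n g)\<^sup>2"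
proof -
  have i: "integrable lborel (\<lambda>x. (norm (f x))\<^sup>2)" "integrable lborel (\<lambda>x. (norm (g x))\<^sup>2)"
    using f g by (auto intro: L2_integrable)
  have i2: "integrable lborel (\<lambda>x. g x * cnj (f x))" by (intro L2_mult_integrable L2_cnj f g)
  then have i3: "integrable lborel (\<lambda>x. Re (g x * cnj (f x)))" by (rule integrable_Re)
  have eq: "(norm (a - b))\<^sup>2 = (norm a)\<^sup>2 - 2 * Re (b * cnj a) + (norm b)\<^sup>2" for a b :: complex
    unfolding cmod_power2 by (simp add: power2_eq_square algebra_simps)
  have "(l2n (\<lambda>x. f x - g x))\<^sup>2 = (LINT x|lborel. (norm (f x))\<^sup>2 - 2 * Re (g x * cnj (f x)) + (norm (g x))\<^sup>2)"
    unfolding l2n_square eq ..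
  also have "\<dots> = (l2n f)\<^sup>2 - 2 * (LINT x|lborel. Re (g x * cnj (f x))) + (l2n g)\<^sup>2"
    unfolding l2n_square
    using Bochner_Integration.integral_add[OF Bochner_Integration.integrable_diff[OF i(1) integrable_mult_right[OF i3, of 2]] i(2)]
      Bochner_Integration.integral_diff[OF i(1) integrable_mult_right[OF i3, of 2]]
    by (simp only: integral_mult_right_zero)
  also have "(LINT x|lborel. Re (g x * cnj (f x))) = Re (LINT x|lborel. g x * cnj (f x))"
    by (rule integral_Re[OF i2])
  finally show ?thesis .
qed

section \<open>The transform on L2 as a limit over truncations\<close>

definition trunc :: "real \<Rightarrow> (real \<Rightarrow> complex) \<Rightarrow> real \<Rightarrow> complex" where
  "trunc R f x = indicator {-R..R} x * f x"

lemma trunc_measurable [measurable]: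
  assumes [measurable]: "f \<in> borel_measurable borel" shows "trunc R f \<in> borel_measurable borel"
  unfolding trunc_def[abs_def] by measurable

lemma trunc_L2: "f \<in> L2 \<Longrightarrow> trunc R f \<in> L2"
  by (rule L2_bound[of f _ 1]) (auto simp: trunc_def indicator_def)

lemma trunc_integrable: assumes f: "f \<in> L2" shows "integrable lborel (trunc R f)"
proof -
  have "(indicator {-R..R} :: real \<Rightarrow> complex) \<in> L2"
    unfolding L2_def
  proof (intro CollectI conjI)
    have "(\<lambda>x. (norm (indicator {-R..R} x :: complex))\<^sup>2) = indicat_real {-R..R}" by (auto simp: indicator_def fun_eq_iff)
    then show "integrable lborel (\<lambda>x. (norm (indicator {-R..R} x :: complex))\<^sup>2)"
      by (simp add: integrable_indicator_iff emeasure_lborel_Icc_eq)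
  qed simp
  from L2_mult_integrable[OF this f] show ?thesis by (simp add: trunc_def[abs_def])
qed

lemma FT_trunc:
  "(LINT x:{-R..R}|lborel. wave_inv x \<xi> * f x) = FT (trunc R f) \<xi>"
  unfolding set_lebesgue_integral_def FT_def trunc_def
  by (rule Bochner_Integration.integral_cong) (auto simp: indicator_def)

lemma trunc_tendsto:
  assumes f: "f \<in> L2" shows "((\<lambda>R. l2n (\<lambda>x. f x - trunc R f x)) \<longlongrightarrow> 0) at_top"
proof -
  note [measurable] = L2_measurable[OF f]
  have "((\<lambda>R. LINT x|lborel. (norm (f x - trunc R f x))\<^sup>2) \<longlongrightarrow> integral\<^sup>L lborel (\<lambda>x::real. 0::real)) at_top"
  proof (rule integral_dominated_convergence_at_top[where w="\<lambda>x. (norm (f x))\<^sup>2"])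
    show "integrable lborel (\<lambda>x. (norm (f x))\<^sup>2)" by (rule L2_integrable[OF f])
    show "AE x in lborel. ((\<lambda>R. (norm (f x - trunc R f x))\<^sup>2) \<longlongrightarrow> 0) at_top"
    proof (intro AE_I2 tendsto_eventually)
      fix x show "\<forall>\<^sub>F R in at_top. (norm (f x - trunc R f x))\<^sup>2 = 0"
        using eventually_ge_at_top[of "\<bar>x\<bar>"] by eventually_elim (auto simp: trunc_def indicator_def)
    qed
    show "\<forall>\<^sub>F R in at_top. AE x in lborel. norm ((norm (f x - trunc R f x))\<^sup>2) \<le> (norm (f x))\<^sup>2"
      by (auto simp: trunc_def indicator_def)
  qed auto
  then have "((\<lambda>R. l2n (\<lambda>x. f x - trunc R f x)) \<longlongrightarrow> sqrt 0) at_top"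
    unfolding l2n_def by (intro tendsto_real_sqrt) simp
  then show ?thesis by simp
qed

lemma FT_diff: "integrable lborel f \<Longrightarrow> integrable lborel g \<Longrightarrow> FT (\<lambda>x. f x - g x) \<xi> = FT f \<xi> - FT g \<xi>"
  unfolding FT_def right_diff_distrib by (intro Bochner_Integration.integral_diff FT_integrable)

lemma FT_add: "integrable lborel f \<Longrightarrow> integrable lborel g \<Longrightarrow> FT (\<lambda>x. f x + g x) \<xi> = FT f \<xi> + FT g \<xi>"
  unfolding FT_def distrib_left by (intro Bochner_Integration.integral_add FT_integrable)

lemma FT_cmult: "FT (\<lambda>x. c * f x) \<xi> = c * FT f \<xi>"
  unfolding FT_def by (subst integral_mult_right_zero[symmetric]) (simp add: mult_ac)

lemma FT_cong_AE:
  assumes [measurable]: "f \<in> borel_measurable borel" "g \<in> borel_measurable borel" and "AE x in lborel. f x = g x"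
  shows "FT f = FT g"
  unfolding FT_def[abs_def] using assms(3) by (intro ext integral_cong_AE) auto

lemma l2n_FT_diff:
  assumes "integrable lborel f" "f \<in> L2" "integrable lborel g" "g \<in> L2"
  shows "l2n (\<lambda>\<xi>. FT f \<xi> - FT g \<xi>) = sqrt (2 * pi) * l2n (\<lambda>x. f x - g x)"
proof -
  have "FT (\<lambda>x. f x - g x) = (\<lambda>\<xi>. FT f \<xi> - FT g \<xi>)" by (simp add: fun_eq_iff FT_diff assms(1,3))
  then show ?thesis
    using Plancherel_L1_L2(2)[OF Bochner_Integration.integrable_diff[OF assms(1,3)] L2_diff[OF assms(2,4)]] by simp
qed

text \<open>Truncations of an \<open>L2\<close> function are integrable, so by Plancherel's theorem
  the extended integral in the definition is finite for every \<open>R\<close> and can be traded for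
  \<open>l2n\<close>.\<close>

lemma has_fourier_iff:
  "has_fourier f g \<longleftrightarrow> f \<in> L2 \<and> g \<in> L2 \<and> ((\<lambda>R. l2n (\<lambda>\<xi>. g \<xi> - FT (trunc R f) \<xi>)) \<longlongrightarrow> 0) at_top"
proof -
  have "((\<lambda>R. \<integral>\<^sup>+\<xi>. ennreal ((norm (g \<xi> - FT (trunc R f) \<xi>))\<^sup>2) \<partial>lborel) \<longlongrightarrow> 0) at_top
    \<longleftrightarrow> ((\<lambda>R. l2n (\<lambda>\<xi>. g \<xi> - FT (trunc R f) \<xi>)) \<longlongrightarrow> 0) at_top" (is "?A \<longleftrightarrow> ?B")
    if f: "f \<in> L2" and g: "g \<in> L2"
  proof -
    have "?A \<longleftrightarrow> ((\<lambda>R. ennreal ((l2n (\<lambda>\<xi>. g \<xi> - FT (trunc R f) \<xi>))\<^sup>2)) \<longlongrightarrow> ennreal 0) at_top"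
      by (subst L2_nn) (auto intro!: L2_diff g Plancherel_L1_L2 trunc_L2 f trunc_integrable)
    also have "\<dots> \<longleftrightarrow> ((\<lambda>R. (l2n (\<lambda>\<xi>. g \<xi> - FT (trunc R f) \<xi>))\<^sup>2) \<longlongrightarrow> 0) at_top"
      by (intro tendsto_ennreal_iff) auto
    also have "\<dots> \<longleftrightarrow> ?B"
    proof
      assume "((\<lambda>R. (l2n (\<lambda>\<xi>. g \<xi> - FT (trunc R f) \<xi>))\<^sup>2) \<longlongrightarrow> 0) at_top"
      from tendsto_real_sqrt[OF this] show ?B by simp
    next
      assume ?B from tendsto_power[OF this, of 2] show "((\<lambda>R. (l2n (\<lambda>\<xi>. g \<xi> - FT (trunc R f) \<xi>))\<^sup>2) \<longlongrightarrow> 0) at_top" by simp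
    qed
    finally show ?thesis .
  qed
  then show ?thesis unfolding has_fourier_def FT_trunc by blast
qed

lemma FT_trunc_L2: "f \<in> L2 \<Longrightarrow> FT (trunc R f) \<in> L2"
  by (intro Plancherel_L1_L2 trunc_L2 trunc_integrable)

text \<open>By Plancherel's theorem the transforms of two truncations are as close as the
  truncations, up to sqrt (2 pi). Completeness gives a limit along the integers; letting the integer
  tend to infinity in the triangle inequality then controls every real \<open>R\<close>.\<close>

lemma has_fourier_exists:
  assumes f: "f \<in> L2" shows "\<exists>g. has_fourier f g"
proof -
  have lim: "(\<lambda>n. l2n (\<lambda>x. f x - trunc (real n) f x)) \<longlonglongrightarrow> 0"
    by (rule filterlim_compose[OF trunc_tendsto[OF f] filterlim_real_sequentially])
  have diff: "l2n (\<lambda>\<xi>. FT (trunc R f) \<xi> - FT (trunc S f) \<xi>)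
      \<le> sqrt (2 * pi) * (l2n (\<lambda>x. f x - trunc R f x) + l2n (\<lambda>x. f x - trunc S f x))" for R S
    using l2n_triangle_diff[OF trunc_L2[OF f] f trunc_L2[OF f], of R S] l2n_minus_commute[of f "trunc R f"]
    by (simp add: l2n_FT_diff trunc_integrable f trunc_L2)
  have "\<exists>N. \<forall>i\<ge>N. \<forall>j\<ge>N. l2n (\<lambda>\<xi>. FT (trunc (real i) f) \<xi> - FT (trunc (real j) f) \<xi>) < e" if e: "e > 0" for e
  proof -
    have "\<forall>\<^sub>F n in sequentially. l2n (\<lambda>x. f x - trunc (real n) f x) < e / (2 * sqrt (2 * pi))"
      using lim by (rule order_tendstoD(2)) (use e in simp)
    then obtain N where N: "\<And>n. n \<ge> N \<Longrightarrow> l2n (\<lambda>x. f x - trunc (real n) f x) < e / (2 * sqrt (2 * pi))"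
      unfolding eventually_sequentially by blast
    show ?thesis
    proof (intro exI allI impI)
      fix i j assume ij: "i \<ge> N" "j \<ge> N"
      have "sqrt (2 * pi) * (l2n (\<lambda>x. f x - trunc (real i) f x) + l2n (\<lambda>x. f x - trunc (real j) f x))
        < sqrt (2 * pi) * (e / (2 * sqrt (2 * pi)) + e / (2 * sqrt (2 * pi)))"
        by (intro mult_strict_left_mono add_strict_mono N ij) auto
      also have "\<dots> = e" by (simp add: field_simps)
      finally show "l2n (\<lambda>\<xi>. FT (trunc (real i) f) \<xi> - FT (trunc (real j) f) \<xi>) < e"
        using diff[of "real i" "real j"] by linarith
    qed
  qed
  then obtain g where g: "g \<in> L2" and gl: "(\<lambda>n. l2n (\<lambda>\<xi>. FT (trunc (real n) f) \<xi> - g \<xi>)) \<longlonglongrightarrow> 0"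
    using Riesz_Fischer[of "\<lambda>n. FT (trunc (real n) f)"] FT_trunc_L2[OF f] by blast
  have le: "l2n (\<lambda>\<xi>. g \<xi> - FT (trunc R f) \<xi>) \<le> sqrt (2 * pi) * l2n (\<lambda>x. f x - trunc R f x)" for R
  proof -
    have "(\<lambda>n. l2n (\<lambda>\<xi>. FT (trunc (real n) f) \<xi> - g \<xi>)
        + sqrt (2 * pi) * (l2n (\<lambda>x. f x - trunc (real n) f x) + l2n (\<lambda>x. f x - trunc R f x)))
      \<longlonglongrightarrow> 0 + sqrt (2 * pi) * (0 + l2n (\<lambda>x. f x - trunc R f x))"
      by (intro tendsto_intros gl lim)
    then have "l2n (\<lambda>\<xi>. g \<xi> - FT (trunc R f) \<xi>) \<le> 0 + sqrt (2 * pi) * (0 + l2n (\<lambda>x. f x - trunc R f x))"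
    proof (rule LIMSEQ_le_const, intro exI allI impI)
      fix n :: nat
      show "l2n (\<lambda>\<xi>. g \<xi> - FT (trunc R f) \<xi>) \<le> l2n (\<lambda>\<xi>. FT (trunc (real n) f) \<xi> - g \<xi>)
        + sqrt (2 * pi) * (l2n (\<lambda>x. f x - trunc (real n) f x) + l2n (\<lambda>x. f x - trunc R f x))"
        using l2n_triangle_diff[OF g FT_trunc_L2[OF f] FT_trunc_L2[OF f], of R "real n"] diff[of "real n" R]
          l2n_minus_commute[of g "FT (trunc (real n) f)"] by linarith
    qed
    then show ?thesis by simp
  qed
  have "((\<lambda>R. l2n (\<lambda>\<xi>. g \<xi> - FT (trunc R f) \<xi>)) \<longlongrightarrow> 0) at_top"
  proof (rule tendsto_sandwich[OF _ _ tendsto_const])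
    show "((\<lambda>R. sqrt (2 * pi) * l2n (\<lambda>x. f x - trunc R f x)) \<longlongrightarrow> 0) at_top"
      using tendsto_mult_left[OF trunc_tendsto[OF f], of "sqrt (2 * pi)"] by simp
  qed (use le in auto)
  then show ?thesis using f g has_fourier_iff by blast
qed

lemma has_fourier_diff:
  assumes 1: "has_fourier f1 g1" and 2: "has_fourier f2 g2"
  shows "has_fourier (\<lambda>x. f1 x - f2 x) (\<lambda>\<xi>. g1 \<xi> - g2 \<xi>)"
proof -
  have L: "f1 \<in> L2" "g1 \<in> L2" "f2 \<in> L2" "g2 \<in> L2" using 1 2 by (auto simp: has_fourier_iff)
  have l: "((\<lambda>R. l2n (\<lambda>\<xi>. g1 \<xi> - FT (trunc R f1) \<xi>)) \<longlongrightarrow> 0) at_top"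
    "((\<lambda>R. l2n (\<lambda>\<xi>. g2 \<xi> - FT (trunc R f2) \<xi>)) \<longlongrightarrow> 0) at_top" using 1 2 by (auto simp: has_fourier_iff)
  have "((\<lambda>R. l2n (\<lambda>\<xi>. (g1 \<xi> - g2 \<xi>) - FT (trunc R (\<lambda>x. f1 x - f2 x)) \<xi>)) \<longlongrightarrow> 0) at_top"
  proof (rule tendsto_sandwich[OF _ _ tendsto_const])
    show "((\<lambda>R. l2n (\<lambda>\<xi>. g1 \<xi> - FT (trunc R f1) \<xi>) + l2n (\<lambda>\<xi>. g2 \<xi> - FT (trunc R f2) \<xi>)) \<longlongrightarrow> 0) at_top"
      using tendsto_add[OF l] by simp
    show "\<forall>\<^sub>F R in at_top. l2n (\<lambda>\<xi>. (g1 \<xi> - g2 \<xi>) - FT (trunc R (\<lambda>x. f1 x - f2 x)) \<xi>)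
       \<le> l2n (\<lambda>\<xi>. g1 \<xi> - FT (trunc R f1) \<xi>) + l2n (\<lambda>\<xi>. g2 \<xi> - FT (trunc R f2) \<xi>)"
    proof (intro always_eventually allI)
      fix R
      have tr: "trunc R (\<lambda>x. f1 x - f2 x) = (\<lambda>x. trunc R f1 x - trunc R f2 x)"
        by (simp add: trunc_def fun_eq_iff algebra_simps)
      have "(\<lambda>\<xi>. (g1 \<xi> - g2 \<xi>) - FT (trunc R (\<lambda>x. f1 x - f2 x)) \<xi>)
        = (\<lambda>\<xi>. (g1 \<xi> - FT (trunc R f1) \<xi>) + (-1) * (g2 \<xi> - FT (trunc R f2) \<xi>))"
        unfolding tr by (auto simp: FT_diff trunc_integrable L fun_eq_iff)
      then show "l2n (\<lambda>\<xi>. (g1 \<xi> - g2 \<xi>) - FT (trunc R (\<lambda>x. f1 x - f2 x)) \<xi>)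
       \<le> l2n (\<lambda>\<xi>. g1 \<xi> - FT (trunc R f1) \<xi>) + l2n (\<lambda>\<xi>. g2 \<xi> - FT (trunc R f2) \<xi>)"
        using l2n_triangle[OF L2_diff[OF L(2) FT_trunc_L2[OF L(1)]] L2_cmult[OF L2_diff[OF L(4) FT_trunc_L2[OF L(3)]]], of R "-1" R]
        unfolding l2n_cmult by simp
    qed
  qed auto
  then show ?thesis using L by (auto simp: has_fourier_iff L2_diff)
qed

theorem Plancherel: assumes "has_fourier f g" shows "l2n g = sqrt (2 * pi) * l2n f"
proof -
  have L: "f \<in> L2" "g \<in> L2" using assms by (auto simp: has_fourier_iff)
  have "((\<lambda>R. l2n (trunc R f)) \<longlongrightarrow> l2n f) at_top"
    by (rule Lim_transform2[OF tendsto_const]; rule Lim_null_comparison[OF _ trunc_tendsto[OF L(1)]])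
       (simp add: l2n_diff_abs L trunc_L2)
  then have "((\<lambda>R. l2n (FT (trunc R f))) \<longlongrightarrow> sqrt (2 * pi) * l2n f) at_top"
    unfolding Plancherel_L1_L2(2)[OF trunc_integrable[OF L(1)] trunc_L2[OF L(1)]] by (intro tendsto_intros)
  moreover have "((\<lambda>R. l2n (FT (trunc R f))) \<longlongrightarrow> l2n g) at_top"
    by (rule Lim_transform2[OF tendsto_const]; rule Lim_null_comparison[where g="\<lambda>R. l2n (\<lambda>\<xi>. g \<xi> - FT (trunc R f) \<xi>)"])
       (use assms in \<open>auto simp: l2n_diff_abs L FT_trunc_L2 has_fourier_iff\<close>)
  ultimately show ?thesis using tendsto_unique trivial_limit_at_top_linorder by blast
qed

text \<open>Plancherel's theorem for the difference, read in both directions: the transform is well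
  defined up to null sets, and it is injective.\<close>

lemma has_fourier_unique:
  assumes 1: "has_fourier f1 g1" and 2: "has_fourier f2 g2"
  shows "(AE x in lborel. f1 x = f2 x) \<longleftrightarrow> (AE \<xi> in lborel. g1 \<xi> = g2 \<xi>)"
proof -
  have L: "f1 \<in> L2" "g1 \<in> L2" "f2 \<in> L2" "g2 \<in> L2" using 1 2 by (auto simp: has_fourier_iff)
  show ?thesis
    using Plancherel[OF has_fourier_diff[OF 1 2]] l2n_eq_0[OF L2_diff[OF L(1,3)]] l2n_eq_0[OF L2_diff[OF L(2,4)]]
    by simp
qed

lemma has_fourier_FT:
  assumes f: "integrable lborel f" "f \<in> L2" shows "has_fourier f (FT f)"
  unfolding has_fourier_iff
  by (simp add: l2n_FT_diff f trunc_integrable trunc_L2 Plancherel_L1_L2)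
     (use tendsto_mult_left[OF trunc_tendsto[OF f(2)], of "sqrt (2 * pi)"] in simp)

lemma has_fourier_cong_AE:
  assumes fg: "has_fourier f g" and [measurable]: "f' \<in> borel_measurable borel" "g' \<in> borel_measurable borel"
    and ff: "AE x in lborel. f x = f' x" and gg: "AE \<xi> in lborel. g \<xi> = g' \<xi>"
  shows "has_fourier f' g'"
proof -
  have L: "f \<in> L2" "g \<in> L2" using fg by (auto simp: has_fourier_iff)
  note [measurable] = L2_measurable[OF L(1)] L2_measurable[OF L(2)]
  have L': "f' \<in> L2" "g' \<in> L2"
    using L ff gg by (auto intro: L2_AE_cong[OF L(1)] L2_AE_cong[OF L(2)])
  have "FT (trunc R f) = FT (trunc R f')" for R
    by (rule FT_cong_AE) (use ff in \<open>auto simp: trunc_def\<close>)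
  moreover have "l2n (\<lambda>\<xi>. g \<xi> - FT (trunc R f') \<xi>) = l2n (\<lambda>\<xi>. g' \<xi> - FT (trunc R f') \<xi>)" for R
    by (rule l2n_cong_AE) (use gg in auto)
  ultimately show ?thesis using fg L' by (simp add: has_fourier_iff)
qed

lemma has_fourier_fourier: "f \<in> L2 \<Longrightarrow> has_fourier f (fourier f)"
  unfolding fourier_def by (rule someI_ex[OF has_fourier_exists])

lemma fourier_AE_eq: "has_fourier f g \<Longrightarrow> AE \<xi> in lborel. fourier f \<xi> = g \<xi>"
  using has_fourier_unique[of f "fourier f" f g] has_fourier_fourier[of f] by (auto simp: has_fourier_iff)

section \<open>Inversion for integrable transforms\<close>

definition IFT :: "(real \<Rightarrow> complex) \<Rightarrow> real \<Rightarrow> complex" where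
  "IFT w x = FT w (- x) / complex_of_real (2 * pi)"

lemma AE_reflect:
  fixes f g :: "real \<Rightarrow> complex"
  assumes [measurable]: "f \<in> borel_measurable borel" "g \<in> borel_measurable borel"
    and "AE x in lborel. f x = g x"
  shows "AE x in lborel. f (- x) = g (- x)"
  using AE_borel_affine[of "-1" "\<lambda>x. f x = g x" 0] assms(3) by simp

lemma L2_reflect: "f \<in> L2 \<Longrightarrow> (\<lambda>x. f (- x)) \<in> L2"
  using L2_affine[of f "-1" 0] by simp

lemma l2n_reflect: "l2n (\<lambda>x. f (- x)) = l2n f"
  using l2n_affine[of "-1" f 0] by simp

lemma IFT_L2: assumes "integrable lborel w" "w \<in> L2" shows "IFT w \<in> L2" "(l2n w)\<^sup>2 = 2 * pi * (l2n (IFT w))\<^sup>2"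
proof -
  have eq: "IFT w = (\<lambda>x. (1 / complex_of_real (2 * pi)) * FT w (- x))" by (simp add: IFT_def fun_eq_iff)
  show "IFT w \<in> L2" unfolding eq by (intro L2_cmult L2_reflect Plancherel_L1_L2 assms)
  show "(l2n w)\<^sup>2 = 2 * pi * (l2n (IFT w))\<^sup>2"
    unfolding eq l2n_cmult l2n_reflect Plancherel_L1_L2(2)[OF assms]
    by (simp add: power_mult_distrib power2_eq_square field_simps norm_divide)
qed

text \<open>Inversion needs no second summability kernel. In the squared distance between
  \<open>w\<close> and the transform of \<open>trunc R (IFT w)\<close>, Fubini's theorem turns the
  cross term into 2 pi times the squared norm of the truncation. By Plancherel's theorem for
  \<open>w\<close> and for the truncation, what remains is 2 pi times the squared mass of
  \<open>IFT w\<close> outside [-R, R].\<close>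

theorem has_fourier_IFT:
  assumes w1: "integrable lborel w" and w2: "w \<in> L2" shows "has_fourier (IFT w) w"
proof -
  let ?u = "IFT w"
  note u2 = IFT_L2(1)[OF w1 w2]
  note [measurable] = L2_measurable[OF w2] L2_measurable[OF u2]
  have eq: "(l2n (\<lambda>\<xi>. w \<xi> - FT (trunc R ?u) \<xi>))\<^sup>2 = 2 * pi * ((l2n ?u)\<^sup>2 - (l2n (trunc R ?u))\<^sup>2)" for R
  proof -
    let ?v = "trunc R ?u"
    have v1: "integrable lborel ?v" by (rule trunc_integrable[OF u2])
    have wc: "integrable lborel (\<lambda>\<xi>. cnj (w \<xi>))" using w1 by (rule integrable_cnj)
    have int: "integrable (lborel \<Otimes>\<^sub>M lborel) (\<lambda>(x, \<xi>). ?v x * cnj (w (0 * x + \<xi>)))"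
      by (rule integrable_prod_shift[OF v1 wc])
    have int': "integrable (lborel \<Otimes>\<^sub>M lborel)
        (\<lambda>(x, \<xi>). wave_inv x \<xi> * ?v x * cnj (w \<xi>))"
      by (rule Bochner_Integration.integrable_bound[OF int]) (auto simp: norm_mult)
    have "(LINT \<xi>|lborel. FT ?v \<xi> * cnj (w \<xi>))
      = (LINT \<xi>|lborel. LINT x|lborel. wave_inv x \<xi> * ?v x * cnj (w \<xi>))"
      unfolding FT_def by simp
    also have "\<dots> = (LINT x|lborel. LINT \<xi>|lborel. wave_inv x \<xi> * ?v x * cnj (w \<xi>))"
      by (rule lborel_pair.Fubini_integral[OF int'])
    also have "\<dots> = (LINT x|lborel. complex_of_real (2 * pi) * (?v x * cnj (?v x)))"
    proof (rule Bochner_Integration.integral_cong[OF refl])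
      fix x
      have "cnj (?u x) * complex_of_real (2 * pi) = (LINT \<xi>|lborel. wave \<xi> (- x) * cnj (w \<xi>))"
        unfolding IFT_def by (simp add: FT_cnj)
      then have "?v x * (cnj (?u x) * complex_of_real (2 * pi)) = (LINT \<xi>|lborel. ?v x * (wave \<xi> (- x) * cnj (w \<xi>)))"
        by (simp only: integral_mult_right_zero)
      also have "\<dots> = (LINT \<xi>|lborel. wave_inv x \<xi> * ?v x * cnj (w \<xi>))"
        by (simp add: mult_ac)
      also have "?v x * (cnj (?u x) * complex_of_real (2 * pi)) = complex_of_real (2 * pi) * (?v x * cnj (?v x))"
        by (simp add: trunc_def indicator_def)
      finally show "(LINT \<xi>|lborel. wave_inv x \<xi> * ?v x * cnj (w \<xi>))
        = complex_of_real (2 * pi) * (?v x * cnj (?v x))" by (rule sym)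
    qed
    also have "\<dots> = complex_of_real (2 * pi * (l2n ?v)\<^sup>2)"
      unfolding integral_mult_right_zero of_real_mult[of "2 * pi"] l2n_square integral_complex_of_real[symmetric]
      by (simp only: complex_norm_square)
    finally have "Re (LINT \<xi>|lborel. FT ?v \<xi> * cnj (w \<xi>)) = 2 * pi * (l2n ?v)\<^sup>2" by simp
    then show ?thesis
      unfolding l2n_square_diff[OF w2 FT_trunc_L2[OF u2]]
      by (simp add: Plancherel_L1_L2(2)[OF v1 trunc_L2[OF u2]] IFT_L2(2)[OF w1 w2] power_mult_distrib algebra_simps)
  qed
  have "((\<lambda>R. l2n (trunc R ?u)) \<longlongrightarrow> l2n ?u) at_top"
    by (rule Lim_transform2[OF tendsto_const]; rule Lim_null_comparison[OF _ trunc_tendsto[OF u2]])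
       (simp add: l2n_diff_abs u2 trunc_L2)
  then have "((\<lambda>R. 2 * pi * ((l2n ?u)\<^sup>2 - (l2n (trunc R ?u))\<^sup>2)) \<longlongrightarrow> 2 * pi * ((l2n ?u)\<^sup>2 - (l2n ?u)\<^sup>2)) at_top"
    by (intro tendsto_intros)
  then have "((\<lambda>R. sqrt ((l2n (\<lambda>\<xi>. w \<xi> - FT (trunc R ?u) \<xi>))\<^sup>2)) \<longlongrightarrow> sqrt 0) at_top"
    unfolding eq by (intro tendsto_real_sqrt) simp
  then show ?thesis using u2 w2 by (simp add: has_fourier_iff)
qed

text \<open>Together with uniqueness this makes the transform of a real-valued function Hermitian
  almost everywhere.\<close>

lemma has_fourier_cnj:
  assumes "has_fourier f g" shows "has_fourier (\<lambda>x. cnj (f x)) (\<lambda>\<xi>. cnj (g (- \<xi>)))"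
proof -
  have L: "f \<in> L2" "g \<in> L2" using assms by (auto simp: has_fourier_iff)
  have "FT (trunc R (\<lambda>x. cnj (f x))) \<xi> = cnj (FT (trunc R f) (- \<xi>))" for R \<xi>
    unfolding FT_cnj by (auto simp: FT_def trunc_def indicator_def intro!: Bochner_Integration.integral_cong)
  then have "l2n (\<lambda>\<xi>. cnj (g (- \<xi>)) - FT (trunc R (\<lambda>x. cnj (f x))) \<xi>) = l2n (\<lambda>\<xi>. g \<xi> - FT (trunc R f) \<xi>)" for R
    using l2n_cnj[of "\<lambda>\<xi>. g (- \<xi>) - FT (trunc R f) (- \<xi>)"] l2n_reflect[of "\<lambda>\<xi>. g \<xi> - FT (trunc R f) \<xi>"] by simp
  then show ?thesis using assms by (auto simp: has_fourier_iff intro: L2_cnj L2_reflect)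
qed

section \<open>Convolution\<close>

definition conv :: "(real \<Rightarrow> complex) \<Rightarrow> (real \<Rightarrow> complex) \<Rightarrow> real \<Rightarrow> complex" where
  "conv f g \<xi> = (LINT \<eta>|lborel. f \<eta> * g (\<xi> - \<eta>))"

lemma conv_measurable [measurable]:
  assumes [measurable]: "f \<in> borel_measurable borel" "g \<in> borel_measurable borel"
  shows "conv f g \<in> borel_measurable borel"
  unfolding conv_def[abs_def] by measurable

lemma L2_reflect_shift: "g \<in> L2 \<Longrightarrow> (\<lambda>\<eta>. g (\<xi> - \<eta>)) \<in> L2"
  using L2_affine[of g "-1" \<xi>] by simp

lemma conv_integrand: "f \<in> L2 \<Longrightarrow> g \<in> L2 \<Longrightarrow> integrable lborel (\<lambda>\<eta>. f \<eta> * g (\<xi> - \<eta>))"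
  by (intro L2_mult_integrable L2_reflect_shift)

lemma norm_conv_le: "f \<in> L2 \<Longrightarrow> g \<in> L2 \<Longrightarrow> norm (conv f g \<xi>) \<le> l2n f * l2n g"
  using L2_Cauchy_Schwarz'[OF _ L2_reflect_shift, of f g \<xi>] l2n_affine[of "-1" g \<xi>] by (simp add: conv_def)

text \<open>Each value is an integral, so null sets disappear altogether; this makes the
  nonlinearity well defined on classes of functions.\<close>

lemma conv_cong_AE:
  assumes [measurable]: "f \<in> borel_measurable borel" "f' \<in> borel_measurable borel"
      "g \<in> borel_measurable borel" "g' \<in> borel_measurable borel"
    and f: "AE x in lborel. f x = f' x" and g: "AE x in lborel. g x = g' x"
  shows "conv f g = conv f' g'"
proof
  fix \<xi>
  have "AE \<eta> in lborel. g (\<xi> + (-1) * \<eta>) = g' (\<xi> + (-1) * \<eta>)"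
    by (rule AE_borel_affine[OF _ _ g]) auto
  then show "conv f g \<xi> = conv f' g' \<xi>"
    unfolding conv_def using f by (intro integral_cong_AE) auto
qed

lemma conv_hermitian:
  assumes "\<And>x. f (- x) = cnj (f x)" "\<And>x. g (- x) = cnj (g x)"
  shows "conv f g (- \<xi>) = cnj (conv f g \<xi>)"
proof -
  have "conv f g (- \<xi>) = (LINT \<eta>|lborel. f (0 + (-1) * \<eta>) * g (- \<xi> - (0 + (-1) * \<eta>)))"
    unfolding conv_def by (subst lborel_integral_real_affine[of "-1" _ 0]) auto
  also have "\<dots> = (LINT \<eta>|lborel. cnj (f \<eta> * g (\<xi> - \<eta>)))"
    using assms(2)[of "\<xi> - _"] by (simp add: assms(1))
  also have "\<dots> = cnj (conv f g \<xi>)" unfolding conv_def by (rule Bochner_Integration.integral_cnj)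
  finally show ?thesis .
qed

lemma conv_add_left: "f \<in> L2 \<Longrightarrow> f' \<in> L2 \<Longrightarrow> g \<in> L2 \<Longrightarrow> conv (\<lambda>x. f x + f' x) g \<xi> = conv f g \<xi> + conv f' g \<xi>"
  unfolding conv_def distrib_right by (intro Bochner_Integration.integral_add conv_integrand)

lemma conv_add_right: "f \<in> L2 \<Longrightarrow> g \<in> L2 \<Longrightarrow> g' \<in> L2 \<Longrightarrow> conv f (\<lambda>x. g x + g' x) \<xi> = conv f g \<xi> + conv f g' \<xi>"
  unfolding conv_def distrib_left by (intro Bochner_Integration.integral_add conv_integrand)

lemma conv_cmult: "conv (\<lambda>x. c * f x) g \<xi> = c * conv f g \<xi>" "conv f (\<lambda>x. c * g x) \<xi> = c * conv f g \<xi>"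
  unfolding conv_def by (simp_all add: mult_ac flip: integral_mult_right_zero)

lemma
  assumes f: "integrable lborel f" and g: "integrable lborel g"
  shows conv_integrable: "integrable lborel (conv f g)"
    and FT_conv: "FT (conv f g) \<xi> = FT f \<xi> * FT g \<xi>"
proof -
  have [measurable]: "f \<in> borel_measurable borel" "g \<in> borel_measurable borel" using f g by auto
  have int: "integrable (lborel \<Otimes>\<^sub>M lborel) (\<lambda>(\<eta>, \<zeta>). f \<eta> * g (\<zeta> - \<eta>))"
    using integrable_prod_shift[OF f g, of "-1"] by simp
  show "integrable lborel (conv f g)"
    unfolding conv_def[abs_def] by (rule lborel_pair.integrable_snd[OF int])
  let ?e = "\<lambda>x. wave_inv x \<xi>"
  have int': "integrable (lborel \<Otimes>\<^sub>M lborel) (\<lambda>(\<eta>, \<zeta>). ?e \<zeta> * (f \<eta> * g (\<zeta> - \<eta>)))"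
    by (rule Bochner_Integration.integrable_bound[OF int]) (auto simp: norm_mult)
  have "FT (conv f g) \<xi> = (LINT \<zeta>|lborel. LINT \<eta>|lborel. ?e \<zeta> * (f \<eta> * g (\<zeta> - \<eta>)))"
    unfolding FT_def conv_def by simp
  also have "\<dots> = (LINT \<eta>|lborel. LINT \<zeta>|lborel. ?e \<zeta> * (f \<eta> * g (\<zeta> - \<eta>)))"
    by (rule lborel_pair.Fubini_integral[OF int'])
  also have "\<dots> = (LINT \<eta>|lborel. ?e \<eta> * f \<eta> * FT g \<xi>)"
  proof (rule Bochner_Integration.integral_cong[OF refl])
    fix \<eta>
    have e: "?e (\<eta> + z) = ?e \<eta> * ?e z" for z
      by (simp add: exp_add[symmetric] algebra_simps)
    have "(LINT \<zeta>|lborel. ?e \<zeta> * (f \<eta> * g (\<zeta> - \<eta>))) = (LINT z|lborel. ?e (\<eta> + z) * (f \<eta> * g (\<eta> + z - \<eta>)))"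
      by (subst lborel_integral_real_affine[of 1 _ \<eta>]) auto
    also have "\<dots> = (LINT z|lborel. ?e \<eta> * f \<eta> * (?e z * g z))"
      unfolding e by (simp only: add_diff_cancel_left' mult_ac)
    also have "\<dots> = ?e \<eta> * f \<eta> * FT g \<xi>" unfolding FT_def by (rule integral_mult_right_zero)
    finally show "(LINT \<zeta>|lborel. ?e \<zeta> * (f \<eta> * g (\<zeta> - \<eta>))) = ?e \<eta> * f \<eta> * FT g \<xi>" .
  qed
  also have "\<dots> = FT f \<xi> * FT g \<xi>" by (simp add: FT_def)
  finally show "FT (conv f g) \<xi> = FT f \<xi> * FT g \<xi>" .
qed

lemma conv_L2:
  assumes f: "integrable lborel f" "f \<in> L2" and g: "integrable lborel g" "g \<in> L2"
  shows "conv f g \<in> L2"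
  unfolding L2_def
proof (intro CollectI conjI)
  note [measurable] = L2_measurable[OF f(2)] L2_measurable[OF g(2)]
  show "conv f g \<in> borel_measurable lborel" by simp
  show "integrable lborel (\<lambda>x. (norm (conv f g x))\<^sup>2)"
  proof (rule Bochner_Integration.integrable_bound)
    show "integrable lborel (\<lambda>x. (l2n f * l2n g) * norm (conv f g x))"
      by (intro integrable_mult_right integrable_norm conv_integrable f g)
    show "AE x in lborel. norm ((norm (conv f g x))\<^sup>2) \<le> norm ((l2n f * l2n g) * norm (conv f g x))"
      using norm_conv_le[OF f(2) g(2)] by (auto simp: power2_eq_square abs_mult intro!: mult_right_mono)
  qed simp
qed

lemma IFT_mult:
  assumes f: "integrable lborel f" and g: "integrable lborel g"
  shows "IFT f x * IFT g x = IFT (\<lambda>\<xi>. conv f g \<xi> / complex_of_real (2 * pi)) x"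
proof -
  have "FT (\<lambda>\<xi>. conv f g \<xi> / complex_of_real (2 * pi)) = (\<lambda>\<xi>. FT (conv f g) \<xi> / complex_of_real (2 * pi))"
    using FT_cmult[of "1 / complex_of_real (2 * pi)" "conv f g"] by (simp add: fun_eq_iff)
  then show ?thesis by (simp add: IFT_def FT_conv[OF f g])
qed

section \<open>The symbol of the equation\<close>

definition bbm_symbol :: "real \<Rightarrow> complex" where
  "bbm_symbol \<xi> = \<i> * complex_of_real \<xi> / complex_of_real (1 + \<xi>\<^sup>2)"

lemma bbm_symbol_measurable [measurable]: "bbm_symbol \<in> borel_measurable borel"
  unfolding bbm_symbol_def[abs_def] by measurable

lemma norm_bbm_symbol: "norm (bbm_symbol \<xi>) = \<bar>\<xi>\<bar> / (1 + \<xi>\<^sup>2)"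
  unfolding bbm_symbol_def norm_divide norm_mult norm_of_real by simp

lemma norm_bbm_symbol_le: "norm (bbm_symbol \<xi>) \<le> 1"
proof -
  have "\<bar>\<xi>\<bar> \<le> 1 + \<xi>\<^sup>2" using sum_squares_bound[of 1 "\<bar>\<xi>\<bar>"] by (simp add: power2_eq_square)
  then show ?thesis unfolding norm_bbm_symbol by (simp add: add_pos_nonneg)
qed

lemma bbm_symbol_mult_integrable:
  "integrable lborel w \<Longrightarrow> integrable lborel (\<lambda>\<xi>. bbm_symbol \<xi> * w \<xi>)"
  by (rule Bochner_Integration.integrable_bound[of _ w])
     (auto simp: norm_mult norm_bbm_symbol_le intro!: mult_left_le_one_le)

lemma bbm_symbol_mult_L2: "w \<in> L2 \<Longrightarrow> (\<lambda>\<xi>. bbm_symbol \<xi> * w \<xi>) \<in> L2"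
  by (rule L2_bounded_mult[OF _ _ norm_bbm_symbol_le]) auto

text \<open>\<open>phi_D\<close> is built from two arbitrarily chosen transforms and is therefore
  determined only up to null sets. When \<open>w\<close> is integrable, the outer one can be taken
  to be the integral formula.\<close>

lemma phi_D_AE_eq:
  assumes f: "has_fourier f w" and w: "integrable lborel w"
  shows "AE x in lborel. phi_D f x = IFT (\<lambda>\<xi>. bbm_symbol \<xi> * w \<xi>) x"
proof -
  have L: "f \<in> L2" "w \<in> L2" using f by (auto simp: has_fourier_iff)
  let ?G = "\<lambda>\<xi>. bbm_symbol \<xi> * fourier f \<xi>" and ?W = "\<lambda>\<xi>. bbm_symbol \<xi> * w \<xi>"
  have ff: "has_fourier f (fourier f)" by (rule has_fourier_fourier[OF L(1)])
  then have f2: "fourier f \<in> L2" by (simp add: has_fourier_iff)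
  note [measurable] = L2_measurable[OF f2] L2_measurable[OF L(2)]
  have W: "has_fourier ?W (FT ?W)" by (intro has_fourier_FT bbm_symbol_mult_integrable bbm_symbol_mult_L2 w L)
  then have W2: "FT ?W \<in> L2" by (simp add: has_fourier_iff)
  have "AE \<xi> in lborel. ?W \<xi> = ?G \<xi>" using fourier_AE_eq[OF f] by eventually_elim simp
  then have "has_fourier ?G (FT ?W)"
    by (intro has_fourier_cong_AE[OF W]) (use L2_measurable[OF W2] in auto)
  moreover from this have G2: "fourier ?G \<in> L2" using has_fourier_fourier[of ?G] by (simp add: has_fourier_iff)
  ultimately have "AE \<xi> in lborel. fourier ?G (- \<xi>) = FT ?W (- \<xi>)"
    by (intro AE_reflect fourier_AE_eq) (use L2_measurable[OF W2] L2_measurable[OF G2] in auto)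
  then show ?thesis
    unfolding phi_D_def fourier_multiplier_def inv_fourier_def IFT_def
    by eventually_elim (simp add: bbm_symbol_def)
qed

section \<open>The Hilbert space of Hermitian functions\<close>

text \<open>Besides encoding real-valued solutions, the symmetry is what allows the three
  frequencies to be permuted in the energy estimate. It is demanded at every point;
  \<open>symmetrize\<close> restores it for limits and for chosen transforms.\<close>

definition hermL2 :: "(real \<Rightarrow> complex) set" where
  "hermL2 = {f \<in> L2. \<forall>\<xi>. f (- \<xi>) = cnj (f \<xi>)}"

lemma hermL2_L2: "f \<in> hermL2 \<Longrightarrow> f \<in> L2" by (simp add: hermL2_def)

lemma hermL2_measurable [measurable_dest]: "f \<in> hermL2 \<Longrightarrow> f \<in> borel_measurable borel"
  by (intro L2_measurable hermL2_L2)

lemma hermL2_reflect: "f \<in> hermL2 \<Longrightarrow> f (- \<xi>) = cnj (f \<xi>)" by (simp add: hermL2_def)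

lemma hermL2_zero: "(\<lambda>_. 0) \<in> hermL2" by (simp add: hermL2_def)

lemma hermL2_add: "f \<in> hermL2 \<Longrightarrow> g \<in> hermL2 \<Longrightarrow> (\<lambda>\<xi>. f \<xi> + g \<xi>) \<in> hermL2"
  by (simp add: hermL2_def L2_add)

lemma hermL2_diff: "f \<in> hermL2 \<Longrightarrow> g \<in> hermL2 \<Longrightarrow> (\<lambda>\<xi>. f \<xi> - g \<xi>) \<in> hermL2"
  by (simp add: hermL2_def L2_diff)

lemma hermL2_cmult: "f \<in> hermL2 \<Longrightarrow> (\<lambda>\<xi>. complex_of_real c * f \<xi>) \<in> hermL2"
  by (simp add: hermL2_def L2_cmult)

text \<open>Hermitian functions are the transforms of real-valued ones. Almost everywhere equal functions
  are identified by choosing one representative of each class.\<close>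

definition canon :: "(real \<Rightarrow> complex) \<Rightarrow> real \<Rightarrow> complex" where
  "canon f = (SOME g. g \<in> hermL2 \<and> (AE \<xi> in lborel. g \<xi> = f \<xi>))"

lemma canon: "f \<in> hermL2 \<Longrightarrow> canon f \<in> hermL2 \<and> (AE \<xi> in lborel. canon f \<xi> = f \<xi>)"
  unfolding canon_def by (rule someI[of _ f]) simp

lemma canon_cong: "AE \<xi> in lborel. f \<xi> = g \<xi> \<Longrightarrow> canon f = canon g"
proof -
  assume fg: "AE \<xi> in lborel. f \<xi> = g \<xi>"
  have "(AE \<xi> in lborel. h \<xi> = f \<xi>) \<longleftrightarrow> (AE \<xi> in lborel. h \<xi> = g \<xi>)" for h
  proof
    assume "AE \<xi> in lborel. h \<xi> = f \<xi>" with fg show "AE \<xi> in lborel. h \<xi> = g \<xi>" by eventually_elim simp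
  next
    assume "AE \<xi> in lborel. h \<xi> = g \<xi>" with fg show "AE \<xi> in lborel. h \<xi> = f \<xi>" by eventually_elim simp
  qed
  then show ?thesis by (simp add: canon_def)
qed

lemma canon_canon: "f \<in> hermL2 \<Longrightarrow> canon (canon f) = canon f"
  using canon by (intro canon_cong) auto

text \<open>A type rather than a set, since the results on differential equations are formulated for
  the classes \<open>real_inner\<close> and \<open>banach\<close>.\<close>

typedef hl2 = "{f \<in> hermL2. canon f = f}" morphisms rep Abs_hl2
  using canon[OF hermL2_zero] canon_canon[OF hermL2_zero] by blast

definition mk :: "(real \<Rightarrow> complex) \<Rightarrow> hl2" where "mk f = Abs_hl2 (canon f)"

lemma rep_herm [simp]: "rep x \<in> hermL2" using rep[of x] by simp

lemma rep_L2 [simp]: "rep x \<in> L2" by (simp add: hermL2_L2)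

lemma rep_measurable [measurable]: "rep x \<in> borel_measurable borel" by (simp add: hermL2_measurable)

lemma mk_rep [simp]: "mk (rep x) = x"
  using rep[of x] rep_inverse[of x] by (simp add: mk_def)

lemma rep_mk: "f \<in> hermL2 \<Longrightarrow> AE \<xi> in lborel. rep (mk f) \<xi> = f \<xi>"
  using canon[of f] canon_canon[of f] by (simp add: mk_def Abs_hl2_inverse)

lemma mk_cong: "AE \<xi> in lborel. f \<xi> = g \<xi> \<Longrightarrow> mk f = mk g"
  unfolding mk_def by (simp add: canon_cong)

lemma mk_eq_iff: "f \<in> hermL2 \<Longrightarrow> g \<in> hermL2 \<Longrightarrow> mk f = mk g \<longleftrightarrow> (AE \<xi> in lborel. f \<xi> = g \<xi>)"
proof
  assume f: "f \<in> hermL2" and g: "g \<in> hermL2" and "mk f = mk g"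
  then have "AE \<xi> in lborel. rep (mk f) \<xi> = g \<xi>" using rep_mk[OF g] by simp
  with rep_mk[OF f] show "AE \<xi> in lborel. f \<xi> = g \<xi>" by eventually_elim simp
qed (rule mk_cong)

lemma hl2_cases: obtains f where "f \<in> hermL2" "x = mk f"
  by (rule that[of "rep x"]) auto

instantiation hl2 :: real_inner
begin

definition "0 = mk (\<lambda>_. 0)"
definition "x + y = mk (\<lambda>\<xi>. rep x \<xi> + rep y \<xi>)"
definition "- x = mk (\<lambda>\<xi>. - rep x \<xi>)"
definition "x - y = mk (\<lambda>\<xi>. rep x \<xi> - rep y \<xi>)"
definition "c *\<^sub>R x = mk (\<lambda>\<xi>. complex_of_real c * rep x \<xi>)"
definition "inner x y = (LINT \<xi>|lborel. Re (rep x \<xi> * cnj (rep y \<xi>)))"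
definition norm_hl2_def: "norm (x::hl2) = sqrt (inner x x)"
definition sgn_hl2_def: "sgn (x::hl2) = inverse (norm x) *\<^sub>R x"
definition "dist (x::hl2) y = norm (x - y)"
definition [code del]: "(uniformity :: (hl2 \<times> hl2) filter) = (INF e\<in>{0<..}. principal {(x, y). dist x y < e})"
definition [code del]: "open (U :: hl2 set) = (\<forall>x\<in>U. eventually (\<lambda>(x', y). x' = x \<longrightarrow> y \<in> U) uniformity)"

lemma mk_add: "f \<in> hermL2 \<Longrightarrow> g \<in> hermL2 \<Longrightarrow> mk f + mk g = mk (\<lambda>\<xi>. f \<xi> + g \<xi>)"
  unfolding plus_hl2_def using rep_mk[of f] rep_mk[of g] by (intro mk_cong) auto

lemma mk_diff: "f \<in> hermL2 \<Longrightarrow> g \<in> hermL2 \<Longrightarrow> mk f - mk g = mk (\<lambda>\<xi>. f \<xi> - g \<xi>)"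
  unfolding minus_hl2_def using rep_mk[of f] rep_mk[of g] by (intro mk_cong) auto

lemma mk_uminus: "f \<in> hermL2 \<Longrightarrow> - mk f = mk (\<lambda>\<xi>. - f \<xi>)"
  unfolding uminus_hl2_def using rep_mk[of f] by (intro mk_cong) auto

lemma mk_scaleR: "f \<in> hermL2 \<Longrightarrow> c *\<^sub>R mk f = mk (\<lambda>\<xi>. complex_of_real c * f \<xi>)"
  unfolding scaleR_hl2_def using rep_mk[of f] by (intro mk_cong) auto

lemma inner_mk:
  assumes [measurable]: "f \<in> hermL2" "g \<in> hermL2"
  shows "inner (mk f) (mk g) = (LINT \<xi>|lborel. Re (f \<xi> * cnj (g \<xi>)))"
  unfolding inner_hl2_def using rep_mk[OF assms(1)] rep_mk[OF assms(2)] by (intro integral_cong_AE) auto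

lemma integrable_inner: "f \<in> hermL2 \<Longrightarrow> g \<in> hermL2 \<Longrightarrow> integrable lborel (\<lambda>\<xi>. Re (f \<xi> * cnj (g \<xi>)))"
  by (intro integrable_Re L2_mult_integrable L2_cnj hermL2_L2)

lemma inner_mk_self: assumes "f \<in> hermL2" shows "inner (mk f) (mk f) = (l2n f)\<^sup>2"
proof -
  have "Re (z * cnj z) = (norm z)\<^sup>2" for z by (simp add: cmod_power2) (simp add: power2_eq_square)
  then show ?thesis by (simp add: inner_mk assms l2n_square)
qed

instance
proof
  fix x y z :: hl2 and a b :: real
  obtain f where f: "f \<in> hermL2" "x = mk f" by (rule hl2_cases)
  obtain g where g: "g \<in> hermL2" "y = mk g" by (rule hl2_cases)
  obtain h where h: "h \<in> hermL2" "z = mk h" by (rule hl2_cases)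
  note s = f g h hermL2_zero mk_add mk_diff mk_uminus mk_scaleR hermL2_add hermL2_diff hermL2_cmult zero_hl2_def
  have um: "(\<lambda>\<xi>. - k \<xi>) \<in> hermL2" if "k \<in> hermL2" for k using hermL2_cmult[OF that, of "-1"] by simp
  show "x + y + z = x + (y + z)" by (simp add: s add.assoc)
  show "x + y = y + x" by (simp add: s add.commute)
  show "0 + x = x" by (simp add: s)
  show "- x + x = 0" by (simp add: s um)
  show "x - y = x + - y" by (simp add: s um)
  show "a *\<^sub>R (x + y) = a *\<^sub>R x + a *\<^sub>R y" by (simp add: s distrib_left)
  show "(a + b) *\<^sub>R x = a *\<^sub>R x + b *\<^sub>R x" by (simp add: s distrib_right)
  show "a *\<^sub>R b *\<^sub>R x = (a * b) *\<^sub>R x" by (simp add: s mult.assoc)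
  show "1 *\<^sub>R x = x" by (simp add: s)
  show "inner x y = inner y x"
    unfolding inner_hl2_def by (intro Bochner_Integration.integral_cong) (auto simp: mult.commute)
  show "inner (x + y) z = inner x z + inner y z"
  proof -
    have "inner (x + y) z = (LINT \<xi>|lborel. Re (f \<xi> * cnj (h \<xi>)) + Re (g \<xi> * cnj (h \<xi>)))"
      by (simp only: f(2) g(2) h(2) mk_add[OF f(1) g(1)] inner_mk[OF hermL2_add[OF f(1) g(1)] h(1)] distrib_right plus_complex.sel)
    then show ?thesis
      by (simp only: f(2) g(2) h(2) inner_mk f(1) g(1) h(1) Bochner_Integration.integral_add integrable_inner)
  qed
  show "inner (a *\<^sub>R x) y = a * inner x y"
  proof -
    have "inner (a *\<^sub>R x) y = (LINT \<xi>|lborel. a * Re (f \<xi> * cnj (g \<xi>)))"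
      unfolding f(2) g(2) mk_scaleR[OF f(1)] inner_mk[OF hermL2_cmult[OF f(1)] g(1)] by (simp add: algebra_simps)
    then show ?thesis by (simp only: f(2) g(2) inner_mk f(1) g(1) integral_mult_right_zero)
  qed
  show "0 \<le> inner x x" by (simp add: f inner_mk_self)
  show "inner x x = 0 \<longleftrightarrow> x = 0"
    by (simp add: f inner_mk_self l2n_eq_0[OF hermL2_L2] zero_hl2_def mk_eq_iff hermL2_zero)
qed (simp_all add: norm_hl2_def sgn_hl2_def dist_hl2_def uniformity_hl2_def open_hl2_def)

end

lemma norm_mk: "f \<in> hermL2 \<Longrightarrow> norm (mk f) = l2n f"
  by (simp add: norm_eq_sqrt_inner inner_mk_self)

lemma norm_rep: "norm x = l2n (rep x)"
  using norm_mk[of "rep x"] by simp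

lemma rep_diff: "AE \<xi> in lborel. rep (x - y) \<xi> = rep x \<xi> - rep y \<xi>"
  using rep_mk[OF hermL2_diff[OF rep_herm rep_herm]] by (simp add: minus_hl2_def)

lemma rep_scaleR: "AE \<xi> in lborel. rep (c *\<^sub>R x) \<xi> = complex_of_real c * rep x \<xi>"
  using rep_mk[OF hermL2_cmult[OF rep_herm]] by (simp add: scaleR_hl2_def)

text \<open>The real-linear projection of \<open>L2\<close> onto the Hermitian functions. It
  averages two isometries that fix every Hermitian function, so it moves no function farther away
  from a Hermitian one.\<close>

definition symmetrize :: "(real \<Rightarrow> complex) \<Rightarrow> real \<Rightarrow> complex" where
  "symmetrize g \<xi> = (g \<xi> + cnj (g (- \<xi>))) / 2"

lemma symmetrize_herm: assumes g: "g \<in> L2" shows "symmetrize g \<in> hermL2"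
proof -
  have "(\<lambda>\<xi>. (1 / 2) * (g \<xi> + cnj (g (- \<xi>)))) \<in> L2"
    by (intro L2_cmult L2_add L2_cnj L2_reflect g)
  then have "symmetrize g \<in> L2" by (simp add: symmetrize_def[abs_def])
  then show ?thesis by (simp add: hermL2_def symmetrize_def add.commute)
qed

lemma l2n_diff_symmetrize_le:
  assumes f: "f \<in> hermL2" and g: "g \<in> L2"
  shows "l2n (\<lambda>\<xi>. f \<xi> - symmetrize g \<xi>) \<le> l2n (\<lambda>\<xi>. f \<xi> - g \<xi>)"
proof -
  have fL: "f \<in> L2" using f by (rule hermL2_L2)
  have d: "(\<lambda>\<xi>. f \<xi> - g \<xi>) \<in> L2" by (rule L2_diff[OF fL g])
  have d': "(\<lambda>\<xi>. cnj (f (- \<xi>) - g (- \<xi>))) \<in> L2" by (rule L2_cnj[OF L2_reflect[OF d]])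
  have "(\<lambda>\<xi>. f \<xi> - symmetrize g \<xi>) = (\<lambda>\<xi>. (1 / 2) * ((f \<xi> - g \<xi>) + cnj (f (- \<xi>) - g (- \<xi>))))"
    by (simp add: symmetrize_def hermL2_reflect[OF f] fun_eq_iff field_simps)
  then have "l2n (\<lambda>\<xi>. f \<xi> - symmetrize g \<xi>) = 1 / 2 * l2n (\<lambda>\<xi>. (f \<xi> - g \<xi>) + cnj (f (- \<xi>) - g (- \<xi>)))"
    by (simp only: l2n_cmult) simp
  also have "\<dots> \<le> 1 / 2 * (l2n (\<lambda>\<xi>. f \<xi> - g \<xi>) + l2n (\<lambda>\<xi>. cnj (f (- \<xi>) - g (- \<xi>))))"
    by (intro mult_left_mono l2n_triangle d d') auto
  also have "l2n (\<lambda>\<xi>. cnj (f (- \<xi>) - g (- \<xi>))) = l2n (\<lambda>\<xi>. f \<xi> - g \<xi>)"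
    using l2n_reflect[of "\<lambda>\<xi>. f \<xi> - g \<xi>"] by (simp only: l2n_cnj)
  finally show ?thesis by simp
qed

text \<open>The limit supplied by \<open>Riesz_Fischer\<close> need not be Hermitian at every point,
  but its symmetrization is at least as close to each member of the sequence.\<close>

instance hl2 :: banach
proof
  fix X :: "nat \<Rightarrow> hl2" assume X: "Cauchy X"
  have n: "norm (x - y) = l2n (\<lambda>\<xi>. rep x \<xi> - rep y \<xi>)" for x y
    unfolding minus_hl2_def by (rule norm_mk[OF hermL2_diff[OF rep_herm rep_herm]])
  obtain g where g: "g \<in> L2" and lim: "(\<lambda>n. l2n (\<lambda>\<xi>. rep (X n) \<xi> - g \<xi>)) \<longlonglongrightarrow> 0"
  proof (rule Riesz_Fischer[of "\<lambda>n. rep (X n)"])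
    fix e :: real assume "e > 0"
    then show "\<exists>N. \<forall>i\<ge>N. \<forall>j\<ge>N. l2n (\<lambda>x. rep (X i) x - rep (X j) x) < e"
      using X unfolding Cauchy_def dist_norm n by blast
  qed auto
  have "(\<lambda>n. norm (X n - mk (symmetrize g))) \<longlonglongrightarrow> 0"
  proof (rule tendsto_sandwich[OF _ _ tendsto_const lim])
    have "norm (X n - mk (symmetrize g)) \<le> l2n (\<lambda>\<xi>. rep (X n) \<xi> - g \<xi>)" for n
    proof -
      have "X n - mk (symmetrize g) = mk (\<lambda>\<xi>. rep (X n) \<xi> - symmetrize g \<xi>)"
        using mk_diff[OF rep_herm symmetrize_herm[OF g], of "X n"] by simp
      then show ?thesis
        by (simp add: norm_mk[OF hermL2_diff[OF rep_herm symmetrize_herm[OF g]]] l2n_diff_symmetrize_le g)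
    qed
    then show "\<forall>\<^sub>F n in sequentially. norm (X n - mk (symmetrize g)) \<le> l2n (\<lambda>\<xi>. rep (X n) \<xi> - g \<xi>)" by simp
  qed auto
  then show "convergent X" by (metis Lim_null convergent_def tendsto_norm_zero_iff)
qed

section \<open>The equation on the Fourier side\<close>

lemma nn_integral_reflect_shift:
  assumes [measurable]: "f \<in> borel_measurable borel"
  shows "(\<integral>\<^sup>+\<eta>. f (\<xi> - \<eta>) \<partial>lborel) = (\<integral>\<^sup>+\<eta>. f \<eta> \<partial>(lborel :: real measure))"
  using nn_integral_real_affine[of f "-1" \<xi>] by simp

lemma nn_integral_shift:
  assumes [measurable]: "f \<in> borel_measurable borel"
  shows "(\<integral>\<^sup>+\<xi>. f (\<xi> - \<eta>) \<partial>lborel) = (\<integral>\<^sup>+\<xi>. f \<xi> \<partial>(lborel :: real measure))"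
  using nn_integral_real_affine[of f 1 "- \<eta>"] by simp

text \<open>The Cauchy-Schwarz inequality in the measure with density \<open>a\<close>, followed by
  Fubini's theorem. With nonnegative extended integrals nothing has to be known to be finite in
  advance.\<close>

lemma nn_integral_Young:
  fixes a b :: "real \<Rightarrow> ennreal"
  assumes [measurable]: "a \<in> borel_measurable borel" "b \<in> borel_measurable borel"
  shows "(\<integral>\<^sup>+\<xi>. (\<integral>\<^sup>+\<eta>. a \<eta> * b (\<xi> - \<eta>) \<partial>lborel)\<^sup>2 \<partial>lborel)
    \<le> (\<integral>\<^sup>+\<eta>. a \<eta> \<partial>lborel)\<^sup>2 * (\<integral>\<^sup>+\<eta>. (b \<eta>)\<^sup>2 \<partial>lborel)"
proof -
  have "(\<integral>\<^sup>+\<eta>. a \<eta> * b (\<xi> - \<eta>) \<partial>lborel)\<^sup>2 \<le> (\<integral>\<^sup>+\<eta>. a \<eta> \<partial>lborel) * (\<integral>\<^sup>+\<eta>. a \<eta> * (b (\<xi> - \<eta>))\<^sup>2 \<partial>lborel)" for \<xi>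
    using Cauchy_Schwarz_nn_integral[of "\<lambda>_. 1" "density lborel a" "\<lambda>\<eta>. b (\<xi> - \<eta>)"]
    by (simp add: nn_integral_density emeasure_density)
  then have "(\<integral>\<^sup>+\<xi>. (\<integral>\<^sup>+\<eta>. a \<eta> * b (\<xi> - \<eta>) \<partial>lborel)\<^sup>2 \<partial>lborel)
    \<le> (\<integral>\<^sup>+\<xi>. (\<integral>\<^sup>+\<eta>. a \<eta> \<partial>lborel) * (\<integral>\<^sup>+\<eta>. a \<eta> * (b (\<xi> - \<eta>))\<^sup>2 \<partial>lborel) \<partial>lborel)"
    by (intro nn_integral_mono)
  also have "\<dots> = (\<integral>\<^sup>+\<eta>. a \<eta> \<partial>lborel) * (\<integral>\<^sup>+\<xi>. \<integral>\<^sup>+\<eta>. a \<eta> * (b (\<xi> - \<eta>))\<^sup>2 \<partial>lborel \<partial>lborel)"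
    by (intro nn_integral_cmult) measurable
  also have "(\<integral>\<^sup>+\<xi>. \<integral>\<^sup>+\<eta>. a \<eta> * (b (\<xi> - \<eta>))\<^sup>2 \<partial>lborel \<partial>lborel)
      = (\<integral>\<^sup>+\<eta>. \<integral>\<^sup>+\<xi>. a \<eta> * (b (\<xi> - \<eta>))\<^sup>2 \<partial>lborel \<partial>lborel)"
    by (rule lborel_pair.Fubini') measurable
  also have "\<dots> = (\<integral>\<^sup>+\<eta>. a \<eta> * (\<integral>\<^sup>+\<xi>. (b \<xi>)\<^sup>2 \<partial>lborel) \<partial>lborel)"
    by (simp add: nn_integral_cmult nn_integral_shift[of "\<lambda>\<xi>. (b \<xi>)\<^sup>2"])
  also have "\<dots> = (\<integral>\<^sup>+\<eta>. a \<eta> \<partial>lborel) * (\<integral>\<^sup>+\<xi>. (b \<xi>)\<^sup>2 \<partial>lborel)"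
    by (rule nn_integral_multc) measurable
  finally show ?thesis by (simp add: power2_eq_square mult.assoc)
qed

lemma ennreal_sum3_square_le: "(a + b + c)\<^sup>2 \<le> 3 * (a\<^sup>2 + b\<^sup>2 + c\<^sup>2)" for a b c :: ennreal
proof (cases "a = top \<or> b = top \<or> c = top")
  case True then show ?thesis by (auto simp: power2_eq_square)
next
  case False
  then obtain x y z where "a = ennreal x" "b = ennreal y" "c = ennreal z" "x \<ge> 0" "y \<ge> 0" "z \<ge> 0"
    by (metis ennreal_cases)
  moreover have "(x + y + z)\<^sup>2 \<le> 3 * (x\<^sup>2 + y\<^sup>2 + z\<^sup>2)"
    using sum_squares_bound[of x y] sum_squares_bound[of y z] sum_squares_bound[of x z]
    by (simp add: power2_eq_square algebra_simps)
  ultimately show ?thesis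
    by (simp add: ennreal_power flip: ennreal_plus ennreal_mult ennreal_numeral)
qed

text \<open>Where \<open>g\<close> sits at the output frequency, the convolution of \<open>u\<close>
  and \<open>v\<close> is bounded and \<open>g\<close> supplies the decay. Where it sits at an input
  frequency, it makes the factor there integrable and Young's inequality applies. All three terms
  have the same bound; 9 is the 3 from squaring a sum of three terms times the number of
  terms.\<close>

lemma nn_integral_kernel_sum:
  fixes g u v :: "real \<Rightarrow> ennreal"
  assumes [measurable]: "g \<in> borel_measurable borel" "u \<in> borel_measurable borel" "v \<in> borel_measurable borel"
  shows "(\<integral>\<^sup>+\<xi>. (\<integral>\<^sup>+\<eta>. (g \<xi> + g \<eta> + g (\<xi> - \<eta>)) * (u \<eta> * v (\<xi> - \<eta>)) \<partial>lborel)\<^sup>2 \<partial>lborel)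
    \<le> 9 * ((\<integral>\<^sup>+\<xi>. (g \<xi>)\<^sup>2 \<partial>lborel) * (\<integral>\<^sup>+\<xi>. (u \<xi>)\<^sup>2 \<partial>lborel) * (\<integral>\<^sup>+\<xi>. (v \<xi>)\<^sup>2 \<partial>lborel))" (is "_ \<le> 9 * ?P")
proof -
  let ?A = "\<lambda>\<xi>. g \<xi> * (\<integral>\<^sup>+\<eta>. u \<eta> * v (\<xi> - \<eta>) \<partial>lborel)"
  let ?B = "\<lambda>\<xi>. \<integral>\<^sup>+\<eta>. (g \<eta> * u \<eta>) * v (\<xi> - \<eta>) \<partial>lborel"
  let ?C = "\<lambda>\<xi>. \<integral>\<^sup>+\<eta>. (g \<eta> * v \<eta>) * u (\<xi> - \<eta>) \<partial>lborel"
  have C: "?C \<xi> = (\<integral>\<^sup>+\<eta>. u \<eta> * (g (\<xi> - \<eta>) * v (\<xi> - \<eta>)) \<partial>lborel)" for \<xi>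
    using nn_integral_reflect_shift[of "\<lambda>\<eta>. (g \<eta> * v \<eta>) * u (\<xi> - \<eta>)" \<xi>] by (simp add: mult_ac)
  have eq: "(\<integral>\<^sup>+\<eta>. (g \<xi> + g \<eta> + g (\<xi> - \<eta>)) * (u \<eta> * v (\<xi> - \<eta>)) \<partial>lborel) = ?A \<xi> + ?B \<xi> + ?C \<xi>" for \<xi>
  proof -
    have "(\<integral>\<^sup>+\<eta>. (g \<xi> + g \<eta> + g (\<xi> - \<eta>)) * (u \<eta> * v (\<xi> - \<eta>)) \<partial>lborel)
       = (\<integral>\<^sup>+\<eta>. g \<xi> * (u \<eta> * v (\<xi> - \<eta>)) + (g \<eta> * u \<eta>) * v (\<xi> - \<eta>) + u \<eta> * (g (\<xi> - \<eta>) * v (\<xi> - \<eta>)) \<partial>lborel)"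
      by (intro nn_integral_cong) (simp add: algebra_simps)
    then show ?thesis unfolding C by (simp add: nn_integral_add nn_integral_cmult)
  qed
  have A: "(\<integral>\<^sup>+\<xi>. (?A \<xi>)\<^sup>2 \<partial>lborel) \<le> ?P"
  proof -
    have "(?A \<xi>)\<^sup>2 \<le> (g \<xi>)\<^sup>2 * ((\<integral>\<^sup>+\<eta>. (u \<eta>)\<^sup>2 \<partial>lborel) * (\<integral>\<^sup>+\<eta>. (v \<eta>)\<^sup>2 \<partial>lborel))" for \<xi>
      using Cauchy_Schwarz_nn_integral[of u lborel "\<lambda>\<eta>. v (\<xi> - \<eta>)"] nn_integral_reflect_shift[of "\<lambda>\<eta>. (v \<eta>)\<^sup>2" \<xi>]
      by (auto simp: power_mult_distrib intro!: mult_left_mono)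
    then have "(\<integral>\<^sup>+\<xi>. (?A \<xi>)\<^sup>2 \<partial>lborel) \<le> (\<integral>\<^sup>+\<xi>. (g \<xi>)\<^sup>2 * ((\<integral>\<^sup>+\<eta>. (u \<eta>)\<^sup>2 \<partial>lborel) * (\<integral>\<^sup>+\<eta>. (v \<eta>)\<^sup>2 \<partial>lborel)) \<partial>lborel)"
      by (intro nn_integral_mono)
    also have "\<dots> = ?P" by (simp add: nn_integral_multc mult.assoc)
    finally show ?thesis .
  qed
  have Y: "(\<integral>\<^sup>+\<xi>. (\<integral>\<^sup>+\<eta>. (g \<eta> * p \<eta>) * q (\<xi> - \<eta>) \<partial>lborel)\<^sup>2 \<partial>lborel)
      \<le> (\<integral>\<^sup>+\<xi>. (g \<xi>)\<^sup>2 \<partial>lborel) * (\<integral>\<^sup>+\<xi>. (p \<xi>)\<^sup>2 \<partial>lborel) * (\<integral>\<^sup>+\<xi>. (q \<xi>)\<^sup>2 \<partial>lborel)"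
    if [measurable]: "p \<in> borel_measurable borel" "q \<in> borel_measurable borel" for p q :: "real \<Rightarrow> ennreal"
    by (rule order_trans[OF nn_integral_Young])
       (auto intro!: mult_right_mono Cauchy_Schwarz_nn_integral)
  have "(\<integral>\<^sup>+\<xi>. (?A \<xi> + ?B \<xi> + ?C \<xi>)\<^sup>2 \<partial>lborel) \<le> (\<integral>\<^sup>+\<xi>. 3 * ((?A \<xi>)\<^sup>2 + (?B \<xi>)\<^sup>2 + (?C \<xi>)\<^sup>2) \<partial>lborel)"
    by (intro nn_integral_mono ennreal_sum3_square_le)
  also have "\<dots> = 3 * ((\<integral>\<^sup>+\<xi>. (?A \<xi>)\<^sup>2 \<partial>lborel) + (\<integral>\<^sup>+\<xi>. (?B \<xi>)\<^sup>2 \<partial>lborel) + (\<integral>\<^sup>+\<xi>. (?C \<xi>)\<^sup>2 \<partial>lborel))"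
    by (simp add: nn_integral_add nn_integral_cmult)
  also have "\<dots> \<le> 3 * (?P + ?P + ?P)"
    using Y[of u v] Y[of v u] by (intro mult_left_mono add_mono A) (auto simp: mult_ac)
  also have "\<dots> = 9 * ?P"
  proof -
    have "3 * (x + x + x) = 9 * x" for x :: ennreal
    proof -
      have "x + x + x = 3 * x" using distrib_right[of "2::ennreal" 1 x] mult_2[of x] by simp
      then show ?thesis by (simp flip: mult.assoc)
    qed
    then show ?thesis .
  qed
  finally show ?thesis unfolding eq .
qed

lemma weighted_conv_L2:
  fixes g p :: "real \<Rightarrow> real"
  assumes g2: "integrable lborel (\<lambda>\<xi>. (g \<xi>)\<^sup>2)" and g0: "\<And>\<xi>. g \<xi> \<ge> 0"
    and [measurable]: "g \<in> borel_measurable borel" "q \<in> borel_measurable borel" "p \<in> borel_measurable borel"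
    and p: "\<And>\<xi>. 0 \<le> p \<xi>" "\<And>\<xi>. p \<xi> \<le> 1"
    and kernel: "\<And>\<xi> \<eta>. norm (q \<xi>) * p \<eta> * p (\<xi> - \<eta>) \<le> g \<xi> + g \<eta> + g (\<xi> - \<eta>)"
    and u: "u \<in> L2" and v: "v \<in> L2"
  defines "F \<equiv> \<lambda>\<xi>. q \<xi> * conv (\<lambda>\<eta>. complex_of_real (p \<eta>) * u \<eta>) (\<lambda>\<eta>. complex_of_real (p \<eta>) * v \<eta>) \<xi>"
  shows "F \<in> L2" "l2n F \<le> 3 * sqrt (LINT \<xi>|lborel. (g \<xi>)\<^sup>2) * l2n u * l2n v"
proof -
  note [measurable] = L2_measurable[OF u] L2_measurable[OF v]
  define G where "G = sqrt (LINT \<xi>|lborel. (g \<xi>)\<^sup>2)"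
  have G2: "G\<^sup>2 = (LINT \<xi>|lborel. (g \<xi>)\<^sup>2)" "G \<ge> 0" by (simp_all add: G_def)
  have pu: "(\<lambda>\<eta>. complex_of_real (p \<eta>) * u \<eta>) \<in> L2" "(\<lambda>\<eta>. complex_of_real (p \<eta>) * v \<eta>) \<in> L2"
    using p by (auto intro!: L2_bounded_mult[of _ _ 1] u v)
  have le: "ennreal (norm (F \<xi>)) \<le> (\<integral>\<^sup>+\<eta>. (ennreal (g \<xi>) + ennreal (g \<eta>) + ennreal (g (\<xi> - \<eta>)))
      * (ennreal (norm (u \<eta>)) * ennreal (norm (v (\<xi> - \<eta>)))) \<partial>lborel)" for \<xi>
  proof -
    let ?I = "\<lambda>\<eta>. q \<xi> * (complex_of_real (p \<eta>) * u \<eta> * (complex_of_real (p (\<xi> - \<eta>)) * v (\<xi> - \<eta>)))"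
    have "F \<xi> = (LINT \<eta>|lborel. ?I \<eta>)" unfolding F_def conv_def by simp
    then have "ennreal (norm (F \<xi>)) \<le> (\<integral>\<^sup>+\<eta>. norm (?I \<eta>) \<partial>lborel)"
      using integral_norm_bound_ennreal[OF integrable_mult_right[OF conv_integrand[OF pu]], of "q \<xi>" \<xi>] by simp
    also have "\<dots> \<le> (\<integral>\<^sup>+\<eta>. (ennreal (g \<xi>) + ennreal (g \<eta>) + ennreal (g (\<xi> - \<eta>)))
      * (ennreal (norm (u \<eta>)) * ennreal (norm (v (\<xi> - \<eta>)))) \<partial>lborel)"
    proof (rule nn_integral_mono)
      fix \<eta>
      have "norm (?I \<eta>) = (norm (q \<xi>) * p \<eta> * p (\<xi> - \<eta>)) * (norm (u \<eta>) * norm (v (\<xi> - \<eta>)))"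
        using p by (simp add: norm_mult mult_ac)
      also have "\<dots> \<le> (g \<xi> + g \<eta> + g (\<xi> - \<eta>)) * (norm (u \<eta>) * norm (v (\<xi> - \<eta>)))"
        by (intro mult_right_mono kernel) auto
      finally have "ennreal (norm (?I \<eta>)) \<le> ennreal ((g \<xi> + g \<eta> + g (\<xi> - \<eta>)) * (norm (u \<eta>) * norm (v (\<xi> - \<eta>))))"
        by (rule ennreal_leI)
      then show "ennreal (norm (?I \<eta>)) \<le> (ennreal (g \<xi>) + ennreal (g \<eta>) + ennreal (g (\<xi> - \<eta>)))
          * (ennreal (norm (u \<eta>)) * ennreal (norm (v (\<xi> - \<eta>))))"
        by (simp add: ennreal_mult ennreal_plus g0 del: ennreal_plus[symmetric])
    qed
    finally show ?thesis .
  qed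
  have "(\<integral>\<^sup>+\<xi>. ennreal ((norm (F \<xi>))\<^sup>2) \<partial>lborel) = (\<integral>\<^sup>+\<xi>. (ennreal (norm (F \<xi>)))\<^sup>2 \<partial>lborel)"
    by (simp add: ennreal_power)
  also have "\<dots> \<le> (\<integral>\<^sup>+\<xi>. (\<integral>\<^sup>+\<eta>. (ennreal (g \<xi>) + ennreal (g \<eta>) + ennreal (g (\<xi> - \<eta>)))
      * (ennreal (norm (u \<eta>)) * ennreal (norm (v (\<xi> - \<eta>)))) \<partial>lborel)\<^sup>2 \<partial>lborel)"
    by (intro nn_integral_mono power_mono le) auto
  also have "\<dots> \<le> 9 * ((\<integral>\<^sup>+\<xi>. (ennreal (g \<xi>))\<^sup>2 \<partial>lborel) * (\<integral>\<^sup>+\<xi>. (ennreal (norm (u \<xi>)))\<^sup>2 \<partial>lborel) * (\<integral>\<^sup>+\<xi>. (ennreal (norm (v \<xi>)))\<^sup>2 \<partial>lborel))"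
    by (rule nn_integral_kernel_sum) measurable
  also have "\<dots> = 9 * (ennreal (G\<^sup>2) * ennreal ((l2n u)\<^sup>2) * ennreal ((l2n v)\<^sup>2))"
    using L2_nn[OF u] L2_nn[OF v] nn_integral_eq_integral[OF g2]
    by (simp add: ennreal_power g0 G2)
  also have "\<dots> = ennreal (9 * (G\<^sup>2 * (l2n u)\<^sup>2 * (l2n v)\<^sup>2))"
    by (simp add: ennreal_mult)
  also have "9 * (G\<^sup>2 * (l2n u)\<^sup>2 * (l2n v)\<^sup>2) = (3 * G * l2n u * l2n v)\<^sup>2"
    by (simp add: power_mult_distrib)
  finally have fin: "(\<integral>\<^sup>+\<xi>. ennreal ((norm (F \<xi>))\<^sup>2) \<partial>lborel) \<le> ennreal ((3 * G * l2n u * l2n v)\<^sup>2)" .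
  have "F \<in> borel_measurable borel" unfolding F_def by measurable
  then show F: "F \<in> L2" using fin by (auto simp: L2_iff intro: order.strict_trans1)
  have "(l2n F)\<^sup>2 \<le> (3 * G * l2n u * l2n v)\<^sup>2" using fin unfolding L2_nn[OF F] by simp
  then show "l2n F \<le> 3 * sqrt (LINT \<xi>|lborel. (g \<xi>)\<^sup>2) * l2n u * l2n v"
    unfolding G_def[symmetric] by (rule power2_le_imp_le) (simp add: G2)
qed

section \<open>Multiplication operators and the weighted equation\<close>

definition mult_op :: "(real \<Rightarrow> complex) \<Rightarrow> hl2 \<Rightarrow> hl2" where
  "mult_op a x = mk (\<lambda>\<xi>. a \<xi> * rep x \<xi>)"

lemma hermL2_mult:
  assumes "f \<in> hermL2" "a \<in> borel_measurable borel" "\<And>\<xi>. norm (a \<xi>) \<le> C" "\<And>\<xi>. a (- \<xi>) = cnj (a \<xi>)"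
  shows "(\<lambda>\<xi>. a \<xi> * f \<xi>) \<in> hermL2"
  using assms by (auto simp: hermL2_def intro: L2_bounded_mult)

lemma
  assumes a: "a \<in> borel_measurable borel" "\<And>\<xi>. norm (a \<xi>) \<le> C" "\<And>\<xi>. a (- \<xi>) = cnj (a \<xi>)"
  shows rep_mult_op: "AE \<xi> in lborel. rep (mult_op a x) \<xi> = a \<xi> * rep x \<xi>"
    and mult_op_mk: "f \<in> hermL2 \<Longrightarrow> mult_op a (mk f) = mk (\<lambda>\<xi>. a \<xi> * f \<xi>)"
    and bounded_linear_mult_op: "bounded_linear (mult_op a)"
proof -
  show "AE \<xi> in lborel. rep (mult_op a x) \<xi> = a \<xi> * rep x \<xi>"
    unfolding mult_op_def by (rule rep_mk[OF hermL2_mult[OF rep_herm a]])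
  show *: "mult_op a (mk f) = mk (\<lambda>\<xi>. a \<xi> * f \<xi>)" if "f \<in> hermL2" for f
    unfolding mult_op_def using rep_mk[OF that] by (intro mk_cong) auto
  show "bounded_linear (mult_op a)"
  proof
    fix x y :: hl2 and c :: real
    obtain f where f: "f \<in> hermL2" "x = mk f" by (rule hl2_cases)
    obtain g where g: "g \<in> hermL2" "y = mk g" by (rule hl2_cases)
    show "mult_op a (x + y) = mult_op a x + mult_op a y"
      by (simp add: f g mk_add hermL2_add * hermL2_mult[OF _ a] distrib_left)
    show "mult_op a (c *\<^sub>R x) = c *\<^sub>R mult_op a x"
      by (simp add: f mk_scaleR hermL2_cmult * hermL2_mult[OF _ a] mult_ac)
  next
    have "norm (mult_op a x) \<le> norm x * C" for x
    proof -
      have C: "C \<ge> 0" using a(2)[of 0] norm_ge_zero order_trans by blast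
      have "l2n (\<lambda>\<xi>. a \<xi> * rep x \<xi>) \<le> C * l2n (rep x)"
      proof (rule power2_le_imp_le)
        have "(LINT \<xi>|lborel. (norm (a \<xi> * rep x \<xi>))\<^sup>2) \<le> (LINT \<xi>|lborel. C\<^sup>2 * (norm (rep x \<xi>))\<^sup>2)"
        proof (rule integral_mono)
          show "integrable lborel (\<lambda>\<xi>. (norm (a \<xi> * rep x \<xi>))\<^sup>2)"
            by (rule L2_integrable[OF hermL2_L2[OF hermL2_mult[OF rep_herm a]]])
          show "integrable lborel (\<lambda>\<xi>. C\<^sup>2 * (norm (rep x \<xi>))\<^sup>2)"
            by (intro integrable_mult_right L2_integrable rep_L2)
          show "(norm (a \<xi> * rep x \<xi>))\<^sup>2 \<le> C\<^sup>2 * (norm (rep x \<xi>))\<^sup>2" for \<xi>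
            using a(2)[of \<xi>] by (auto simp: norm_mult power_mult_distrib intro!: mult_right_mono power_mono)
        qed
        then show "(l2n (\<lambda>\<xi>. a \<xi> * rep x \<xi>))\<^sup>2 \<le> (C * l2n (rep x))\<^sup>2"
          by (simp add: l2n_square power_mult_distrib)
        show "0 \<le> C * l2n (rep x)" using C by simp
      qed
      then show ?thesis
        unfolding mult_op_def norm_mk[OF hermL2_mult[OF rep_herm a]] norm_rep[of x] by (simp add: mult.commute)
    qed
    then show "\<exists>K. \<forall>x. norm (mult_op a x) \<le> norm x * K" by blast
  qed
qed

lemma bbm_symbol_reflect: "bbm_symbol (- \<xi>) = cnj (bbm_symbol \<xi>)"
  by (simp add: bbm_symbol_def)

lemmas mult_op_bbm_symbol =
  rep_mult_op[OF bbm_symbol_measurable norm_bbm_symbol_le bbm_symbol_reflect]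
  mult_op_mk[OF bbm_symbol_measurable norm_bbm_symbol_le bbm_symbol_reflect]
  bounded_linear_mult_op[OF bbm_symbol_measurable norm_bbm_symbol_le bbm_symbol_reflect]

text \<open>With \<open>v = w / p\<close> for the transform \<open>w\<close> of a solution, the equation becomes
  \<open>v' = bbm_field p v\<close> with the linear part unchanged and the nonlinearity conjugated by \<open>p\<close>.\<close>

definition weighted :: "(real \<Rightarrow> real) \<Rightarrow> (real \<Rightarrow> complex) \<Rightarrow> real \<Rightarrow> complex" where
  "weighted p f \<xi> = complex_of_real (p \<xi>) * f \<xi>"

definition bbm_product :: "(real \<Rightarrow> real) \<Rightarrow> (real \<Rightarrow> complex) \<Rightarrow> (real \<Rightarrow> complex) \<Rightarrow> real \<Rightarrow> complex" where
  "bbm_product p f g \<xi> = bbm_symbol \<xi> / complex_of_real (p \<xi>) * conv (weighted p f) (weighted p g) \<xi>"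

definition bbm_bilinear :: "(real \<Rightarrow> real) \<Rightarrow> hl2 \<Rightarrow> hl2 \<Rightarrow> hl2" where
  "bbm_bilinear p x y = mk (bbm_product p (rep x) (rep y))"

text \<open>The constant is the 1 / 2 in front of the quadratic term times the 1 / (2 pi) from the
  transform of a product.\<close>

definition bbm_field :: "(real \<Rightarrow> real) \<Rightarrow> hl2 \<Rightarrow> hl2" where
  "bbm_field p x = - mult_op bbm_symbol x - (1 / (4 * pi)) *\<^sub>R bbm_bilinear p x x"

definition unweight :: "(real \<Rightarrow> real) \<Rightarrow> hl2 \<Rightarrow> hl2" where
  "unweight p = mult_op (\<lambda>\<xi>. complex_of_real (p \<xi>))"

text \<open>Here \<open>p\<close> is the reciprocal of the weight, so that multiplication by the
  bounded function \<open>p\<close> recovers the solution from v. The condition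
  \<open>kernel\<close> makes the conjugated nonlinearity bounded: a single square integrable
  function, evaluated at the three frequencies, has to absorb the symbol and all three
  weights.\<close>

locale bbm_weight =
  fixes p g :: "real \<Rightarrow> real"
  assumes p_measurable [measurable]: "p \<in> borel_measurable borel"
    and p_pos: "0 < p \<xi>" and p_le_1: "p \<xi> \<le> 1" and p_even: "p (- \<xi>) = p \<xi>"
    and g_measurable [measurable]: "g \<in> borel_measurable borel"
    and g_nonneg: "0 \<le> g \<xi>" and g_square: "integrable lborel (\<lambda>\<xi>. (g \<xi>)\<^sup>2)"
    and kernel: "norm (bbm_symbol \<xi>) / p \<xi> * p \<eta> * p (\<xi> - \<eta>) \<le> g \<xi> + g \<eta> + g (\<xi> - \<eta>)"
begin

lemma weighted_hermL2: "f \<in> hermL2 \<Longrightarrow> weighted p f \<in> hermL2"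
  unfolding weighted_def[abs_def]
  by (rule hermL2_mult[of _ _ 1]) (auto simp: p_even p_le_1 less_imp_le[OF p_pos])

lemma weighted_measurable [measurable]:
  assumes [measurable]: "f \<in> borel_measurable borel" shows "weighted p f \<in> borel_measurable borel"
  unfolding weighted_def[abs_def] by measurable

lemma bbm_product_norm:
  assumes f: "f \<in> L2" and h: "h \<in> L2"
  shows "bbm_product p f h \<in> L2" "l2n (bbm_product p f h) \<le> 3 * sqrt (LINT \<xi>|lborel. (g \<xi>)\<^sup>2) * l2n f * l2n h"
proof -
  have "norm (bbm_symbol \<xi> / complex_of_real (p \<xi>)) * p \<eta> * p (\<xi> - \<eta>) \<le> g \<xi> + g \<eta> + g (\<xi> - \<eta>)" for \<xi> \<eta>
    using kernel[of \<xi> \<eta>] p_pos[of \<xi>] by (simp add: norm_divide)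
  then show "bbm_product p f h \<in> L2" "l2n (bbm_product p f h) \<le> 3 * sqrt (LINT \<xi>|lborel. (g \<xi>)\<^sup>2) * l2n f * l2n h"
    unfolding bbm_product_def[abs_def] weighted_def[abs_def]
    using weighted_conv_L2[OF g_square g_nonneg g_measurable, of "\<lambda>\<xi>. bbm_symbol \<xi> / complex_of_real (p \<xi>)" p f h]
    by (auto simp: p_le_1 less_imp_le[OF p_pos] f h)
qed

lemma bbm_product_hermL2: assumes f: "f \<in> hermL2" and h: "h \<in> hermL2" shows "bbm_product p f h \<in> hermL2"
proof -
  have "conv (weighted p f) (weighted p h) (- \<xi>) = cnj (conv (weighted p f) (weighted p h) \<xi>)" for \<xi>
    by (intro conv_hermitian hermL2_reflect weighted_hermL2 f h)
  then show ?thesis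
    using bbm_product_norm(1)[OF hermL2_L2[OF f] hermL2_L2[OF h]]
    by (simp add: hermL2_def bbm_product_def bbm_symbol_reflect p_even)
qed

lemma bbm_product_cong:
  assumes [measurable]: "f \<in> borel_measurable borel" "f' \<in> borel_measurable borel"
      "h \<in> borel_measurable borel" "h' \<in> borel_measurable borel"
    and "AE x in lborel. f x = f' x" "AE x in lborel. h x = h' x"
  shows "bbm_product p f h = bbm_product p f' h'"
proof -
  have "conv (weighted p f) (weighted p h) = conv (weighted p f') (weighted p h')"
    using assms(5,6) by (intro conv_cong_AE) (auto simp: weighted_def)
  then show ?thesis by (simp add: bbm_product_def fun_eq_iff)
qed

lemma bbm_bilinear_mk:
  assumes "f \<in> hermL2" "h \<in> hermL2"
  shows "bbm_bilinear p (mk f) (mk h) = mk (bbm_product p f h)"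
  unfolding bbm_bilinear_def
  using bbm_product_cong[OF rep_measurable hermL2_measurable[OF assms(1)] rep_measurable hermL2_measurable[OF assms(2)] rep_mk rep_mk] assms
  by simp

lemma bounded_bilinear_bbm: "bounded_bilinear (bbm_bilinear p)"
proof
  fix x x' y y' :: hl2 and c :: real
  obtain f where f: "f \<in> hermL2" "x = mk f" by (rule hl2_cases)
  obtain f' where f': "f' \<in> hermL2" "x' = mk f'" by (rule hl2_cases)
  obtain h where h: "h \<in> hermL2" "y = mk h" by (rule hl2_cases)
  obtain h' where h': "h' \<in> hermL2" "y' = mk h'" by (rule hl2_cases)
  note L = hermL2_L2[OF weighted_hermL2]
  have wa: "weighted p (\<lambda>\<xi>. u \<xi> + v \<xi>) = (\<lambda>\<xi>. weighted p u \<xi> + weighted p v \<xi>)" for u v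
    by (simp add: weighted_def fun_eq_iff distrib_left)
  have wc: "weighted p (\<lambda>\<xi>. complex_of_real c * u \<xi>) = (\<lambda>\<xi>. complex_of_real c * weighted p u \<xi>)" for u
    by (simp add: weighted_def fun_eq_iff)
  have "bbm_product p (\<lambda>\<xi>. f \<xi> + f' \<xi>) h = (\<lambda>\<xi>. bbm_product p f h \<xi> + bbm_product p f' h \<xi>)"
    unfolding bbm_product_def[abs_def] wa by (simp add: conv_add_left L f f' h distrib_left)
  then show "bbm_bilinear p (x + x') y = bbm_bilinear p x y + bbm_bilinear p x' y"
    by (simp add: f f' h mk_add hermL2_add bbm_bilinear_mk bbm_product_hermL2)
  have "bbm_product p f (\<lambda>\<xi>. h \<xi> + h' \<xi>) = (\<lambda>\<xi>. bbm_product p f h \<xi> + bbm_product p f h' \<xi>)"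
    unfolding bbm_product_def[abs_def] wa by (simp add: conv_add_right L f h h' distrib_left)
  then show "bbm_bilinear p x (y + y') = bbm_bilinear p x y + bbm_bilinear p x y'"
    by (simp add: f h h' mk_add hermL2_add bbm_bilinear_mk bbm_product_hermL2)
  have "bbm_product p (\<lambda>\<xi>. complex_of_real c * f \<xi>) h = (\<lambda>\<xi>. complex_of_real c * bbm_product p f h \<xi>)"
    unfolding bbm_product_def[abs_def] wc by (simp add: conv_cmult mult_ac)
  then show "bbm_bilinear p (c *\<^sub>R x) y = c *\<^sub>R bbm_bilinear p x y"
    by (simp add: f h mk_scaleR hermL2_cmult bbm_bilinear_mk bbm_product_hermL2)
  have "bbm_product p f (\<lambda>\<xi>. complex_of_real c * h \<xi>) = (\<lambda>\<xi>. complex_of_real c * bbm_product p f h \<xi>)"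
    unfolding bbm_product_def[abs_def] wc by (simp add: conv_cmult mult_ac)
  then show "bbm_bilinear p x (c *\<^sub>R y) = c *\<^sub>R bbm_bilinear p x y"
    by (simp add: f h mk_scaleR hermL2_cmult bbm_bilinear_mk bbm_product_hermL2)
next
  show "\<exists>K. \<forall>x y. norm (bbm_bilinear p x y) \<le> norm x * norm y * K"
  proof (intro exI allI)
    fix x y :: hl2
    show "norm (bbm_bilinear p x y) \<le> norm x * norm y * (3 * sqrt (LINT \<xi>|lborel. (g \<xi>)\<^sup>2))"
      using bbm_product_norm(2)[of "rep x" "rep y"]
      by (simp add: bbm_bilinear_def norm_mk bbm_product_hermL2 norm_rep[of x] norm_rep[of y] mult_ac)
  qed
qed

lemma bbm_field_lipschitz:
  "\<exists>L. \<forall>x y. norm x \<le> R \<longrightarrow> norm y \<le> R \<longrightarrow> norm (bbm_field p x - bbm_field p y) \<le> L * norm (x - y)"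
proof -
  interpret A: bounded_linear "mult_op bbm_symbol" by (rule mult_op_bbm_symbol(3))
  interpret B: bounded_bilinear "bbm_bilinear p" by (rule bounded_bilinear_bbm)
  obtain KA where KA: "\<And>x. norm (mult_op bbm_symbol x) \<le> norm x * KA" using A.bounded by blast
  obtain KB where KB: "\<And>x y. norm (bbm_bilinear p x y) \<le> norm x * norm y * KB" "KB \<ge> 0"
    using B.nonneg_bounded by blast
  let ?c = "1 / (4 * pi)"
  have "norm (bbm_field p x - bbm_field p y) \<le> (KA + ?c * (2 * R * KB)) * norm (x - y)"
    if xy: "norm x \<le> R" "norm y \<le> R" for x y
  proof -
    have "bbm_field p x - bbm_field p y = - mult_op bbm_symbol (x - y) + (- ?c) *\<^sub>R (bbm_bilinear p x (x - y) + bbm_bilinear p (x - y) y)"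
      by (simp add: bbm_field_def A.diff B.diff_left B.diff_right algebra_simps)
    then have "norm (bbm_field p x - bbm_field p y) \<le> norm (mult_op bbm_symbol (x - y)) + ?c * norm (bbm_bilinear p x (x - y) + bbm_bilinear p (x - y) y)"
      using norm_triangle_ineq[of "- mult_op bbm_symbol (x - y)" "(- ?c) *\<^sub>R (bbm_bilinear p x (x - y) + bbm_bilinear p (x - y) y)"]
      by simp
    also have "\<dots> \<le> norm (x - y) * KA + ?c * (norm (x - y) * R * KB + norm (x - y) * R * KB)"
    proof (intro add_mono mult_left_mono KA order_trans[OF norm_triangle_ineq])
      show "norm (bbm_bilinear p x (x - y)) \<le> norm (x - y) * R * KB"
        using KB(1)[of x "x - y"] mult_right_mono[OF mult_right_mono[OF xy(1) norm_ge_zero[of "x - y"]] KB(2)]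
        by (simp add: mult_ac)
      show "norm (bbm_bilinear p (x - y) y) \<le> norm (x - y) * R * KB"
        using KB(1)[of "x - y" y] mult_right_mono[OF mult_left_mono[OF xy(2) norm_ge_zero[of "x - y"]] KB(2)]
        by (simp add: mult_ac)
    qed auto
    also have "\<dots> = (KA + ?c * (2 * R * KB)) * norm (x - y)" by (simp add: algebra_simps)
    finally show ?thesis .
  qed
  then show ?thesis by blast
qed

lemma weight_multiplier:
  "(\<lambda>\<xi>. complex_of_real (p \<xi>)) \<in> borel_measurable borel" "norm (complex_of_real (p \<xi>)) \<le> 1"
  "complex_of_real (p (- \<xi>)) = cnj (complex_of_real (p \<xi>))"
  by (auto simp: p_even p_le_1 less_imp_le[OF p_pos])

lemmas bounded_linear_unweight = bounded_linear_mult_op[OF weight_multiplier, folded unweight_def]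
  and rep_unweight = rep_mult_op[OF weight_multiplier, folded unweight_def]
  and unweight_mk = mult_op_mk[OF weight_multiplier, folded unweight_def]

lemma bbm_field_mk:
  assumes f: "f \<in> hermL2"
  shows "bbm_field p (mk f) = mk (\<lambda>\<xi>. - (bbm_symbol \<xi> * f \<xi>) - complex_of_real (1 / (4 * pi)) * bbm_product p f f \<xi>)"
    and "(\<lambda>\<xi>. - (bbm_symbol \<xi> * f \<xi>) - complex_of_real (1 / (4 * pi)) * bbm_product p f f \<xi>) \<in> hermL2"
proof -
  have h: "(\<lambda>\<xi>. bbm_symbol \<xi> * f \<xi>) \<in> hermL2"
    by (rule hermL2_mult[OF f bbm_symbol_measurable norm_bbm_symbol_le bbm_symbol_reflect])
  have um: "(\<lambda>\<xi>. - (bbm_symbol \<xi> * f \<xi>)) \<in> hermL2" using hermL2_cmult[OF h, of "-1"] by simp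
  have h2: "(\<lambda>\<xi>. complex_of_real (1 / (4 * pi)) * bbm_product p f f \<xi>) \<in> hermL2"
    by (intro hermL2_cmult bbm_product_hermL2 f)
  show "(\<lambda>\<xi>. - (bbm_symbol \<xi> * f \<xi>) - complex_of_real (1 / (4 * pi)) * bbm_product p f f \<xi>) \<in> hermL2"
    by (rule hermL2_diff[OF um h2])
  show "bbm_field p (mk f) = mk (\<lambda>\<xi>. - (bbm_symbol \<xi> * f \<xi>) - complex_of_real (1 / (4 * pi)) * bbm_product p f f \<xi>)"
    unfolding bbm_field_def mult_op_bbm_symbol(2)[OF f] mk_uminus[OF h] bbm_bilinear_mk[OF f f]
      mk_scaleR[OF bbm_product_hermL2[OF f f]] by (rule mk_diff[OF um h2])
qed

end

lemma bbm_symbol_square_integrable: "integrable lborel (\<lambda>\<xi>. (norm (bbm_symbol \<xi>))\<^sup>2)"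
proof (rule Bochner_Integration.integrable_bound[OF integrable_inverse_1_plus_square_lborel])
  have "(norm (bbm_symbol \<xi>))\<^sup>2 \<le> 1 / (1 + \<xi>\<^sup>2)" for \<xi>
  proof -
    have pos: "1 + \<xi>\<^sup>2 > 0" by (simp add: add_pos_nonneg)
    have "(norm (bbm_symbol \<xi>))\<^sup>2 = \<xi>\<^sup>2 / (1 + \<xi>\<^sup>2) / (1 + \<xi>\<^sup>2)"
      unfolding norm_bbm_symbol by (simp add: power_divide power2_eq_square)
    also have "\<dots> \<le> 1 / (1 + \<xi>\<^sup>2)" using pos by (intro divide_right_mono) auto
    finally show ?thesis .
  qed
  then show "AE \<xi> in lborel. norm ((norm (bbm_symbol \<xi>))\<^sup>2) \<le> norm (1 / (1 + \<xi>\<^sup>2))"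
    by (intro AE_I2) (simp add: add_pos_nonneg abs_of_pos)
qed simp

text \<open>For the trivial weight the symbol itself is the required square integrable function.
  This version of the equation is the common ground on which solutions for different widths are
  compared.\<close>

interpretation unweighted: bbm_weight "\<lambda>_. 1" "\<lambda>\<xi>. norm (bbm_symbol \<xi>)"
  by standard (auto intro: bbm_symbol_square_integrable)

context bbm_weight
begin

text \<open>The weighted field is the original one conjugated by \<open>p\<close>. Multiplication by
  \<open>p\<close> therefore carries solutions of every weighted equation to solutions of one and
  the same unweighted equation.\<close>

lemma unweight_bbm_field: "unweight p (bbm_field p x) = bbm_field (\<lambda>_. 1) (unweight p x)"
proof -
  obtain f where f: "f \<in> hermL2" "x = mk f" by (rule hl2_cases)
  have wf: "weighted p f \<in> hermL2" by (rule weighted_hermL2[OF f(1)])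
  have em: "unweight p (mk h) = mk (weighted p h)" if "h \<in> hermL2" for h
    unfolding unweight_mk[OF that] weighted_def[abs_def] ..
  have "unweight p (bbm_field p x) = mk (weighted p (\<lambda>\<xi>. - (bbm_symbol \<xi> * f \<xi>) - complex_of_real (1 / (4 * pi)) * bbm_product p f f \<xi>))"
    unfolding f(2) bbm_field_mk(1)[OF f(1)] by (rule em[OF bbm_field_mk(2)[OF f(1)]])
  also have "weighted p (\<lambda>\<xi>. - (bbm_symbol \<xi> * f \<xi>) - complex_of_real (1 / (4 * pi)) * bbm_product p f f \<xi>)
    = (\<lambda>\<xi>. - (bbm_symbol \<xi> * weighted p f \<xi>) - complex_of_real (1 / (4 * pi)) * bbm_product (\<lambda>_. 1) (weighted p f) (weighted p f) \<xi>)"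
  proof
    fix \<xi>
    have "complex_of_real (p \<xi>) \<noteq> 0" using p_pos[of \<xi>] by simp
    moreover have "weighted (\<lambda>_. 1) h = h" for h by (simp add: weighted_def fun_eq_iff)
    ultimately show "weighted p (\<lambda>\<xi>. - (bbm_symbol \<xi> * f \<xi>) - complex_of_real (1 / (4 * pi)) * bbm_product p f f \<xi>) \<xi>
      = - (bbm_symbol \<xi> * weighted p f \<xi>) - complex_of_real (1 / (4 * pi)) * bbm_product (\<lambda>_. 1) (weighted p f) (weighted p f) \<xi>"
      by (simp add: bbm_product_def) (simp add: weighted_def field_simps)
  qed
  also have "mk \<dots> = bbm_field (\<lambda>_. 1) (unweight p x)"
    unfolding f(2) em[OF f(1)] by (rule unweighted.bbm_field_mk(1)[OF wf, symmetric])
  finally show ?thesis .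
qed

text \<open>The linear part has a purely imaginary multiplier and so contributes nothing to the
  energy.\<close>

lemma inner_bbm_field: "inner x (bbm_field p x) = - (1 / (4 * pi)) * inner x (bbm_bilinear p x x)"
proof -
  obtain f where f: "f \<in> hermL2" "x = mk f" by (rule hl2_cases)
  have h: "(\<lambda>\<xi>. bbm_symbol \<xi> * f \<xi>) \<in> hermL2"
    by (rule hermL2_mult[OF f(1) bbm_symbol_measurable norm_bbm_symbol_le bbm_symbol_reflect])
  have "Re (f \<xi> * cnj (bbm_symbol \<xi> * f \<xi>)) = 0" for \<xi>
  proof -
    have "f \<xi> * cnj (bbm_symbol \<xi> * f \<xi>) = cnj (bbm_symbol \<xi>) * complex_of_real ((norm (f \<xi>))\<^sup>2)"
      by (simp only: complex_norm_square complex_cnj_mult mult_ac)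
    moreover have "Re (bbm_symbol \<xi>) = 0" unfolding bbm_symbol_def by (simp del: of_real_add)
    ultimately show ?thesis by simp
  qed
  then have "inner x (mult_op bbm_symbol x) = 0"
    unfolding f(2) mult_op_bbm_symbol(2)[OF f(1)] inner_mk[OF f(1) h] by simp
  then show ?thesis by (simp add: bbm_field_def inner_diff_right)
qed

end

section \<open>Weights and the energy estimate\<close>

lemma ennreal_le_of_power2_le:
  fixes X :: ennreal assumes "X\<^sup>2 \<le> ennreal (r\<^sup>2)" "r \<ge> 0" shows "X \<le> ennreal r"
proof (cases X)
  case (real x)
  then have "x\<^sup>2 \<le> r\<^sup>2" using assms by (simp add: ennreal_power)
  then have "x \<le> r" using assms(2) by (rule power2_le_imp_le)
  then show ?thesis using real by (simp add: ennreal_leI)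
next
  case top then show ?thesis using assms by (simp add: power2_eq_square ennreal_top_mult top_unique)
qed

text \<open>\<open>nn_integral_kernel_sum\<close> paired with a third function \<open>f1\<close>.
  The integrability on the product space is what later permits changing the order of integration in
  the cubic form.\<close>

lemma trilinear_bound:
  fixes g :: "real \<Rightarrow> real" and h :: "real \<Rightarrow> real \<Rightarrow> complex"
  assumes g2: "integrable lborel (\<lambda>\<xi>. (g \<xi>)\<^sup>2)" and g0: "\<And>\<xi>. g \<xi> \<ge> 0"
    and [measurable]: "g \<in> borel_measurable borel"
    and f: "f1 \<in> L2" "f2 \<in> L2" "f3 \<in> L2"
    and hm [measurable]: "case_prod h \<in> borel_measurable (lborel \<Otimes>\<^sub>M lborel)"
    and h: "\<And>\<xi> \<eta>. norm (h \<xi> \<eta>) \<le> (g \<xi> + g \<eta> + g (\<xi> - \<eta>)) * (norm (f1 \<xi>) * norm (f2 \<eta>) * norm (f3 (\<xi> - \<eta>)))"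
  shows "integrable (lborel \<Otimes>\<^sub>M lborel) (case_prod h)"
    and "norm (LINT \<xi>|lborel. LINT \<eta>|lborel. h \<xi> \<eta>) \<le> 3 * sqrt (LINT \<xi>|lborel. (g \<xi>)\<^sup>2) * (l2n f1 * l2n f2 * l2n f3)"
proof -
  note [measurable] = L2_measurable[OF f(1)] L2_measurable[OF f(2)] L2_measurable[OF f(3)]
  define r where "r = 3 * sqrt (LINT \<xi>|lborel. (g \<xi>)\<^sup>2) * (l2n f1 * l2n f2 * l2n f3)"
  have r0: "r \<ge> 0" by (simp add: r_def)
  let ?G = "\<lambda>\<xi>. \<integral>\<^sup>+\<eta>. (ennreal (g \<xi>) + ennreal (g \<eta>) + ennreal (g (\<xi> - \<eta>)))
      * (ennreal (norm (f2 \<eta>)) * ennreal (norm (f3 (\<xi> - \<eta>)))) \<partial>lborel"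
  have "(\<integral>\<^sup>+\<xi>. \<integral>\<^sup>+\<eta>. norm (h \<xi> \<eta>) \<partial>lborel \<partial>lborel) \<le> (\<integral>\<^sup>+\<xi>. ennreal (norm (f1 \<xi>)) * ?G \<xi> \<partial>lborel)"
  proof (rule nn_integral_mono)
    fix \<xi>
    have "(\<integral>\<^sup>+\<eta>. norm (h \<xi> \<eta>) \<partial>lborel) \<le> (\<integral>\<^sup>+\<eta>. ennreal (norm (f1 \<xi>)) * ((ennreal (g \<xi>) + ennreal (g \<eta>) + ennreal (g (\<xi> - \<eta>)))
      * (ennreal (norm (f2 \<eta>)) * ennreal (norm (f3 (\<xi> - \<eta>))))) \<partial>lborel)"
    proof (rule nn_integral_mono)
      fix \<eta>
      have "ennreal (norm (h \<xi> \<eta>)) \<le> ennreal (norm (f1 \<xi>) * ((g \<xi> + g \<eta> + g (\<xi> - \<eta>)) * (norm (f2 \<eta>) * norm (f3 (\<xi> - \<eta>)))))"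
        using h[of \<xi> \<eta>] by (intro ennreal_leI) (simp add: mult_ac)
      then show "ennreal (norm (h \<xi> \<eta>)) \<le> ennreal (norm (f1 \<xi>)) * ((ennreal (g \<xi>) + ennreal (g \<eta>) + ennreal (g (\<xi> - \<eta>)))
        * (ennreal (norm (f2 \<eta>)) * ennreal (norm (f3 (\<xi> - \<eta>)))))"
        by (simp add: ennreal_mult ennreal_plus g0 del: ennreal_plus[symmetric])
    qed
    also have "\<dots> = ennreal (norm (f1 \<xi>)) * ?G \<xi>" by (rule nn_integral_cmult) measurable
    finally show "(\<integral>\<^sup>+\<eta>. norm (h \<xi> \<eta>) \<partial>lborel) \<le> ennreal (norm (f1 \<xi>)) * ?G \<xi>" .
  qed
  then have "(\<integral>\<^sup>+\<xi>. \<integral>\<^sup>+\<eta>. norm (h \<xi> \<eta>) \<partial>lborel \<partial>lborel)\<^sup>2 \<le> (\<integral>\<^sup>+\<xi>. ennreal (norm (f1 \<xi>)) * ?G \<xi> \<partial>lborel)\<^sup>2"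
    by (rule power_mono) simp
  also have "\<dots> \<le> (\<integral>\<^sup>+\<xi>. (ennreal (norm (f1 \<xi>)))\<^sup>2 \<partial>lborel) * (\<integral>\<^sup>+\<xi>. (?G \<xi>)\<^sup>2 \<partial>lborel)"
    by (rule Cauchy_Schwarz_nn_integral) measurable
  also have "\<dots> \<le> (\<integral>\<^sup>+\<xi>. (ennreal (norm (f1 \<xi>)))\<^sup>2 \<partial>lborel) * (9 * ((\<integral>\<^sup>+\<xi>. (ennreal (g \<xi>))\<^sup>2 \<partial>lborel)
      * (\<integral>\<^sup>+\<xi>. (ennreal (norm (f2 \<xi>)))\<^sup>2 \<partial>lborel) * (\<integral>\<^sup>+\<xi>. (ennreal (norm (f3 \<xi>)))\<^sup>2 \<partial>lborel)))"
    by (intro mult_left_mono nn_integral_kernel_sum) auto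
  also have "\<dots> = ennreal ((l2n f1)\<^sup>2) * (9 * (ennreal (LINT \<xi>|lborel. (g \<xi>)\<^sup>2) * ennreal ((l2n f2)\<^sup>2) * ennreal ((l2n f3)\<^sup>2)))"
    using L2_nn[OF f(1)] L2_nn[OF f(2)] L2_nn[OF f(3)] nn_integral_eq_integral[OF g2]
    by (simp add: ennreal_power g0)
  also have "\<dots> = ennreal ((l2n f1)\<^sup>2 * (9 * ((LINT \<xi>|lborel. (g \<xi>)\<^sup>2) * (l2n f2)\<^sup>2 * (l2n f3)\<^sup>2)))"
    by (simp add: ennreal_mult)
  also have "(l2n f1)\<^sup>2 * (9 * ((LINT \<xi>|lborel. (g \<xi>)\<^sup>2) * (l2n f2)\<^sup>2 * (l2n f3)\<^sup>2)) = r\<^sup>2"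
    by (simp add: r_def power_mult_distrib)
  finally have le: "(\<integral>\<^sup>+\<xi>. \<integral>\<^sup>+\<eta>. norm (h \<xi> \<eta>) \<partial>lborel \<partial>lborel) \<le> ennreal r"
    using r0 by (rule ennreal_le_of_power2_le)
  have eq: "(\<integral>\<^sup>+z. ennreal (norm (case_prod h z)) \<partial>(lborel \<Otimes>\<^sub>M lborel)) = (\<integral>\<^sup>+\<xi>. \<integral>\<^sup>+\<eta>. norm (h \<xi> \<eta>) \<partial>lborel \<partial>lborel)"
    by (subst lborel.nn_integral_fst[symmetric]) auto
  show int: "integrable (lborel \<Otimes>\<^sub>M lborel) (case_prod h)"
    by (rule integrableI_bounded[OF hm]) (use eq le in \<open>auto intro: order.strict_trans1\<close>)
  have "ennreal (norm (LINT \<xi>|lborel. LINT \<eta>|lborel. h \<xi> \<eta>)) \<le> ennreal r"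
    unfolding lborel_pair.integral_fst[OF int]
    by (rule order_trans[OF integral_norm_bound_ennreal[OF int]]) (use eq le in simp)
  then show "norm (LINT \<xi>|lborel. LINT \<eta>|lborel. h \<xi> \<eta>) \<le> 3 * sqrt (LINT \<xi>|lborel. (g \<xi>)\<^sup>2) * (l2n f1 * l2n f2 * l2n f3)"
    using r0 by (simp add: r_def)
qed

section \<open>Comparison of sinh x / x with exponentials\<close>

definition sinhc :: "real \<Rightarrow> real" where
  "sinhc x = (if x = 0 then 1 else sinh x / x)"

lemma sinhc_measurable [measurable]: "sinhc \<in> borel_measurable borel"
  unfolding sinhc_def[abs_def] sinh_field_def by measurable

lemma mult_sinhc: "x * sinhc x = sinh x"
  by (simp add: sinhc_def)

lemma sinhc_even: "sinhc (- x) = sinhc x"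
  by (simp add: sinhc_def)

lemma sinhc_abs: "sinhc \<bar>x\<bar> = sinhc x"
  by (simp add: abs_if sinhc_even)

lemma sinh_ge_self: assumes "x \<ge> 0" shows "x \<le> sinh (x::real)"
proof -
  have "sinh 0 - 0 \<le> sinh x - x"
    by (rule DERIV_nonneg_imp_nondecreasing[where f="\<lambda>x. sinh x - x", OF assms])
       (auto intro!: derivative_eq_intros exI simp: cosh_real_ge_1)
  then show ?thesis by simp
qed

lemma sinh_le_mult_exp: assumes "x \<ge> 0" shows "sinh x \<le> x * exp (x::real)"
proof -
  have "1 - 2 * x \<le> exp (- 2 * x)" using exp_ge_add_one_self[of "- 2 * x"] by simp
  then have "(1 - 2 * x) * exp x \<le> exp (- 2 * x) * exp x" by (rule mult_right_mono) simp
  also have "\<dots> = exp (- x)" by (simp flip: exp_add)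
  finally show ?thesis by (simp add: sinh_field_def algebra_simps)
qed

lemma sinhc_ge_1: "1 \<le> sinhc x"
proof -
  have "1 \<le> sinhc \<bar>x\<bar>" using sinh_ge_self[of "\<bar>x\<bar>"] by (simp add: sinhc_def)
  then show ?thesis by (simp add: sinhc_abs)
qed

text \<open>Together with \<open>sinhc_le_exp\<close>: \<open>sinhc x\<close> is comparable to exp
  |x| / (1 + |x|). Here, for y = |x|, exp y = 2 y sinhc y + exp (- y), and the last term is at most
  1 <= sinhc y.\<close>

lemma exp_le_sinhc: "exp \<bar>x\<bar> \<le> 2 * (1 + \<bar>x\<bar>) * sinhc x"
proof -
  define y where "y = \<bar>x\<bar>"
  have y: "y \<ge> 0" by (simp add: y_def)
  have "exp (- y) \<le> sinhc y" using order_trans[OF _ sinhc_ge_1, of "exp (- y)" y] y by simp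
  moreover have "2 * y * sinhc y = exp y - exp (- y)" using mult_sinhc[of y] by (simp add: sinh_field_def)
  ultimately have "exp y \<le> 2 * y * sinhc y + 2 * sinhc y" using sinhc_ge_1[of y] by linarith
  then show ?thesis unfolding y_def[symmetric] sinhc_abs[of x, symmetric] by (simp add: algebra_simps)
qed

lemma sinhc_le_exp: "(1 + \<bar>x\<bar>) * sinhc x \<le> 2 * exp \<bar>x\<bar>"
proof -
  define y where "y = \<bar>x\<bar>"
  have y: "y \<ge> 0" by (simp add: y_def)
  have "sinhc y \<le> exp y" using sinh_le_mult_exp[OF y] y by (auto simp: sinhc_def field_simps)
  moreover have "y * sinhc y \<le> exp y" using mult_sinhc[of y] by (simp add: sinh_field_def) (smt (verit) exp_gt_zero)
  ultimately have "(1 + y) * sinhc y \<le> 2 * exp y" by (simp add: distrib_right)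
  then show ?thesis unfolding y_def sinhc_abs .
qed

text \<open>By the factorization of x^3 + y^3 + z^3 - 3 x y z. It converts a bound by a product over
  the three frequencies into the sum over frequencies that \<open>bbm_weight\<close> and
  \<open>trilinear_bound\<close> ask for.\<close>

lemma AM_GM_3: fixes x y z :: real
  assumes "x \<ge> 0" "y \<ge> 0" "z \<ge> 0" shows "3 * (x * y * z) \<le> x ^ 3 + y ^ 3 + z ^ 3"
proof -
  have "0 \<le> (x + y + z) * ((x - y)\<^sup>2 + (y - z)\<^sup>2 + (z - x)\<^sup>2)" using assms by (intro mult_nonneg_nonneg) auto
  also have "\<dots> = 2 * (x ^ 3 + y ^ 3 + z ^ 3 - 3 * (x * y * z))"
    by (simp add: power2_eq_square power3_eq_cube algebra_simps)
  finally show ?thesis by simp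
qed

text \<open>The square of the weight is \<open>(1 + \<xi>\<^sup>2) sinh (2 \<sigma> \<xi>) / (2 \<sigma> \<xi>)\<close>: it is comparable to
  \<open>(1 + \<bar>\<xi>\<bar>) exp (2 \<sigma> \<bar>\<xi>\<bar>)\<close>, and multiplied by the symbol of the equation it is
  \<open>i sinh (2 \<sigma> \<xi>) / (2 \<sigma>)\<close>, whose sum over three frequencies with sum zero is a product.\<close>

definition bbm_inv_weight :: "real \<Rightarrow> real \<Rightarrow> real" where
  "bbm_inv_weight \<sigma> \<xi> = 1 / sqrt ((1 + \<xi>\<^sup>2) * sinhc (2 * \<sigma> * \<xi>))"

lemma one_plus_square_pos: "0 < 1 + (x::real)\<^sup>2" by (simp add: add_pos_nonneg)

lemma bbm_inv_weight_measurable [measurable]: "bbm_inv_weight \<sigma> \<in> borel_measurable borel"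
  unfolding bbm_inv_weight_def[abs_def] by measurable

lemma bbm_weight_square_ge_1: "1 \<le> (1 + \<xi>\<^sup>2) * sinhc (2 * \<sigma> * \<xi>)"
  using mult_mono[of 1 "1 + \<xi>\<^sup>2" 1 "sinhc (2 * \<sigma> * \<xi>)"] sinhc_ge_1[of "2 * \<sigma> * \<xi>"] by simp

lemma bbm_inv_weight_pos: "0 < bbm_inv_weight \<sigma> \<xi>"
  using bbm_weight_square_ge_1[of \<xi> \<sigma>] by (simp add: bbm_inv_weight_def del: real_sqrt_mult)

lemma bbm_inv_weight_le_1: "bbm_inv_weight \<sigma> \<xi> \<le> 1"
  using bbm_weight_square_ge_1[of \<xi> \<sigma>] unfolding bbm_inv_weight_def by (subst divide_le_eq_1) (auto simp del: real_sqrt_mult)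

lemma bbm_inv_weight_even: "bbm_inv_weight \<sigma> (- \<xi>) = bbm_inv_weight \<sigma> \<xi>"
  using sinhc_even[of "2 * \<sigma> * \<xi>"] by (simp add: bbm_inv_weight_def)

lemma bbm_inv_weight_square: "(bbm_inv_weight \<sigma> \<xi>)\<^sup>2 = 1 / ((1 + \<xi>\<^sup>2) * sinhc (2 * \<sigma> * \<xi>))"
  using bbm_weight_square_ge_1[of \<xi> \<sigma>]
  unfolding bbm_inv_weight_def power_divide by (subst real_sqrt_pow2) auto

lemma bbm_inv_weight_square_le:
  "(bbm_inv_weight \<sigma> \<xi>)\<^sup>2 \<le> 2 * (1 + \<bar>2 * \<sigma> * \<xi>\<bar>) * exp (- \<bar>2 * \<sigma> * \<xi>\<bar>) / (1 + \<xi>\<^sup>2)"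
proof -
  have s: "sinhc (2 * \<sigma> * \<xi>) > 0" using sinhc_ge_1[of "2 * \<sigma> * \<xi>"] by linarith
  have "1 / sinhc (2 * \<sigma> * \<xi>) \<le> 2 * (1 + \<bar>2 * \<sigma> * \<xi>\<bar>) * exp (- \<bar>2 * \<sigma> * \<xi>\<bar>)"
    using exp_le_sinhc[of "2 * \<sigma> * \<xi>"] s by (simp add: exp_minus field_simps)
  then have "1 / sinhc (2 * \<sigma> * \<xi>) / (1 + \<xi>\<^sup>2) \<le> 2 * (1 + \<bar>2 * \<sigma> * \<xi>\<bar>) * exp (- \<bar>2 * \<sigma> * \<xi>\<bar>) / (1 + \<xi>\<^sup>2)"
    by (rule divide_right_mono) (simp add: less_imp_le[OF one_plus_square_pos])
  then show ?thesis unfolding bbm_inv_weight_square by (simp add: mult.commute)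
qed

text \<open>It grows like \<sigma>^(-1/2) as \<sigma> tends to 0. It enters the Lipschitz constant
  and the integrability behind Fubini's theorem, but not the energy inequality.\<close>

definition bbm_kernel_const :: "real \<Rightarrow> real" where
  "bbm_kernel_const \<sigma> = sqrt (32 * (1 + 2 * \<sigma>)\<^sup>2 * (1 + 1 / (2 * \<sigma>)))"

definition bbm_kernel_bound :: "real \<Rightarrow> real \<Rightarrow> real" where
  "bbm_kernel_bound \<sigma> \<xi> = bbm_kernel_const \<sigma> / 3 * (1 / sqrt (1 + \<bar>\<xi>\<bar>)) ^ 3"

lemma bbm_symbol_div_weight_square_le:
  "(norm (bbm_symbol \<xi>) / bbm_inv_weight \<sigma> \<xi>)\<^sup>2 \<le> 2 * exp \<bar>2 * \<sigma> * \<xi>\<bar> / (1 + \<bar>2 * \<sigma> * \<xi>\<bar>)"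
proof -
  have s: "sinhc (2 * \<sigma> * \<xi>) > 0" using sinhc_ge_1[of "2 * \<sigma> * \<xi>"] by linarith
  have "(norm (bbm_symbol \<xi>) / bbm_inv_weight \<sigma> \<xi>)\<^sup>2 = \<xi>\<^sup>2 / (1 + \<xi>\<^sup>2) * sinhc (2 * \<sigma> * \<xi>)"
  proof -
    have "(x / y)\<^sup>2 / (1 / (y * z)) = x\<^sup>2 / y * z" if "y > 0" "z > 0" for x y z :: real
      using that by (simp add: power2_eq_square field_simps)
    from this[OF one_plus_square_pos[of \<xi>] s, of "\<bar>\<xi>\<bar>"] show ?thesis
      unfolding power_divide[of _ "bbm_inv_weight \<sigma> \<xi>"] bbm_inv_weight_square norm_bbm_symbol by simp
  qed
  also have "\<dots> \<le> 1 * sinhc (2 * \<sigma> * \<xi>)"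
    using s one_plus_square_pos[of \<xi>] by (intro mult_right_mono) auto
  also have "\<dots> \<le> 2 * exp \<bar>2 * \<sigma> * \<xi>\<bar> / (1 + \<bar>2 * \<sigma> * \<xi>\<bar>)"
    using sinhc_le_exp[of "2 * \<sigma> * \<xi>"] by (simp add: field_simps)
  finally show ?thesis .
qed

lemma frac_le_frac: "0 < b \<Longrightarrow> 0 < d \<Longrightarrow> a * d \<le> c * b \<Longrightarrow> a / b \<le> c / (d::real)"
  by (simp add: field_simps)

text \<open>Up to constants depending on \<sigma>, p x is at most exp (- \<sigma> |x|) (1 +
  |x|)^(-1/2), and |m| / p is at most exp (\<sigma> |\<xi>|) (1 + |\<xi>|)^(-1/2). The exponentials
  cancel by the triangle inequality. The three algebraic factors combine by \<open>AM_GM_3\<close>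
  into powers with exponent -3/2, which are square integrable.\<close>

lemma bbm_kernel:
  assumes s: "\<sigma> > 0"
  shows "norm (bbm_symbol \<xi>) / bbm_inv_weight \<sigma> \<xi> * bbm_inv_weight \<sigma> \<eta> * bbm_inv_weight \<sigma> (\<xi> - \<eta>)
    \<le> bbm_kernel_bound \<sigma> \<xi> + bbm_kernel_bound \<sigma> \<eta> + bbm_kernel_bound \<sigma> (\<xi> - \<eta>)"
proof -
  let ?p = "bbm_inv_weight \<sigma>" and ?r = "\<lambda>\<xi>::real. 1 / sqrt (1 + \<bar>\<xi>\<bar>)" and ?C = "bbm_kernel_const \<sigma>"
  define \<zeta> where "\<zeta> = \<xi> - \<eta>"
  define D where "D = 2 * (1 + 2 * \<sigma>)"
  have D: "D > 0" using s by (simp add: D_def)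
  let ?e = "\<lambda>\<xi>. exp (- \<bar>2 * \<sigma> * \<xi>\<bar>)"
  have p: "(?p x)\<^sup>2 \<le> 2 * ?e x * (D / (1 + \<bar>x\<bar>))" for x
  proof -
    have a: "1 + \<bar>2 * \<sigma> * x\<bar> \<le> (1 + 2 * \<sigma>) * (1 + \<bar>x\<bar>)" using s by (simp add: abs_mult algebra_simps)
    have b: "(1 + \<bar>x\<bar>)\<^sup>2 \<le> 2 * (1 + x\<^sup>2)" using sum_squares_bound[of 1 "\<bar>x\<bar>"] by (simp add: power2_sum)
    have "(1 + \<bar>2 * \<sigma> * x\<bar>) * (1 + \<bar>x\<bar>) \<le> (1 + 2 * \<sigma>) * (1 + \<bar>x\<bar>) * (1 + \<bar>x\<bar>)"
      using a by (rule mult_right_mono) simp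
    also have "\<dots> \<le> (1 + 2 * \<sigma>) * (2 * (1 + x\<^sup>2))"
      using mult_left_mono[OF b, of "1 + 2 * \<sigma>"] s by (simp add: power2_eq_square mult.assoc)
    finally have f: "(1 + \<bar>2 * \<sigma> * x\<bar>) / (1 + x\<^sup>2) \<le> D / (1 + \<bar>x\<bar>)"
      unfolding D_def by (intro frac_le_frac one_plus_square_pos) (simp_all add: algebra_simps)
    have "2 * (1 + \<bar>2 * \<sigma> * x\<bar>) * ?e x / (1 + x\<^sup>2) = 2 * ?e x * ((1 + \<bar>2 * \<sigma> * x\<bar>) / (1 + x\<^sup>2))"
      by (simp only: times_divide_eq_right mult_ac)
    also have "\<dots> \<le> 2 * ?e x * (D / (1 + \<bar>x\<bar>))"
      using f by (rule mult_left_mono) simp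
    finally show ?thesis by (rule order_trans[OF bbm_inv_weight_square_le])
  qed
  have m: "(norm (bbm_symbol \<xi>) / ?p \<xi>)\<^sup>2 \<le> 2 * exp \<bar>2 * \<sigma> * \<xi>\<bar> * ((1 + 1 / (2 * \<sigma>)) / (1 + \<bar>\<xi>\<bar>))"
  proof -
    have pos: "1 + \<bar>2 * \<sigma> * \<xi>\<bar> > 0" by (simp add: add_pos_nonneg)
    have "1 + \<bar>\<xi>\<bar> \<le> (1 + 1 / (2 * \<sigma>)) * (1 + \<bar>2 * \<sigma> * \<xi>\<bar>)"
      using s by (simp add: abs_mult field_simps)
    then have "1 / (1 + \<bar>2 * \<sigma> * \<xi>\<bar>) \<le> (1 + 1 / (2 * \<sigma>)) / (1 + \<bar>\<xi>\<bar>)"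
      by (intro frac_le_frac pos) simp_all
    from mult_left_mono[OF this, of "2 * exp \<bar>2 * \<sigma> * \<xi>\<bar>"] show ?thesis
      using bbm_symbol_div_weight_square_le[of \<xi> \<sigma>] by simp
  qed
  have e: "exp \<bar>2 * \<sigma> * \<xi>\<bar> * (?e \<eta> * ?e \<zeta>) \<le> 1"
  proof -
    have "\<bar>2 * \<sigma> * \<xi>\<bar> \<le> \<bar>2 * \<sigma> * \<eta>\<bar> + \<bar>2 * \<sigma> * \<zeta>\<bar>"
      using abs_triangle_ineq[of "2 * \<sigma> * \<eta>" "2 * \<sigma> * \<zeta>"] by (simp add: \<zeta>_def algebra_simps)
    then show ?thesis by (simp flip: exp_add)
  qed
  let ?K = "norm (bbm_symbol \<xi>) / ?p \<xi> * ?p \<eta> * ?p \<zeta>"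
  have "?K\<^sup>2 \<le> (2 * exp \<bar>2 * \<sigma> * \<xi>\<bar> * ((1 + 1 / (2 * \<sigma>)) / (1 + \<bar>\<xi>\<bar>))) * (2 * ?e \<eta> * (D / (1 + \<bar>\<eta>\<bar>))) * (2 * ?e \<zeta> * (D / (1 + \<bar>\<zeta>\<bar>)))"
    unfolding power_mult_distrib[of _ "?p \<zeta>"] power_mult_distrib[of _ "?p \<eta>"]
    using D s by (intro mult_mono m p) auto
  also have "\<dots> = (exp \<bar>2 * \<sigma> * \<xi>\<bar> * (?e \<eta> * ?e \<zeta>)) * (8 * D\<^sup>2 * (1 + 1 / (2 * \<sigma>)) / ((1 + \<bar>\<xi>\<bar>) * (1 + \<bar>\<eta>\<bar>) * (1 + \<bar>\<zeta>\<bar>)))"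
    by (simp add: power2_eq_square field_simps)
  also have "\<dots> \<le> 1 * (8 * D\<^sup>2 * (1 + 1 / (2 * \<sigma>)) / ((1 + \<bar>\<xi>\<bar>) * (1 + \<bar>\<eta>\<bar>) * (1 + \<bar>\<zeta>\<bar>)))"
    using s by (intro mult_right_mono e) auto
  also have "\<dots> = (?C * (?r \<xi> * ?r \<eta> * ?r \<zeta>))\<^sup>2"
  proof -
    have D2: "8 * D\<^sup>2 = 32 * (1 + 2 * \<sigma>)\<^sup>2" unfolding D_def power_mult_distrib by simp
    show ?thesis unfolding D2 using s by (simp add: bbm_kernel_const_def power_mult_distrib power_divide)
  qed
  finally have "?K \<le> ?C * (?r \<xi> * ?r \<eta> * ?r \<zeta>)"
    by (rule power2_le_imp_le) (use s in \<open>auto simp: bbm_kernel_const_def\<close>)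
  also have "\<dots> \<le> ?C * ((?r \<xi> ^ 3 + ?r \<eta> ^ 3 + ?r \<zeta> ^ 3) / 3)"
  proof (rule mult_left_mono)
    show "?r \<xi> * ?r \<eta> * ?r \<zeta> \<le> (?r \<xi> ^ 3 + ?r \<eta> ^ 3 + ?r \<zeta> ^ 3) / 3"
      using AM_GM_3[of "?r \<xi>" "?r \<eta>" "?r \<zeta>"] by simp
  qed (use s in \<open>simp add: bbm_kernel_const_def\<close>)
  also have "\<dots> = bbm_kernel_bound \<sigma> \<xi> + bbm_kernel_bound \<sigma> \<eta> + bbm_kernel_bound \<sigma> \<zeta>"
    by (simp add: bbm_kernel_bound_def distrib_left add_divide_distrib)
  finally show ?thesis unfolding \<zeta>_def .
qed

lemma bbm_weight_inv_weight:
  assumes s: "\<sigma> > 0" shows "bbm_weight (bbm_inv_weight \<sigma>) (bbm_kernel_bound \<sigma>)"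
proof
  show "bbm_kernel_bound \<sigma> \<in> borel_measurable borel" unfolding bbm_kernel_bound_def[abs_def] by measurable
  then have [measurable]: "(\<lambda>\<xi>. (bbm_kernel_bound \<sigma> \<xi>)\<^sup>2) \<in> borel_measurable lborel" by simp
  show "integrable lborel (\<lambda>\<xi>. (bbm_kernel_bound \<sigma> \<xi>)\<^sup>2)"
  proof (rule Bochner_Integration.integrable_bound)
    show "integrable lborel (\<lambda>\<xi>. (bbm_kernel_const \<sigma> / 3)\<^sup>2 * (1 / (1 + \<xi>\<^sup>2)))"
      by (intro integrable_mult_right integrable_inverse_1_plus_square_lborel)
    have "((1 / sqrt (1 + \<bar>\<xi>\<bar>)) ^ 3)\<^sup>2 \<le> 1 / (1 + \<xi>\<^sup>2)" for \<xi> :: real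
    proof -
      have "((1 / sqrt (1 + \<bar>\<xi>\<bar>)) ^ 3)\<^sup>2 = ((1 / sqrt (1 + \<bar>\<xi>\<bar>))\<^sup>2) ^ 3" by (simp flip: power_mult)
      also have "\<dots> = 1 / (1 + \<bar>\<xi>\<bar>) ^ 3" by (simp add: power_divide)
      also have "\<dots> \<le> 1 / (1 + \<xi>\<^sup>2)"
      proof (rule divide_left_mono)
        have "1 + \<xi>\<^sup>2 \<le> (1 + \<bar>\<xi>\<bar>)\<^sup>2" by (simp add: power2_sum)
        also have "\<dots> \<le> (1 + \<bar>\<xi>\<bar>) ^ 3" by (rule power_increasing) auto
        finally show "1 + \<xi>\<^sup>2 \<le> (1 + \<bar>\<xi>\<bar>) ^ 3" .
      qed (use one_plus_square_pos in auto)
      finally show ?thesis .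
    qed
    then have "(bbm_kernel_bound \<sigma> \<xi>)\<^sup>2 \<le> (bbm_kernel_const \<sigma> / 3)\<^sup>2 * (1 / (1 + \<xi>\<^sup>2))" for \<xi>
      unfolding bbm_kernel_bound_def power_mult_distrib by (rule mult_left_mono) simp
    then show "AE \<xi> in lborel. norm ((bbm_kernel_bound \<sigma> \<xi>)\<^sup>2) \<le> norm ((bbm_kernel_const \<sigma> / 3)\<^sup>2 * (1 / (1 + \<xi>\<^sup>2)))"
      by (intro AE_I2) (simp add: abs_of_pos one_plus_square_pos abs_mult)
  qed measurable
qed (use s bbm_kernel[OF s] in \<open>auto simp: bbm_inv_weight_pos bbm_inv_weight_le_1 bbm_inv_weight_even
      bbm_kernel_bound_def bbm_kernel_const_def\<close>)

section \<open>The symmetrized energy kernel\<close>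

lemma sinh_square_le:
  fixes a :: real
  shows "(sinh a)\<^sup>2 \<le> \<bar>a\<bar> * sinhc (2 * a)" "(sinh a)\<^sup>2 \<le> 2 * a\<^sup>2 * sinhc (2 * a)"
proof -
  define y where "y = \<bar>a\<bar>"
  have y: "y \<ge> 0" by (simp add: y_def)
  have sy: "sinh y \<ge> 0" using sinh_ge_self[OF y] y by linarith
  \<comment> \<open>The double argument produces a factor cosh y to compare one sinh y with: sinh y
    <= cosh y is good for large y, and sinh y <= 2 y cosh y for small y.\<close>
  have "y * sinhc (2 * y) = sinh y * cosh y"
    using mult_sinhc[of "2 * y"] by (simp add: sinh_double)
  moreover have "sinh y * sinh y \<le> sinh y * cosh y"
    using sy by (intro mult_left_mono) (simp_all add: sinh_field_def cosh_field_def field_simps)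
  ultimately have 1: "(sinh y)\<^sup>2 \<le> y * sinhc (2 * y)" by (simp add: power2_eq_square)
  have "exp y \<le> 2 * cosh y" by (simp add: cosh_field_def)
  then have "sinh y \<le> y * (2 * cosh y)" using sinh_le_mult_exp[OF y] mult_left_mono[OF _ y] order_trans by blast
  then have "sinh y * sinh y \<le> sinh y * (y * (2 * cosh y))" using sy by (rule mult_left_mono)
  also have "\<dots> = 2 * y * (y * sinhc (2 * y))" using mult_sinhc[of "2 * y"] by (simp add: sinh_double)
  finally have 2: "(sinh y)\<^sup>2 \<le> 2 * y\<^sup>2 * sinhc (2 * y)" by (simp add: power2_eq_square mult_ac)
  have e: "(sinh y)\<^sup>2 = (sinh a)\<^sup>2" "sinhc (2 * y) = sinhc (2 * a)" "y\<^sup>2 = a\<^sup>2"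
    using sinhc_even[of "2 * a"] by (auto simp: y_def abs_if)
  show "(sinh a)\<^sup>2 \<le> \<bar>a\<bar> * sinhc (2 * a)" "(sinh a)\<^sup>2 \<le> 2 * a\<^sup>2 * sinhc (2 * a)"
    using 1 2 unfolding e by (simp_all add: y_def)
qed

text \<open>In exp a and exp b both sides are the same rational function. The left-hand side is the
  sum of sinh at twice the three numbers a, - b, b - a, whose sum is zero. Its first-order terms
  cancel and three small factors remain; this is the gain over a term-by-term estimate.\<close>

lemma sinh_sum_zero:
  fixes a b :: real
  shows "sinh (2 * a) - sinh (2 * b) - sinh (2 * (a - b)) = 4 * (sinh a * sinh b * sinh (a - b))"
proof -
  define u v where "u = exp a" and "v = exp b"
  have uv: "u > 0" "v > 0" by (simp_all add: u_def v_def)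
  have e: "exp a = u" "exp (- a) = 1 / u" "exp b = v" "exp (- b) = 1 / v" "exp (2 * a) = u\<^sup>2" "exp (- (2 * a)) = 1 / u\<^sup>2"
    "exp (2 * b) = v\<^sup>2" "exp (- (2 * b)) = 1 / v\<^sup>2" "exp (a - b) = u / v" "exp (- (a - b)) = v / u"
    "exp (2 * (a - b)) = u\<^sup>2 / v\<^sup>2" "exp (- (2 * (a - b))) = v\<^sup>2 / u\<^sup>2"
    by (simp_all add: u_def v_def exp_minus exp_diff exp_double divide_inverse right_diff_distrib)
  show ?thesis
    unfolding sinh_field_def e using uv by (simp add: field_simps power2_eq_square)
qed

text \<open>The constant is 4 / (2 \<sigma>) from the addition theorem, divided by 3 in
  \<open>AM_GM_3\<close>.\<close>

definition energy_kernel :: "real \<Rightarrow> real \<Rightarrow> real" where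
  "energy_kernel \<sigma> \<xi> = 2 / (3 * \<sigma>) * (\<bar>sinh (\<sigma> * \<xi>)\<bar> * bbm_inv_weight \<sigma> \<xi>) ^ 3"

lemma energy_kernel_measurable [measurable]: "energy_kernel \<sigma> \<in> borel_measurable borel"
  unfolding energy_kernel_def[abs_def] sinh_field_def by measurable

text \<open>With a = \<sigma> \<xi> not 0, the two bounds of \<open>sinh_square_le\<close> say that
  k is at most 2 \<sigma>^2 and at most \<sigma>^2 / |a|. Hence k^3 is of order \<sigma>^6 / (1 +
  a^2), and the squared prefactor of order 1 / \<sigma>^2 leaves \<sigma>^4. The form
  \<open>0 + \<sigma> * \<xi>\<close> is the one expected by the affine substitution rules.\<close>

lemma energy_kernel_square_le:
  assumes s: "\<sigma> > 0"
  shows "(energy_kernel \<sigma> \<xi>)\<^sup>2 \<le> 64 / 9 * \<sigma> ^ 4 * (1 / (1 + (0 + \<sigma> * \<xi>)\<^sup>2))"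
proof -
  define a k where "a = \<sigma> * \<xi>" and "k = (\<bar>sinh (\<sigma> * \<xi>)\<bar> * bbm_inv_weight \<sigma> \<xi>)\<^sup>2"
  have k0: "k \<ge> 0" by (simp add: k_def)
  have sc: "sinhc (2 * a) > 0" using sinhc_ge_1[of "2 * a"] by linarith
  have k: "k = (sinh a)\<^sup>2 / sinhc (2 * a) / (1 + \<xi>\<^sup>2)"
    by (simp add: k_def a_def power_mult_distrib bbm_inv_weight_square mult_ac)
  have 1: "k \<le> \<bar>a\<bar> / (1 + \<xi>\<^sup>2)" "k \<le> 2 * a\<^sup>2 / (1 + \<xi>\<^sup>2)"
    unfolding k using sinh_square_le[of a] sc one_plus_square_pos[of \<xi>]
    by (auto intro!: divide_right_mono simp: pos_divide_le_eq)
  have k3: "k ^ 3 \<le> 16 * \<sigma> ^ 6 / (1 + a\<^sup>2)"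
  proof (cases "\<xi> = 0")
    case True then show ?thesis by (simp add: k a_def)
  next
    case False
    then have x: "\<xi>\<^sup>2 > 0" by simp
    have a0: "a \<noteq> 0" using False s by (simp add: a_def)
    have k1: "k \<le> 2 * \<sigma>\<^sup>2"
    proof -
      have "2 * a\<^sup>2 / (1 + \<xi>\<^sup>2) \<le> 2 * a\<^sup>2 / \<xi>\<^sup>2" using x one_plus_square_pos[of \<xi>] by (intro divide_left_mono mult_pos_pos) auto
      also have "\<dots> = 2 * \<sigma>\<^sup>2" using False by (simp add: a_def power_mult_distrib)
      finally show ?thesis using 1(2) by linarith
    qed
    have k2: "k \<le> \<sigma>\<^sup>2 / \<bar>a\<bar>"
    proof -
      have "\<bar>a\<bar> / (1 + \<xi>\<^sup>2) \<le> \<bar>a\<bar> / \<xi>\<^sup>2" using x one_plus_square_pos[of \<xi>] by (intro divide_left_mono mult_pos_pos) auto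
      also have "\<dots> = \<sigma>\<^sup>2 / \<bar>a\<bar>"
      proof -
        have "\<bar>a\<bar> * \<bar>a\<bar> = \<sigma>\<^sup>2 * \<xi>\<^sup>2" by (simp add: a_def power2_eq_square mult_ac)
        then show ?thesis using a0 False by (simp add: field_simps)
      qed
      finally show ?thesis using 1(1) by linarith
    qed
    show ?thesis
    proof (cases "\<bar>a\<bar> \<le> 1")
      case True
      then have "a\<^sup>2 \<le> 1" by (simp add: abs_square_le_1)
      have "k ^ 3 \<le> (2 * \<sigma>\<^sup>2) ^ 3" using k1 k0 by (rule power_mono)
      also have "\<dots> = 8 * \<sigma> ^ 6" by (simp add: power_mult_distrib flip: power_mult)
      also have "\<dots> \<le> 16 * \<sigma> ^ 6 / (1 + a\<^sup>2)"
      proof -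
        have "8 * \<sigma> ^ 6 * (1 + a\<^sup>2) \<le> 8 * \<sigma> ^ 6 * 2" using \<open>a\<^sup>2 \<le> 1\<close> by (intro mult_left_mono) auto
        then show ?thesis using one_plus_square_pos[of a] by (simp add: pos_le_divide_eq)
      qed
      finally show ?thesis .
    next
      case False
      then have a1: "1 \<le> a\<^sup>2" using power_mono[of 1 "\<bar>a\<bar>" 2] by simp
      have "k ^ 3 = k * k\<^sup>2" by (simp add: power3_eq_cube power2_eq_square)
      also have "\<dots> \<le> (2 * \<sigma>\<^sup>2) * (\<sigma>\<^sup>2 / \<bar>a\<bar>)\<^sup>2" using k1 k2 k0 by (intro mult_mono power_mono) auto
      also have "\<dots> = 2 * \<sigma> ^ 6 / a\<^sup>2" by (simp add: power_divide flip: power_mult power_add)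
      also have "\<dots> \<le> 16 * \<sigma> ^ 6 / (1 + a\<^sup>2)"
      proof (rule frac_le_frac)
        have "2 * \<sigma> ^ 6 * (1 + a\<^sup>2) \<le> 2 * \<sigma> ^ 6 * (8 * a\<^sup>2)" using a1 by (intro mult_left_mono) auto
        then show "2 * \<sigma> ^ 6 * (1 + a\<^sup>2) \<le> 16 * \<sigma> ^ 6 * a\<^sup>2" by simp
      qed (use a1 one_plus_square_pos in auto)
      finally show ?thesis .
    qed
  qed
  have "(energy_kernel \<sigma> \<xi>)\<^sup>2 = 4 / (9 * \<sigma>\<^sup>2) * k ^ 3"
    unfolding energy_kernel_def k_def by (simp add: power_mult_distrib power_divide flip: power_mult)
  also have "\<dots> \<le> 4 / (9 * \<sigma>\<^sup>2) * (16 * \<sigma> ^ 6 / (1 + a\<^sup>2))" using k3 by (rule mult_left_mono) simp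
  also have "\<dots> = 64 / 9 * \<sigma> ^ 4 * (1 / (1 + a\<^sup>2))"
  proof -
    have e: "4 / (9 * x) * (16 * (x * z) / y) = 64 / 9 * z * (1 / y)" if "x > 0" "y > 0" for x y z :: real
      using that by (simp add: field_simps)
    have "\<sigma> ^ 6 = \<sigma>\<^sup>2 * \<sigma> ^ 4" by (simp flip: power_add)
    then show ?thesis using e[of "\<sigma>\<^sup>2" "1 + a\<^sup>2" "\<sigma> ^ 4"] s one_plus_square_pos[of a] by simp
  qed
  finally show ?thesis by (simp add: a_def)
qed

text \<open>Substituting a = \<sigma> \<xi> in the integral turns \<sigma>^4 into \<sigma>^3, whose
  square root is \<open>\<sigma> * sqrt \<sigma>\<close>.\<close>

lemma energy_kernel_norm:
  assumes s: "\<sigma> > 0"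
  shows "integrable lborel (\<lambda>\<xi>. (energy_kernel \<sigma> \<xi>)\<^sup>2)"
    and "sqrt (LINT \<xi>|lborel. (energy_kernel \<sigma> \<xi>)\<^sup>2) \<le> 8 / 3 * sqrt (LINT x|lborel. 1 / (1 + x\<^sup>2)) * (\<sigma> * sqrt \<sigma>)"
proof -
  have i: "integrable lborel (\<lambda>\<xi>. 64 / 9 * \<sigma> ^ 4 * (1 / (1 + (0 + \<sigma> * \<xi>)\<^sup>2)))"
    using s by (intro integrable_mult_right lborel_integrable_real_affine integrable_inverse_1_plus_square_lborel) simp
  show int: "integrable lborel (\<lambda>\<xi>. (energy_kernel \<sigma> \<xi>)\<^sup>2)"
    by (rule Bochner_Integration.integrable_bound[OF i])
       (use energy_kernel_square_le[OF s] in \<open>auto intro!: order_trans[OF _ abs_ge_self]\<close>)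
  have "(LINT \<xi>|lborel. (energy_kernel \<sigma> \<xi>)\<^sup>2) \<le> (LINT \<xi>|lborel. 64 / 9 * \<sigma> ^ 4 * (1 / (1 + (0 + \<sigma> * \<xi>)\<^sup>2)))"
    by (rule integral_mono[OF int i energy_kernel_square_le[OF s]])
  also have "\<dots> = 64 / 9 * \<sigma> ^ 3 * (LINT x|lborel. 1 / (1 + x\<^sup>2))"
    using lborel_integral_real_affine[of \<sigma> "\<lambda>x. 1 / (1 + x\<^sup>2)" 0] s
    unfolding integral_mult_right_zero by (simp add: power3_eq_cube power4_eq_xxxx)
  finally have "sqrt (LINT \<xi>|lborel. (energy_kernel \<sigma> \<xi>)\<^sup>2) \<le> sqrt (64 / 9 * \<sigma> ^ 3 * (LINT x|lborel. 1 / (1 + x\<^sup>2)))"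
    by (rule real_sqrt_le_mono)
  also have "\<dots> = 8 / 3 * sqrt (LINT x|lborel. 1 / (1 + x\<^sup>2)) * (\<sigma> * sqrt \<sigma>)"
  proof -
    have "sqrt 64 = (8::real)" "sqrt 9 = (3::real)" by (rule real_sqrt_unique; simp)+
    moreover have "sqrt (\<sigma> ^ 3) = \<sigma> * sqrt \<sigma>" using s by (simp add: power3_eq_cube real_sqrt_mult)
    ultimately show ?thesis by (simp add: real_sqrt_mult real_sqrt_divide)
  qed
  finally show "sqrt (LINT \<xi>|lborel. (energy_kernel \<sigma> \<xi>)\<^sup>2) \<le> 8 / 3 * sqrt (LINT x|lborel. 1 / (1 + x\<^sup>2)) * (\<sigma> * sqrt \<sigma>)" .
qed

definition energy_symbol :: "real \<Rightarrow> real \<Rightarrow> real" where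
  "energy_symbol \<sigma> \<xi> = sinh (2 * \<sigma> * \<xi>) / (2 * \<sigma>)"

lemma energy_symbol_measurable [measurable]: "energy_symbol \<sigma> \<in> borel_measurable borel"
  unfolding energy_symbol_def[abs_def] sinh_field_def by measurable

lemma energy_symbol_odd: "energy_symbol \<sigma> (- \<xi>) = - energy_symbol \<sigma> \<xi>"
  by (simp add: energy_symbol_def)

text \<open>\<open>energy_symbol\<close> is the imaginary part of the symbol divided by p^2. Keeping
  only one of the two divisions gives the multiplier as it occurs in
  \<open>bbm_product\<close>.\<close>

lemma energy_symbol_weight:
  assumes s: "\<sigma> > 0"
  shows "energy_symbol \<sigma> \<xi> * bbm_inv_weight \<sigma> \<xi> = \<xi> / (1 + \<xi>\<^sup>2) / bbm_inv_weight \<sigma> \<xi>"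
proof -
  have sc: "sinhc (2 * \<sigma> * \<xi>) > 0" using sinhc_ge_1[of "2 * \<sigma> * \<xi>"] by linarith
  have "energy_symbol \<sigma> \<xi> = \<xi> * sinhc (2 * \<sigma> * \<xi>)"
    using mult_sinhc[of "2 * \<sigma> * \<xi>"] s by (simp add: energy_symbol_def field_simps)
  then have "energy_symbol \<sigma> \<xi> * (bbm_inv_weight \<sigma> \<xi>)\<^sup>2 = \<xi> / (1 + \<xi>\<^sup>2)"
    unfolding bbm_inv_weight_square using sc by simp
  then have "energy_symbol \<sigma> \<xi> * (bbm_inv_weight \<sigma> \<xi>)\<^sup>2 / bbm_inv_weight \<sigma> \<xi> = \<xi> / (1 + \<xi>\<^sup>2) / bbm_inv_weight \<sigma> \<xi>"
    by simp
  moreover have "bbm_inv_weight \<sigma> \<xi> \<noteq> 0" using bbm_inv_weight_pos[of \<sigma> \<xi>] by simp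
  ultimately show ?thesis by (simp add: power2_eq_square)
qed

lemma abs_energy_symbol_weight:
  assumes s: "\<sigma> > 0"
  shows "\<bar>energy_symbol \<sigma> \<xi>\<bar> * bbm_inv_weight \<sigma> \<xi> = norm (bbm_symbol \<xi>) / bbm_inv_weight \<sigma> \<xi>"
proof -
  have "\<bar>energy_symbol \<sigma> \<xi>\<bar> * bbm_inv_weight \<sigma> \<xi> = \<bar>energy_symbol \<sigma> \<xi> * bbm_inv_weight \<sigma> \<xi>\<bar>"
    using bbm_inv_weight_pos[of \<sigma> \<xi>] by (simp add: abs_mult)
  then show ?thesis
    unfolding energy_symbol_weight[OF s] norm_bbm_symbol
    using bbm_inv_weight_pos[of \<sigma> \<xi>] one_plus_square_pos[of \<xi>] by (simp add: abs_mult)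
qed

text \<open>Writing the cubic form as an integral over frequencies \<open>\<xi>\<close>, \<open>- \<eta>\<close>, \<open>\<eta> - \<xi>\<close> with sum zero and
  symmetrizing in them replaces the multiplier \<open>energy_symbol \<sigma> \<xi>\<close> by one third of the sum of its values,
  which by the addition theorem is a product of three hyperbolic sines.\<close>

lemma inner_bbm_bilinear_le:
  assumes s: "\<sigma> > 0"
  shows "\<bar>inner x (bbm_bilinear (bbm_inv_weight \<sigma>) x x)\<bar>
    \<le> 8 / 3 * sqrt (LINT x|lborel. 1 / (1 + x\<^sup>2)) * (\<sigma> * sqrt \<sigma>) * norm x ^ 3"
proof -
  interpret W: bbm_weight "bbm_inv_weight \<sigma>" "bbm_kernel_bound \<sigma>" by (rule bbm_weight_inv_weight[OF s])
  let ?p = "bbm_inv_weight \<sigma>" and ?S = "energy_symbol \<sigma>"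
  obtain f where f: "f \<in> hermL2" "x = mk f" by (rule hl2_cases)
  note [measurable] = hermL2_measurable[OF f(1)]
  have fL: "f \<in> L2" by (rule hermL2_L2[OF f(1)])
  define q where "q = weighted ?p f"
  have qh: "q \<in> hermL2" unfolding q_def by (rule W.weighted_hermL2[OF f(1)])
  note [measurable] = hermL2_measurable[OF qh]
  have nq: "norm (q \<xi>) = ?p \<xi> * norm (f \<xi>)" for \<xi>
    by (simp add: q_def weighted_def norm_mult abs_of_pos[OF bbm_inv_weight_pos])
  \<comment> \<open>By Hermitian symmetry this is q (\<xi>) q (- \<eta>) q (\<eta> - \<xi>), a
    symmetric function of three frequencies with sum zero. \<open>Q1\<close> exchanges the first two
    of them, \<open>Q2\<close> the first and the third.\<close>
  define Q where "Q \<xi> \<eta> = q \<xi> * cnj (q \<eta>) * cnj (q (\<xi> - \<eta>))" for \<xi> \<eta>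
  have Qm [measurable]: "case_prod Q \<in> borel_measurable (lborel \<Otimes>\<^sub>M lborel)" unfolding Q_def[abs_def] by measurable
  have Q1: "Q (- \<eta>) (- \<xi>) = Q \<xi> \<eta>" for \<xi> \<eta>
    using hermL2_reflect[OF qh] by (simp add: Q_def mult_ac)
  have Q2: "Q (\<eta> - \<xi>) \<eta> = Q \<xi> \<eta>" for \<xi> \<eta>
    using hermL2_reflect[OF qh, of \<xi>] hermL2_reflect[OF qh, of "\<xi> - \<eta>"] by (simp add: Q_def mult_ac)
  \<comment> \<open>Applied with \<open>bbm_kernel_bound\<close> to each single term, where only
    integrability is wanted, and with \<open>energy_kernel\<close> to their sum, where the size
    matters.\<close>
  have bound: "integrable (lborel \<Otimes>\<^sub>M lborel) (\<lambda>(\<xi>, \<eta>). complex_of_real (M \<xi> \<eta>) * Q \<xi> \<eta>)"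
    "norm (LINT \<xi>|lborel. LINT \<eta>|lborel. complex_of_real (M \<xi> \<eta>) * Q \<xi> \<eta>)
      \<le> 3 * sqrt (LINT \<xi>|lborel. (g \<xi>)\<^sup>2) * (l2n f * l2n f * l2n f)"
    if g: "integrable lborel (\<lambda>\<xi>. (g \<xi>)\<^sup>2)" "\<And>\<xi>. g \<xi> \<ge> 0" "g \<in> borel_measurable borel"
      and M[measurable]: "case_prod M \<in> borel_measurable (lborel \<Otimes>\<^sub>M lborel)"
      and le: "\<And>\<xi> \<eta>. \<bar>M \<xi> \<eta>\<bar> * (?p \<xi> * ?p \<eta> * ?p (\<xi> - \<eta>)) \<le> g \<xi> + g \<eta> + g (\<xi> - \<eta>)"
    for g :: "real \<Rightarrow> real" and M :: "real \<Rightarrow> real \<Rightarrow> real"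
  proof -
    have m: "(\<lambda>(\<xi>, \<eta>). complex_of_real (M \<xi> \<eta>) * Q \<xi> \<eta>) \<in> borel_measurable (lborel \<Otimes>\<^sub>M lborel)" by measurable
    have b: "norm (complex_of_real (M \<xi> \<eta>) * Q \<xi> \<eta>) \<le> (g \<xi> + g \<eta> + g (\<xi> - \<eta>)) * (norm (f \<xi>) * norm (f \<eta>) * norm (f (\<xi> - \<eta>)))" for \<xi> \<eta>
    proof -
      have "norm (complex_of_real (M \<xi> \<eta>) * Q \<xi> \<eta>) = (\<bar>M \<xi> \<eta>\<bar> * (?p \<xi> * ?p \<eta> * ?p (\<xi> - \<eta>))) * (norm (f \<xi>) * norm (f \<eta>) * norm (f (\<xi> - \<eta>)))"
        by (simp add: Q_def norm_mult nq mult_ac)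
      also have "\<dots> \<le> (g \<xi> + g \<eta> + g (\<xi> - \<eta>)) * (norm (f \<xi>) * norm (f \<eta>) * norm (f (\<xi> - \<eta>)))"
        by (intro mult_right_mono le) auto
      finally show ?thesis .
    qed
    show "integrable (lborel \<Otimes>\<^sub>M lborel) (\<lambda>(\<xi>, \<eta>). complex_of_real (M \<xi> \<eta>) * Q \<xi> \<eta>)"
      "norm (LINT \<xi>|lborel. LINT \<eta>|lborel. complex_of_real (M \<xi> \<eta>) * Q \<xi> \<eta>) \<le> 3 * sqrt (LINT \<xi>|lborel. (g \<xi>)\<^sup>2) * (l2n f * l2n f * l2n f)"
      using trilinear_bound[OF g fL fL fL m b] by auto
  qed
  let ?g = "bbm_kernel_bound \<sigma>"
  have ge: "?g (- \<xi>) = ?g \<xi>" for \<xi> by (simp add: bbm_kernel_bound_def)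
  have kern: "\<bar>?S \<xi>\<bar> * (?p \<xi> * ?p \<eta> * ?p (\<xi> - \<eta>)) \<le> ?g \<xi> + ?g \<eta> + ?g (\<xi> - \<eta>)" for \<xi> \<eta>
    using W.kernel[of \<xi> \<eta>] unfolding abs_energy_symbol_weight[OF s, symmetric] by (simp add: mult_ac)
  have pe: "?p (a - b) = ?p (b - a)" and ge': "?g (a - b) = ?g (b - a)" for a b
    using bbm_inv_weight_even[of \<sigma> "b - a"] ge[of "b - a"] by simp_all
  \<comment> \<open>The multiplier is evaluated at \<xi>, - \<eta> and \<eta> - \<xi> in turn, using
    that \<open>energy_symbol\<close> is odd. The permutations of \<open>Q\<close> show that all
    three integrals equal \<open>J\<close>.\<close>
  define h1 where "h1 \<xi> \<eta> = complex_of_real (?S \<xi>) * Q \<xi> \<eta>" for \<xi> \<eta>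
  define h2 where "h2 \<xi> \<eta> = complex_of_real (- ?S \<eta>) * Q \<xi> \<eta>" for \<xi> \<eta>
  define h3 where "h3 \<xi> \<eta> = complex_of_real (- ?S (\<xi> - \<eta>)) * Q \<xi> \<eta>" for \<xi> \<eta>
  have i1: "integrable (lborel \<Otimes>\<^sub>M lborel) (case_prod h1)"
    unfolding h1_def[abs_def] by (rule bound(1)[OF W.g_square W.g_nonneg W.g_measurable]) (measurable, rule kern)
  have i2: "integrable (lborel \<Otimes>\<^sub>M lborel) (case_prod h2)"
    unfolding h2_def[abs_def]
  proof (rule bound(1)[OF W.g_square W.g_nonneg W.g_measurable])
    fix \<xi> \<eta>
    show "\<bar>- ?S \<eta>\<bar> * (?p \<xi> * ?p \<eta> * ?p (\<xi> - \<eta>)) \<le> ?g \<xi> + ?g \<eta> + ?g (\<xi> - \<eta>)"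
      using kern[of \<eta> \<xi>] unfolding pe[of \<eta> \<xi>] ge'[of \<eta> \<xi>] by (simp add: mult_ac add_ac)
  qed measurable
  have i3: "integrable (lborel \<Otimes>\<^sub>M lborel) (case_prod h3)"
    unfolding h3_def[abs_def]
  proof (rule bound(1)[OF W.g_square W.g_nonneg W.g_measurable])
    fix \<xi> \<eta>
    show "\<bar>- ?S (\<xi> - \<eta>)\<bar> * (?p \<xi> * ?p \<eta> * ?p (\<xi> - \<eta>)) \<le> ?g \<xi> + ?g \<eta> + ?g (\<xi> - \<eta>)"
      using kern[of "\<xi> - \<eta>" \<xi>] by (simp add: bbm_inv_weight_even ge mult_ac add_ac)
  qed measurable
  define J where "J = (LINT \<xi>|lborel. LINT \<eta>|lborel. h1 \<xi> \<eta>)"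
  have J2: "J = (LINT \<xi>|lborel. LINT \<eta>|lborel. h2 \<xi> \<eta>)"
  proof -
    have r: "(LINT x|lborel. F x) = (LINT x|lborel. F (- x))" for F :: "real \<Rightarrow> complex"
      using lborel_integral_real_affine[of "-1" F 0] by simp
    have "J = (LINT \<xi>|lborel. LINT \<eta>|lborel. h1 (- \<xi>) (- \<eta>))"
      unfolding J_def by (subst r, subst (2) r) (rule refl)
    also have "\<dots> = (LINT \<xi>|lborel. LINT \<eta>|lborel. h2 \<eta> \<xi>)"
      unfolding h1_def h2_def Q1 energy_symbol_odd ..
    also have "\<dots> = (LINT \<xi>|lborel. LINT \<eta>|lborel. h2 \<xi> \<eta>)"
      by (rule lborel_pair.Fubini_integral[OF i2])
    finally show ?thesis .
  qed
  have J3: "J = (LINT \<xi>|lborel. LINT \<eta>|lborel. h3 \<xi> \<eta>)"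
  proof -
    have "J = (LINT \<eta>|lborel. LINT \<xi>|lborel. h1 \<xi> \<eta>)"
      unfolding J_def by (rule lborel_pair.Fubini_integral[OF i1, symmetric])
    also have "\<dots> = (LINT \<eta>|lborel. LINT \<xi>|lborel. h1 (\<eta> - \<xi>) \<eta>)"
    proof (rule Bochner_Integration.integral_cong[OF refl])
      fix \<eta> show "(LINT \<xi>|lborel. h1 \<xi> \<eta>) = (LINT \<xi>|lborel. h1 (\<eta> - \<xi>) \<eta>)"
        using lborel_integral_real_affine[of "-1" "\<lambda>\<xi>. h1 \<xi> \<eta>" \<eta>] by simp
    qed
    also have "\<dots> = (LINT \<eta>|lborel. LINT \<xi>|lborel. h3 \<xi> \<eta>)"
      unfolding h1_def h3_def Q2 energy_symbol_odd[symmetric] by simp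
    also have "\<dots> = (LINT \<xi>|lborel. LINT \<eta>|lborel. h3 \<xi> \<eta>)"
      by (rule lborel_pair.Fubini_integral[OF i3])
    finally show ?thesis .
  qed
  define M where "M \<xi> \<eta> = 2 / \<sigma> * (sinh (\<sigma> * \<xi>) * sinh (\<sigma> * \<eta>) * sinh (\<sigma> * (\<xi> - \<eta>)))" for \<xi> \<eta>
  have MS: "M \<xi> \<eta> = ?S \<xi> - ?S \<eta> - ?S (\<xi> - \<eta>)" for \<xi> \<eta>
    using sinh_sum_zero[of "\<sigma> * \<xi>" "\<sigma> * \<eta>"] s
    by (simp add: M_def energy_symbol_def field_simps)
  have "3 * J = J + J + J" by simp
  also have "\<dots> = (\<integral>z. case_prod h1 z + case_prod h2 z + case_prod h3 z \<partial>(lborel \<Otimes>\<^sub>M lborel))"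
    unfolding Bochner_Integration.integral_add[OF Bochner_Integration.integrable_add[OF i1 i2] i3] Bochner_Integration.integral_add[OF i1 i2]
      lborel_pair.integral_fst[OF i1, symmetric] lborel_pair.integral_fst[OF i2, symmetric] lborel_pair.integral_fst[OF i3, symmetric]
    unfolding J_def[symmetric] J2[symmetric] J3[symmetric] ..
  also have "\<dots> = (\<integral>z. (\<lambda>(\<xi>, \<eta>). complex_of_real (M \<xi> \<eta>) * Q \<xi> \<eta>) z \<partial>(lborel \<Otimes>\<^sub>M lborel))"
    by (rule Bochner_Integration.integral_cong) (auto simp: h1_def h2_def h3_def MS algebra_simps)
  finally have J: "3 * J = (\<integral>z. (\<lambda>(\<xi>, \<eta>). complex_of_real (M \<xi> \<eta>) * Q \<xi> \<eta>) z \<partial>(lborel \<Otimes>\<^sub>M lborel))" .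
  let ?k = "energy_kernel \<sigma>"
  have k0: "?k \<xi> \<ge> 0" for \<xi>
    using s bbm_inv_weight_pos[of \<sigma> \<xi>] by (simp add: energy_kernel_def)
  have Mm: "case_prod M \<in> borel_measurable (lborel \<Otimes>\<^sub>M lborel)" unfolding MS[abs_def] by measurable
  have Mk: "\<bar>M \<xi> \<eta>\<bar> * (?p \<xi> * ?p \<eta> * ?p (\<xi> - \<eta>)) \<le> ?k \<xi> + ?k \<eta> + ?k (\<xi> - \<eta>)" for \<xi> \<eta>
  proof -
    let ?r = "\<lambda>\<xi>. \<bar>sinh (\<sigma> * \<xi>)\<bar> * ?p \<xi>"
    have "\<bar>M \<xi> \<eta>\<bar> * (?p \<xi> * ?p \<eta> * ?p (\<xi> - \<eta>)) = 2 / (3 * \<sigma>) * (3 * (?r \<xi> * ?r \<eta> * ?r (\<xi> - \<eta>)))"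
      using s by (simp add: M_def abs_mult)
    also have "\<dots> \<le> 2 / (3 * \<sigma>) * (?r \<xi> ^ 3 + ?r \<eta> ^ 3 + ?r (\<xi> - \<eta>) ^ 3)"
      using s bbm_inv_weight_pos[of \<sigma>] by (intro mult_left_mono AM_GM_3) (auto simp: less_imp_le)
    also have "\<dots> = ?k \<xi> + ?k \<eta> + ?k (\<xi> - \<eta>)" by (simp add: energy_kernel_def algebra_simps)
    finally show ?thesis .
  qed
  note Mb = bound[OF energy_kernel_norm(1)[OF s] k0 energy_kernel_measurable Mm Mk]
  have "norm (3 * J) \<le> 3 * sqrt (LINT \<xi>|lborel. (?k \<xi>)\<^sup>2) * (l2n f * l2n f * l2n f)"
    unfolding J lborel_pair.integral_fst[OF Mb(1), symmetric] by (rule Mb(2))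
  then have "norm J \<le> sqrt (LINT \<xi>|lborel. (?k \<xi>)\<^sup>2) * l2n f ^ 3"
    by (simp add: norm_mult power3_eq_cube)
  also have "\<dots> \<le> (8 / 3 * sqrt (LINT x|lborel. 1 / (1 + x\<^sup>2)) * (\<sigma> * sqrt \<sigma>)) * l2n f ^ 3"
    by (intro mult_right_mono energy_kernel_norm(2)[OF s]) auto
  finally have Jle: "norm J \<le> 8 / 3 * sqrt (LINT x|lborel. 1 / (1 + x\<^sup>2)) * (\<sigma> * sqrt \<sigma>) * l2n f ^ 3" .
  \<comment> \<open>Writing f = q / p turns the 1 / p of \<open>bbm_product\<close> into 1 / p^2,
    and the conjugate of the symbol divided by p^2 is - i times
    \<open>energy_symbol\<close>.\<close>
  have pt: "f \<xi> * cnj (bbm_product ?p f f \<xi>) = - \<i> * (LINT \<eta>|lborel. h1 \<xi> \<eta>)" for \<xi>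
  proof -
    have c: "cnj (conv q q \<xi>) = (LINT \<eta>|lborel. cnj (q \<eta>) * cnj (q (\<xi> - \<eta>)))"
      unfolding conv_def complex_cnj_mult[symmetric] by (rule Bochner_Integration.integral_cnj[symmetric])
    have "(LINT \<eta>|lborel. h1 \<xi> \<eta>) = (LINT \<eta>|lborel. (complex_of_real (?S \<xi>) * q \<xi>) * (cnj (q \<eta>) * cnj (q (\<xi> - \<eta>))))"
      by (simp add: h1_def Q_def mult_ac)
    also have "\<dots> = complex_of_real (?S \<xi>) * q \<xi> * cnj (conv q q \<xi>)"
      unfolding c by (rule integral_mult_right_zero)
    also have "complex_of_real (?S \<xi>) * q \<xi> = complex_of_real (?S \<xi> * ?p \<xi>) * f \<xi>"
      by (simp add: q_def weighted_def)
    finally have h: "(LINT \<eta>|lborel. h1 \<xi> \<eta>) = complex_of_real (\<xi> / (1 + \<xi>\<^sup>2) / ?p \<xi>) * f \<xi> * cnj (conv q q \<xi>)"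
      unfolding energy_symbol_weight[OF s] .
    show ?thesis unfolding h bbm_product_def q_def[symmetric] bbm_symbol_def
      by (simp del: of_real_add)
  qed
  have "inner x (bbm_bilinear ?p x x) = (LINT \<xi>|lborel. Re (f \<xi> * cnj (bbm_product ?p f f \<xi>)))"
    unfolding f(2) W.bbm_bilinear_mk[OF f(1) f(1)] by (rule inner_mk[OF f(1) W.bbm_product_hermL2[OF f(1) f(1)]])
  also have "\<dots> = Re (LINT \<xi>|lborel. f \<xi> * cnj (bbm_product ?p f f \<xi>))"
    by (intro integral_Re L2_mult_integrable fL L2_cnj W.bbm_product_norm(1))
  also have "(LINT \<xi>|lborel. f \<xi> * cnj (bbm_product ?p f f \<xi>)) = - \<i> * J"
    unfolding pt J_def by (rule integral_mult_right_zero)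
  finally have "\<bar>inner x (bbm_bilinear ?p x x)\<bar> \<le> norm J"
    using abs_Re_le_cmod[of "- \<i> * J"] by (simp add: norm_mult)
  then show ?thesis using Jle by (simp add: f(2) norm_mk[OF f(1)])
qed

definition energy_const :: real where
  "energy_const = 1 / (4 * pi) * (8 / 3 * sqrt (LINT x|lborel. 1 / (1 + x\<^sup>2)))"

lemma energy_const_nonneg: "energy_const \<ge> 0"
  by (simp add: energy_const_def)

lemma energy_estimate:
  assumes s: "\<sigma> > 0"
  shows "inner x (bbm_field (bbm_inv_weight \<sigma>) x) \<le> energy_const * (\<sigma> * sqrt \<sigma>) * norm x ^ 3"
proof -
  interpret W: bbm_weight "bbm_inv_weight \<sigma>" "bbm_kernel_bound \<sigma>" by (rule bbm_weight_inv_weight[OF s])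
  have "inner x (bbm_field (bbm_inv_weight \<sigma>) x) \<le> 1 / (4 * pi) * \<bar>inner x (bbm_bilinear (bbm_inv_weight \<sigma>) x x)\<bar>"
    unfolding W.inner_bbm_field by (simp add: field_simps)
  also have "\<dots> \<le> 1 / (4 * pi) * (8 / 3 * sqrt (LINT x|lborel. 1 / (1 + x\<^sup>2)) * (\<sigma> * sqrt \<sigma>) * norm x ^ 3)"
    by (intro mult_left_mono inner_bbm_bilinear_le s) auto
  finally show ?thesis by (simp only: energy_const_def mult.assoc)
qed

section \<open>Analytic solutions\<close>

text \<open>Restates the derivative through the quotient used in
  \<open>has_gevrey_derivative\<close>; under the norm, division by s - t and by |s - t| are the
  same.\<close>

lemma has_vector_derivative_difference_quotient:
  assumes "(f has_vector_derivative D) (at t within S)"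
  shows "((\<lambda>s. norm (inverse (s - t) *\<^sub>R (f s - f t) - D)) \<longlongrightarrow> 0) (at t within S)"
proof -
  have "((\<lambda>s. (1 / norm (s - t)) *\<^sub>R (f s - (f t + (s - t) *\<^sub>R D))) \<longlongrightarrow> 0) (at t within S)"
    using assms unfolding has_vector_derivative_def has_derivative_within by blast
  then have "((\<lambda>s. norm ((1 / norm (s - t)) *\<^sub>R (f s - (f t + (s - t) *\<^sub>R D)))) \<longlongrightarrow> 0) (at t within S)"
    by (rule tendsto_norm_zero)
  moreover have "\<forall>\<^sub>F s in at t within S. norm ((1 / norm (s - t)) *\<^sub>R (f s - (f t + (s - t) *\<^sub>R D))) = norm (inverse (s - t) *\<^sub>R (f s - f t) - D)"
  proof -
    have "norm ((1 / norm (s - t)) *\<^sub>R (f s - (f t + (s - t) *\<^sub>R D))) = norm (inverse (s - t) *\<^sub>R (f s - f t) - D)"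
      if "s \<noteq> t" for s
    proof -
      have "inverse (s - t) *\<^sub>R (f s - f t) - D = inverse (s - t) *\<^sub>R (f s - (f t + (s - t) *\<^sub>R D))"
        using that by (simp add: scaleR_diff_right scaleR_add_right)
      then show ?thesis by (simp add: inverse_eq_divide)
    qed
    then show ?thesis by (auto simp: eventually_at_filter)
  qed
  ultimately show ?thesis by (rule Lim_transform_eventually)
qed

section \<open>From the Fourier side back to the Gevrey spaces\<close>

lemma integrable_exp_abs:
  fixes \<sigma> :: real
  assumes s: "\<sigma> > 0" shows "integrable lborel (\<lambda>\<xi>. exp (- 2 * \<sigma> * \<bar>\<xi>\<bar>))"
proof (rule Bochner_Integration.integrable_bound)
  show "integrable lborel (\<lambda>\<xi>. 2 * (1 / (1 + (0 + 2 * \<sigma> * \<xi>)\<^sup>2)))"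
    using s by (intro integrable_mult_right lborel_integrable_real_affine integrable_inverse_1_plus_square_lborel) simp
  have "exp (- 2 * \<sigma> * \<bar>\<xi>\<bar>) \<le> 2 * (1 / (1 + (0 + 2 * \<sigma> * \<xi>)\<^sup>2))" for \<xi>
  proof -
    define y where "y = 2 * \<sigma> * \<bar>\<xi>\<bar>"
    have y: "y \<ge> 0" using s by (simp add: y_def)
    have "1 + y\<^sup>2 \<le> 2 * exp y" using exp_lower_Taylor_quadratic[OF y] y by (simp add: field_simps)
    then have "exp (- y) * (1 + y\<^sup>2) \<le> exp (- y) * (2 * exp y)" by (rule mult_left_mono) simp
    also have "\<dots> = 2" by (simp add: exp_minus)
    finally have "exp (- y) \<le> 2 / (1 + y\<^sup>2)"
      using one_plus_square_pos[of y] by (simp add: pos_le_divide_eq)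
    then show ?thesis by (simp add: y_def power_mult_distrib)
  qed
  then show "AE \<xi> in lborel. norm (exp (- 2 * \<sigma> * \<bar>\<xi>\<bar>)) \<le> norm (2 * (1 / (1 + (0 + 2 * \<sigma> * \<xi>)\<^sup>2)))"
    by (intro AE_I2) (auto intro: order_trans[OF _ abs_ge_self])
qed simp

text \<open>\<open>w\<close> is the product of exp (- \<sigma> |\<xi>|) and exp (\<sigma> |\<xi>|)
  w, two square integrable functions. Integrable transforms make the inversion formula and the
  convolution theorem available pointwise.\<close>

lemma gevrey_weight_integrable:
  fixes w :: "real \<Rightarrow> complex"
  assumes s: "\<sigma> > 0" and [measurable]: "w \<in> borel_measurable borel"
    and w: "integrable lborel (\<lambda>\<xi>. exp (2 * \<sigma> * \<bar>\<xi>\<bar>) * (norm (w \<xi>))\<^sup>2)"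
  shows "integrable lborel w"
proof (rule Bochner_Integration.integrable_bound)
  show "integrable lborel (\<lambda>\<xi>. exp (- 2 * \<sigma> * \<bar>\<xi>\<bar>) + exp (2 * \<sigma> * \<bar>\<xi>\<bar>) * (norm (w \<xi>))\<^sup>2)"
    by (intro Bochner_Integration.integrable_add integrable_exp_abs s w)
  have "norm (w \<xi>) \<le> exp (- 2 * \<sigma> * \<bar>\<xi>\<bar>) + exp (2 * \<sigma> * \<bar>\<xi>\<bar>) * (norm (w \<xi>))\<^sup>2" for \<xi>
  proof -
    define a b where "a = exp (- \<sigma> * \<bar>\<xi>\<bar>)" and "b = exp (\<sigma> * \<bar>\<xi>\<bar>) * norm (w \<xi>)"
    have ab: "a * b = norm (w \<xi>)" by (simp add: a_def b_def exp_minus)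
    have a2: "a\<^sup>2 = exp (- 2 * \<sigma> * \<bar>\<xi>\<bar>)" by (simp add: a_def exp_double[symmetric] mult_ac)
    have b2: "b\<^sup>2 = exp (2 * \<sigma> * \<bar>\<xi>\<bar>) * (norm (w \<xi>))\<^sup>2" by (simp add: b_def power_mult_distrib exp_double[symmetric] mult_ac)
    have "0 \<le> a * b" by (simp add: a_def b_def)
    then have "a * b \<le> a\<^sup>2 + b\<^sup>2" using sum_squares_bound[of a b] by (simp add: mult.assoc)
    then show ?thesis unfolding ab a2 b2 .
  qed
  then show "AE \<xi> in lborel. norm (w \<xi>) \<le> norm (exp (- 2 * \<sigma> * \<bar>\<xi>\<bar>) + exp (2 * \<sigma> * \<bar>\<xi>\<bar>) * (norm (w \<xi>))\<^sup>2)"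
    by (intro AE_I2) (auto intro: order_trans[OF _ abs_ge_self])
qed simp

lemma gevrey_IFT:
  assumes s: "\<sigma> > 0" and wL: "w \<in> L2"
    and w: "integrable lborel (\<lambda>\<xi>. exp (2 * \<sigma> * \<bar>\<xi>\<bar>) * (norm (w \<xi>))\<^sup>2)"
  shows "IFT w \<in> gevrey \<sigma>"
    and "gevrey_norm \<sigma> (IFT w) = sqrt (LINT \<xi>|lborel. exp (2 * \<sigma> * \<bar>\<xi>\<bar>) * (norm (w \<xi>))\<^sup>2)"
proof -
  note [measurable] = L2_measurable[OF wL]
  have w1: "integrable lborel w" by (rule gevrey_weight_integrable[OF s _ w]) simp
  have hf: "has_fourier (IFT w) w" by (rule has_fourier_IFT[OF w1 wL])
  have uL: "IFT w \<in> L2" using hf by (simp add: has_fourier_iff)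
  have "fourier (IFT w) \<in> L2" using has_fourier_fourier[OF uL] by (simp add: has_fourier_iff)
  note [measurable] = L2_measurable[OF this]
  have ae: "AE \<xi> in lborel. exp (2 * \<sigma> * \<bar>\<xi>\<bar>) * (norm (w \<xi>))\<^sup>2 = exp (2 * \<sigma> * \<bar>\<xi>\<bar>) * (norm (fourier (IFT w) \<xi>))\<^sup>2"
    using fourier_AE_eq[OF hf] by eventually_elim simp
  have "integrable lborel (\<lambda>\<xi>. exp (2 * \<sigma> * \<bar>\<xi>\<bar>) * (norm (fourier (IFT w) \<xi>))\<^sup>2)"
    by (rule integrable_cong_AE_imp[OF w _ ae]) simp
  then show "IFT w \<in> gevrey \<sigma>" using uL by (simp add: gevrey_def)
  show "gevrey_norm \<sigma> (IFT w) = sqrt (LINT \<xi>|lborel. exp (2 * \<sigma> * \<bar>\<xi>\<bar>) * (norm (w \<xi>))\<^sup>2)"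
    unfolding gevrey_norm_def
    by (intro arg_cong[where f=sqrt] integral_cong_AE) (use ae in auto)
qed

text \<open>Meaningful when \<open>rep x\<close> is integrable, as it is on the range of
  \<open>unweight (bbm_inv_weight \<sigma>)\<close> for \<sigma> > 0.\<close>

definition physical :: "hl2 \<Rightarrow> real \<Rightarrow> complex" where
  "physical x = IFT (rep x)"

lemma physical_real: "real_valued (physical x)"
proof -
  have "cnj (physical x t) = physical x t" for t
  proof -
    have "cnj (FT (rep x) (- t)) = (LINT \<xi>|lborel. exp (\<i> * complex_of_real (0 + (-1) * \<xi>) * complex_of_real (- t)) * cnj (rep x (0 + (-1) * \<xi>)))"
      unfolding FT_cnj by (subst lborel_integral_real_affine[of "-1" _ 0]) auto
    also have "\<dots> = FT (rep x) (- t)"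
      using hermL2_reflect[OF rep_herm[of x]] by (simp add: FT_def)
    finally show ?thesis by (simp add: physical_def IFT_def)
  qed
  then have "physical x t \<in> \<real>" for t by (simp only: Reals_cnj_iff)
  then show ?thesis by (simp add: real_valued_def)
qed

lemma physical_diff:
  assumes "integrable lborel (rep x)" "integrable lborel (rep y)"
  shows "physical (x - y) t = physical x t - physical y t"
proof -
  have "FT (rep (x - y)) = FT (\<lambda>\<xi>. rep x \<xi> - rep y \<xi>)"
    by (rule FT_cong_AE) (use rep_diff in auto)
  then show ?thesis using assms by (simp add: physical_def IFT_def FT_diff diff_divide_distrib)
qed

lemma physical_scaleR: "physical (c *\<^sub>R x) t = complex_of_real c * physical x t"
proof -
  have "FT (rep (c *\<^sub>R x)) = FT (\<lambda>\<xi>. complex_of_real c * rep x \<xi>)"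
    by (rule FT_cong_AE) (use rep_scaleR in auto)
  then show ?thesis by (simp add: physical_def IFT_def FT_cmult)
qed

text \<open>No width is lost: exp (2 \<sigma> |\<xi>|) p^2 is at most 2 (1 + 2 \<sigma> |\<xi>|) /
  (1 + \<xi>^2). The numerator is the loss of \<open>sinhc\<close> against the exponential, and the
  Sobolev factor 1 + \<xi>^2 of the weight absorbs it.\<close>

lemma unweight_gevrey:
  fixes x :: hl2
  assumes s: "\<sigma> > 0"
  defines "w \<equiv> rep (unweight (bbm_inv_weight \<sigma>) x)"
  shows "integrable lborel w"
    and "physical (unweight (bbm_inv_weight \<sigma>) x) \<in> gevrey \<sigma>"
    and "gevrey_norm \<sigma> (physical (unweight (bbm_inv_weight \<sigma>) x)) \<le> sqrt (2 * (1 + 2 * \<sigma>)) * norm x"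
proof -
  interpret W: bbm_weight "bbm_inv_weight \<sigma>" "bbm_kernel_bound \<sigma>" by (rule bbm_weight_inv_weight[OF s])
  have wL: "w \<in> L2" by (simp add: w_def)
  note [measurable] = L2_measurable[OF wL]
  have le: "AE \<xi> in lborel. exp (2 * \<sigma> * \<bar>\<xi>\<bar>) * (norm (w \<xi>))\<^sup>2 \<le> 2 * (1 + 2 * \<sigma>) * (norm (rep x \<xi>))\<^sup>2"
    using W.rep_unweight[of x]
  proof eventually_elim
    case (elim \<xi>)
    let ?y = "2 * \<sigma> * \<bar>\<xi>\<bar>"
    have y: "\<bar>2 * \<sigma> * \<xi>\<bar> = ?y" using s by (simp add: abs_mult)
    have "exp ?y * (bbm_inv_weight \<sigma> \<xi>)\<^sup>2 \<le> exp ?y * (2 * (1 + ?y) * exp (- ?y) / (1 + \<xi>\<^sup>2))"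
      using bbm_inv_weight_square_le[of \<sigma> \<xi>] unfolding y by (rule mult_left_mono) simp
    also have "\<dots> = 2 * (1 + ?y) / (1 + \<xi>\<^sup>2)" by (simp add: exp_minus)
    also have "\<dots> \<le> 2 * (1 + 2 * \<sigma>)"
    proof -
      have "\<bar>\<xi>\<bar> \<le> 1 + \<xi>\<^sup>2" using sum_squares_bound[of 1 "\<bar>\<xi>\<bar>"] by (simp add: power2_eq_square)
      then have "\<sigma> * \<bar>\<xi>\<bar> \<le> \<sigma> * (1 + \<xi>\<^sup>2)" using s by (intro mult_left_mono) auto
      moreover have "2 * (1 + 2 * \<sigma>) * (1 + \<xi>\<^sup>2) = 2 + 2 * \<xi>\<^sup>2 + 4 * (\<sigma> * (1 + \<xi>\<^sup>2))" by (simp add: algebra_simps)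
      moreover have "2 * (1 + ?y) = 2 + 4 * (\<sigma> * \<bar>\<xi>\<bar>)" by simp
      ultimately have "2 * (1 + ?y) \<le> 2 * (1 + 2 * \<sigma>) * (1 + \<xi>\<^sup>2)" using zero_le_power2[of \<xi>] by linarith
      then show ?thesis using one_plus_square_pos[of \<xi>] by (simp add: pos_divide_le_eq)
    qed
    finally have "exp ?y * (bbm_inv_weight \<sigma> \<xi>)\<^sup>2 * (norm (rep x \<xi>))\<^sup>2 \<le> 2 * (1 + 2 * \<sigma>) * (norm (rep x \<xi>))\<^sup>2"
      by (rule mult_right_mono) simp
    then show ?case by (simp add: w_def elim norm_mult power_mult_distrib mult.assoc)
  qed
  have i: "integrable lborel (\<lambda>\<xi>. 2 * (1 + 2 * \<sigma>) * (norm (rep x \<xi>))\<^sup>2)"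
    by (intro integrable_mult_right L2_integrable rep_L2)
  have int: "integrable lborel (\<lambda>\<xi>. exp (2 * \<sigma> * \<bar>\<xi>\<bar>) * (norm (w \<xi>))\<^sup>2)"
    by (rule Bochner_Integration.integrable_bound[OF i]) (use le in \<open>auto elim!: eventually_mono intro: order_trans[OF _ abs_ge_self]\<close>)
  show "integrable lborel w" by (rule gevrey_weight_integrable[OF s _ int]) simp
  show "physical (unweight (bbm_inv_weight \<sigma>) x) \<in> gevrey \<sigma>"
    unfolding physical_def w_def[symmetric] by (rule gevrey_IFT(1)[OF s wL int])
  have "(LINT \<xi>|lborel. exp (2 * \<sigma> * \<bar>\<xi>\<bar>) * (norm (w \<xi>))\<^sup>2) \<le> (LINT \<xi>|lborel. 2 * (1 + 2 * \<sigma>) * (norm (rep x \<xi>))\<^sup>2)"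
    by (rule integral_mono_AE[OF int i le])
  also have "\<dots> = 2 * (1 + 2 * \<sigma>) * (norm x)\<^sup>2" by (simp add: norm_rep l2n_square)
  finally have "sqrt (LINT \<xi>|lborel. exp (2 * \<sigma> * \<bar>\<xi>\<bar>) * (norm (w \<xi>))\<^sup>2) \<le> sqrt (2 * (1 + 2 * \<sigma>) * (norm x)\<^sup>2)"
    by (rule real_sqrt_le_mono)
  then show "gevrey_norm \<sigma> (physical (unweight (bbm_inv_weight \<sigma>) x)) \<le> sqrt (2 * (1 + 2 * \<sigma>)) * norm x"
    unfolding physical_def w_def[symmetric] gevrey_IFT(2)[OF s wL int] by (simp add: real_sqrt_mult)
qed

text \<open>Since the transform w is integrable, the square of the solution is, at every point, the
  inverse transform of conv w w / (2 pi). Exceptional null sets come only from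
  \<open>phi_D\<close>.\<close>

lemma bbm_field_physical:
  fixes z :: hl2
  assumes w1: "integrable lborel (rep z)"
  shows "AE x in lborel. physical (bbm_field (\<lambda>_. 1) z) x + phi_D (physical z) x + 1 / 2 * phi_D (\<lambda>y. (physical z y)\<^sup>2) x = 0"
proof -
  define w where "w = rep z"
  have w: "integrable lborel w" "w \<in> hermL2" "w \<in> L2" using w1 by (simp_all add: w_def)
  note [measurable] = L2_measurable[OF w(3)]
  define c where "c = (\<lambda>\<xi>. conv w w \<xi> / complex_of_real (2 * pi))"
  have cw: "c = (\<lambda>\<xi>. (1 / complex_of_real (2 * pi)) * conv w w \<xi>)" by (simp add: c_def)
  have c1: "integrable lborel c" unfolding cw by (intro integrable_mult_right conv_integrable w)
  have c2: "c \<in> L2" unfolding cw by (intro L2_cmult conv_L2 w)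
  have sq: "(\<lambda>y. (physical z y)\<^sup>2) = IFT c"
    by (simp add: fun_eq_iff physical_def power2_eq_square IFT_mult[OF w1 w1] c_def w_def)
  have A: "AE x in lborel. phi_D (physical z) x = IFT (\<lambda>\<xi>. bbm_symbol \<xi> * w \<xi>) x"
    unfolding physical_def w_def[symmetric] by (rule phi_D_AE_eq[OF has_fourier_IFT[OF w(1,3)] w(1)])
  have B: "AE x in lborel. phi_D (\<lambda>y. (physical z y)\<^sup>2) x = IFT (\<lambda>\<xi>. bbm_symbol \<xi> * c \<xi>) x"
    unfolding sq by (rule phi_D_AE_eq[OF has_fourier_IFT[OF c1 c2] c1])
  have "bbm_field (\<lambda>_. 1) z = mk (\<lambda>\<xi>. - (bbm_symbol \<xi> * w \<xi>) - complex_of_real (1 / (4 * pi)) * bbm_product (\<lambda>_. 1) w w \<xi>)"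
    using unweighted.bbm_field_mk(1)[OF w(2)] by (simp add: w_def)
  also have "(\<lambda>\<xi>. - (bbm_symbol \<xi> * w \<xi>) - complex_of_real (1 / (4 * pi)) * bbm_product (\<lambda>_. 1) w w \<xi>)
    = (\<lambda>\<xi>. (-1) * (bbm_symbol \<xi> * w \<xi>) + (- (1 / 2)) * (bbm_symbol \<xi> * c \<xi>))" (is "_ = ?G")
  proof -
    have "weighted (\<lambda>_. 1) h = h" for h by (simp add: weighted_def fun_eq_iff)
    then show ?thesis by (intro ext) (simp add: bbm_product_def c_def field_simps)
  qed
  finally have F: "bbm_field (\<lambda>_. 1) z = mk ?G" .
  have "?G \<in> hermL2"
    using unweighted.bbm_field_mk(2)[OF w(2)]
    by (simp add: bbm_product_def weighted_def[abs_def] c_def field_simps)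
  then have ae: "AE \<xi> in lborel. rep (bbm_field (\<lambda>_. 1) z) \<xi> = ?G \<xi>" unfolding F by (rule rep_mk)
  have [measurable]: "c \<in> borel_measurable borel" using c2 by (rule L2_measurable)
  have "FT (rep (bbm_field (\<lambda>_. 1) z)) = FT ?G" by (rule FT_cong_AE) (use ae in auto)
  also have "FT ?G = (\<lambda>t. (-1) * FT (\<lambda>\<xi>. bbm_symbol \<xi> * w \<xi>) t + (- (1 / 2)) * FT (\<lambda>\<xi>. bbm_symbol \<xi> * c \<xi>) t)"
    unfolding FT_cmult[symmetric]
    by (intro ext FT_add integrable_mult_right bbm_symbol_mult_integrable w c1)
  finally have P: "physical (bbm_field (\<lambda>_. 1) z) x = - IFT (\<lambda>\<xi>. bbm_symbol \<xi> * w \<xi>) x - 1 / 2 * IFT (\<lambda>\<xi>. bbm_symbol \<xi> * c \<xi>) x" for x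
    by (simp add: physical_def IFT_def diff_divide_distrib)
  show ?thesis using A B by eventually_elim (simp add: P)
qed

text \<open>Of exp (2 \<sigma>_0 |\<xi>|), one half controls
  \<open>sinhc (2 * \<sigma> * \<xi>)\<close> because
  \<open>2 * \<sigma> \<le> \<sigma>\<^sub>0\<close>, and the other half controls 1 + \<xi>^2. The
  constant does not depend on \<sigma>, so a single radius will serve all end times.\<close>

lemma initial_data:
  assumes s0: "\<sigma>\<^sub>0 > 0" and u0: "u0 \<in> gevrey \<sigma>\<^sub>0" and re: "real_valued u0"
  obtains g where "g \<in> hermL2" "AE x in lborel. physical (mk g) x = u0 x"
    "\<And>\<sigma>. 0 < \<sigma> \<Longrightarrow> \<sigma> \<le> \<sigma>\<^sub>0 / 2 \<Longrightarrow> \<exists>v. unweight (bbm_inv_weight \<sigma>) v = mk g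
      \<and> norm v \<le> sqrt (2 * (1 + 2 / \<sigma>\<^sub>0\<^sup>2)) * gevrey_norm \<sigma>\<^sub>0 u0"
proof -
  have uL: "u0 \<in> L2" using u0 by (simp add: gevrey_def)
  let ?f = "fourier u0"
  have hf: "has_fourier u0 ?f" by (rule has_fourier_fourier[OF uL])
  then have fL: "?f \<in> L2" by (simp add: has_fourier_iff)
  note [measurable] = L2_measurable[OF uL] L2_measurable[OF fL]
  \<comment> \<open>For real-valued data the chosen transform is Hermitian almost everywhere.
    Symmetrizing changes it on a null set only and makes the symmetry hold at every point.\<close>
  define g where "g = symmetrize ?f"
  have g: "g \<in> hermL2" unfolding g_def by (rule symmetrize_herm[OF fL])
  note [measurable] = hermL2_measurable[OF g]
  have "AE x in lborel. u0 x = cnj (u0 x)"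
    using re unfolding real_valued_def by (auto simp: Reals_cnj_iff elim!: eventually_mono)
  then have "AE \<xi> in lborel. ?f \<xi> = cnj (?f (- \<xi>))"
    using has_fourier_unique[OF hf has_fourier_cnj[OF hf]] by simp
  then have gf: "AE \<xi> in lborel. g \<xi> = ?f \<xi>"
  proof eventually_elim
    case (elim \<xi>)
    then show ?case unfolding g_def symmetrize_def elim[symmetric] by simp
  qed
  have iu: "integrable lborel (\<lambda>\<xi>. exp (2 * \<sigma>\<^sub>0 * \<bar>\<xi>\<bar>) * (norm (?f \<xi>))\<^sup>2)" using u0 by (simp add: gevrey_def)
  have ig: "integrable lborel (\<lambda>\<xi>. exp (2 * \<sigma>\<^sub>0 * \<bar>\<xi>\<bar>) * (norm (g \<xi>))\<^sup>2)"
    by (rule integrable_cong_AE_imp[OF iu]) (use gf in auto)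
  have ng: "gevrey_norm \<sigma>\<^sub>0 u0 = sqrt (LINT \<xi>|lborel. exp (2 * \<sigma>\<^sub>0 * \<bar>\<xi>\<bar>) * (norm (g \<xi>))\<^sup>2)"
    unfolding gevrey_norm_def by (intro arg_cong[where f=sqrt] integral_cong_AE) (use gf in auto)
  have g1: "integrable lborel g" by (rule gevrey_weight_integrable[OF s0 _ ig]) simp
  have rg: "AE \<xi> in lborel. rep (mk g) \<xi> = g \<xi>" by (rule rep_mk[OF g])
  have phg: "physical (mk g) = IFT g"
    using FT_cong_AE[OF rep_measurable hermL2_measurable[OF g] rg] by (simp add: physical_def IFT_def fun_eq_iff)
  have "AE x in lborel. IFT g x = u0 x"
    using has_fourier_unique[OF has_fourier_IFT[OF g1 hermL2_L2[OF g]] hf] gf by simp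
  then have 2: "AE x in lborel. physical (mk g) x = u0 x" by (simp add: phg)
  have 3: "\<exists>v. unweight (bbm_inv_weight \<sigma>) v = mk g \<and> norm v \<le> sqrt (2 * (1 + 2 / \<sigma>\<^sub>0\<^sup>2)) * gevrey_norm \<sigma>\<^sub>0 u0"
    if s: "0 < \<sigma>" "\<sigma> \<le> \<sigma>\<^sub>0 / 2" for \<sigma>
  proof -
    interpret W: bbm_weight "bbm_inv_weight \<sigma>" "bbm_kernel_bound \<sigma>" by (rule bbm_weight_inv_weight[OF s(1)])
    let ?p = "bbm_inv_weight \<sigma>"
    define h where "h \<xi> = g \<xi> / complex_of_real (?p \<xi>)" for \<xi>
    have [measurable]: "h \<in> borel_measurable borel" unfolding h_def[abs_def] by measurable
    have le: "(norm (h \<xi>))\<^sup>2 \<le> 2 * (1 + 2 / \<sigma>\<^sub>0\<^sup>2) * (exp (2 * \<sigma>\<^sub>0 * \<bar>\<xi>\<bar>) * (norm (g \<xi>))\<^sup>2)" for \<xi>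
    proof -
      define y where "y = \<sigma>\<^sub>0 * \<bar>\<xi>\<bar>"
      have y: "y \<ge> 0" using s0 by (simp add: y_def)
      have sc0: "sinhc (2 * \<sigma> * \<xi>) \<ge> 0" using sinhc_ge_1[of "2 * \<sigma> * \<xi>"] by linarith
      have "sinhc (2 * \<sigma> * \<xi>) \<le> (1 + \<bar>2 * \<sigma> * \<xi>\<bar>) * sinhc (2 * \<sigma> * \<xi>)"
        using mult_right_mono[of 1 "1 + \<bar>2 * \<sigma> * \<xi>\<bar>", OF _ sc0] by simp
      also have "\<dots> \<le> 2 * exp \<bar>2 * \<sigma> * \<xi>\<bar>" by (rule sinhc_le_exp)
      also have "\<dots> \<le> 2 * exp y"
        using s mult_right_mono[of "2 * \<sigma>" "\<sigma>\<^sub>0" "\<bar>\<xi>\<bar>"] by (simp add: y_def abs_mult)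
      finally have sc: "sinhc (2 * \<sigma> * \<xi>) \<le> 2 * exp y" .
      have "y\<^sup>2 \<le> 2 * exp y" "1 \<le> exp y" using exp_lower_Taylor_quadratic[OF y] y by (auto simp: field_simps)
      then have "\<sigma>\<^sub>0\<^sup>2 * \<xi>\<^sup>2 \<le> 2 * exp y" by (simp add: y_def power_mult_distrib)
      then have "\<xi>\<^sup>2 \<le> 2 * exp y / \<sigma>\<^sub>0\<^sup>2" using s0 by (simp add: pos_le_divide_eq mult.commute)
      moreover have "(1 + 2 / \<sigma>\<^sub>0\<^sup>2) * exp y = exp y + 2 * exp y / \<sigma>\<^sub>0\<^sup>2" by (simp add: distrib_right)
      ultimately have x2: "1 + \<xi>\<^sup>2 \<le> (1 + 2 / \<sigma>\<^sub>0\<^sup>2) * exp y" using \<open>1 \<le> exp y\<close> by linarith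
      have "(1 + \<xi>\<^sup>2) * sinhc (2 * \<sigma> * \<xi>) \<le> ((1 + 2 / \<sigma>\<^sub>0\<^sup>2) * exp y) * (2 * exp y)"
        by (intro mult_mono x2 sc sc0) auto
      also have "\<dots> = 2 * (1 + 2 / \<sigma>\<^sub>0\<^sup>2) * exp (2 * \<sigma>\<^sub>0 * \<bar>\<xi>\<bar>)"
        by (simp add: y_def exp_double power2_eq_square mult.assoc)
      finally have w: "(1 + \<xi>\<^sup>2) * sinhc (2 * \<sigma> * \<xi>) \<le> 2 * (1 + 2 / \<sigma>\<^sub>0\<^sup>2) * exp (2 * \<sigma>\<^sub>0 * \<bar>\<xi>\<bar>)" .
      have "(norm (h \<xi>))\<^sup>2 = (norm (g \<xi>))\<^sup>2 / (?p \<xi>)\<^sup>2" by (simp add: h_def norm_divide power_divide)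
      also have "\<dots> = (1 + \<xi>\<^sup>2) * sinhc (2 * \<sigma> * \<xi>) * (norm (g \<xi>))\<^sup>2" by (simp add: bbm_inv_weight_square)
      also have "\<dots> \<le> 2 * (1 + 2 / \<sigma>\<^sub>0\<^sup>2) * exp (2 * \<sigma>\<^sub>0 * \<bar>\<xi>\<bar>) * (norm (g \<xi>))\<^sup>2"
        by (rule mult_right_mono[OF w]) simp
      finally show ?thesis by (simp only: mult.assoc)
    qed
    have i: "integrable lborel (\<lambda>\<xi>. 2 * (1 + 2 / \<sigma>\<^sub>0\<^sup>2) * (exp (2 * \<sigma>\<^sub>0 * \<bar>\<xi>\<bar>) * (norm (g \<xi>))\<^sup>2))"
      by (rule integrable_mult_right[OF ig])
    have ih: "integrable lborel (\<lambda>\<xi>. (norm (h \<xi>))\<^sup>2)"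
      by (rule Bochner_Integration.integrable_bound[OF i]) (use le in \<open>auto intro!: AE_I2 order_trans[OF _ abs_ge_self]\<close>)
    have hh: "h \<in> hermL2"
      using ih hermL2_reflect[OF g] by (simp add: hermL2_def L2_def h_def W.p_even)
    have "unweight ?p (mk h) = mk (\<lambda>\<xi>. complex_of_real (?p \<xi>) * h \<xi>)" by (rule W.unweight_mk[OF hh])
    also have "(\<lambda>\<xi>. complex_of_real (?p \<xi>) * h \<xi>) = g"
      using less_imp_neq[OF bbm_inv_weight_pos[of \<sigma>]] by (auto simp: h_def fun_eq_iff)
    finally have 1: "unweight ?p (mk h) = mk g" .
    have "(LINT \<xi>|lborel. (norm (h \<xi>))\<^sup>2) \<le> (LINT \<xi>|lborel. 2 * (1 + 2 / \<sigma>\<^sub>0\<^sup>2) * (exp (2 * \<sigma>\<^sub>0 * \<bar>\<xi>\<bar>) * (norm (g \<xi>))\<^sup>2))"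
      by (rule integral_mono[OF ih i le])
    also have "\<dots> = 2 * (1 + 2 / \<sigma>\<^sub>0\<^sup>2) * (LINT \<xi>|lborel. exp (2 * \<sigma>\<^sub>0 * \<bar>\<xi>\<bar>) * (norm (g \<xi>))\<^sup>2)"
      by (rule integral_mult_right_zero)
    finally have "norm (mk h) \<le> sqrt (2 * (1 + 2 / \<sigma>\<^sub>0\<^sup>2)) * gevrey_norm \<sigma>\<^sub>0 u0"
      unfolding norm_mk[OF hh] l2n_def ng real_sqrt_mult[symmetric] by (rule real_sqrt_le_mono)
    with 1 show ?thesis by blast
  qed
  from g 2 3 show ?thesis by (rule that)
qed

text \<open>Quantifying \<open>c\<close> before \<open>u0\<close>, when only the value
  \<open>r\<close> of its norm is fixed, expresses that the constant depends on nothing but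
  \<open>\<sigma>\<^sub>0\<close> and the norm.\<close>

theorem theorem1p1:
  fixes \<sigma>\<^sub>0 r :: real
  assumes "\<sigma>\<^sub>0 > 0"
  shows "\<exists>c>0. \<forall>u0 :: real \<Rightarrow> complex.
    u0 \<in> gevrey \<sigma>\<^sub>0 \<and> real_valued u0 \<and> gevrey_norm \<sigma>\<^sub>0 u0 = r \<longrightarrow>
    (\<exists>(\<sigma> :: real \<Rightarrow> real) (u :: real \<Rightarrow> real \<Rightarrow> complex).
      (\<forall>t\<ge>0. \<sigma> t > 0) \<and> antimono_on {0..} \<sigma> \<and>
      C_gevrey \<sigma> u \<and> (\<forall>t\<ge>0. real_valued (u t)) \<and> BBM_solution \<sigma> u0 u \<and>
      (\<forall>\<^sub>F t in at_top. \<sigma> t \<ge> c * t powr (- (2 / 3))))"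
proof -
  let ?M = "sqrt (2 * (1 + 2 / \<sigma>\<^sub>0\<^sup>2))"
  \<comment> \<open>The radius for \<open>ODE_exists\<close>: three times a bound for the weighted
    initial norm at every width in use. The absolute value and the added 1 keep it positive for
    every real \<open>r\<close>, including 0.\<close>
  define R where "R = 3 * (?M * \<bar>r\<bar> + 1)"
  have Rp: "R > 0" unfolding R_def by (intro mult_pos_pos add_nonneg_pos mult_nonneg_nonneg) auto
  \<comment> \<open>From c <= d <= 1 follows c sqrt c <= d, and energy_const R d <= 1: this is the
    time condition of \<open>ODE_exists\<close> for T = 1. The other constraint on \<open>c\<close>
    is the range of widths in \<open>initial_data\<close>.\<close>
  define d where "d = min 1 (1 / (energy_const * R + 1))"
  have KR: "energy_const * R \<ge> 0" using energy_const_nonneg Rp by simp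
  have d0: "d > 0" "d \<le> 1" using KR by (auto simp: d_def add_nonneg_pos)
  define c where "c = min (\<sigma>\<^sub>0 / 2) d"
  have c0: "c > 0" "c \<le> \<sigma>\<^sub>0 / 2" "c \<le> d" using assms d0 by (auto simp: c_def)
  have cK: "energy_const * (c * sqrt c) * R \<le> 1"
  proof -
    have "c * sqrt c \<le> d * 1" using c0 d0 by (intro mult_mono) auto
    then have "energy_const * R * (c * sqrt c) \<le> energy_const * R * d" using KR by (intro mult_left_mono) auto
    also have "\<dots> \<le> energy_const * R * (1 / (energy_const * R + 1))" using KR by (intro mult_left_mono) (auto simp: d_def)
    also have "\<dots> \<le> 1" using KR by (simp add: divide_le_eq)
    finally show ?thesis by (simp add: mult_ac)
  qed
  \<comment> \<open>\<open>max 1 t\<close> instead of \<open>t\<close> because \<open>0 powr (- (2 / 3)) = 0\<close>\<close>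
  define \<sigma> where "\<sigma> t = c * max 1 t powr (- (2 / 3))" for t :: real
  have \<sigma>0: "\<sigma> t > 0" for t using c0 by (simp add: \<sigma>_def)
  have \<sigma>_le: "\<sigma> t \<le> \<sigma>\<^sub>0 / 2" for t
  proof -
    have "max 1 t powr (- (2 / 3)) \<le> 1" using powr_mono2'[of "- (2 / 3)" 1 "max 1 t"] by simp
    then have "\<sigma> t \<le> c * 1" unfolding \<sigma>_def using c0 by (intro mult_left_mono) auto
    then show ?thesis using c0 by simp
  qed
  have \<sigma>_antimono: "\<sigma> t \<le> \<sigma> s" if "s \<le> t" for s t
    unfolding \<sigma>_def using c0 that by (intro mult_left_mono powr_mono2') auto
  \<comment> \<open>The power 3/2 of \<sigma> T is c sqrt c / max 1 T, and the denominator
    compensates the factor \<open>T\<close> in the time condition of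
    \<open>ODE_exists\<close>.\<close>
  have \<sigma>K: "energy_const * (\<sigma> T * sqrt (\<sigma> T)) * R * T \<le> 1" if "T \<ge> 0" for T
  proof -
    define m where "m = max 1 T"
    have m: "m \<ge> 1" "T \<le> m" by (auto simp: m_def)
    have "sqrt (m powr (- (2 / 3))) = m powr (- (1 / 3))"
      by (simp add: powr_half_sqrt[symmetric] powr_powr)
    then have "\<sigma> T * sqrt (\<sigma> T) = c * sqrt c * (m powr (- (2 / 3)) * m powr (- (1 / 3)))"
      by (simp add: \<sigma>_def m_def[symmetric] real_sqrt_mult)
    also have "m powr (- (2 / 3)) * m powr (- (1 / 3)) = 1 / m"
      using m by (simp add: powr_add[symmetric] powr_minus_divide)
    finally have "energy_const * (\<sigma> T * sqrt (\<sigma> T)) * R * T = energy_const * (c * sqrt c) * R * (T / m)"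
      by simp
    also have "\<dots> \<le> energy_const * (c * sqrt c) * R * 1"
      using m that energy_const_nonneg Rp c0 by (intro mult_left_mono mult_nonneg_nonneg) auto
    finally show ?thesis using cK by simp
  qed
  show ?thesis
  proof (intro exI[of _ c] conjI allI impI)
    show "c > 0" by (rule c0)
    fix u0 :: "real \<Rightarrow> complex"
    assume "u0 \<in> gevrey \<sigma>\<^sub>0 \<and> real_valued u0 \<and> gevrey_norm \<sigma>\<^sub>0 u0 = r"
    then have u0: "u0 \<in> gevrey \<sigma>\<^sub>0" "real_valued u0" "gevrey_norm \<sigma>\<^sub>0 u0 = r" by auto
    obtain g where g: "g \<in> hermL2" "AE x in lborel. physical (mk g) x = u0 x"
      and init: "\<And>\<sigma>. 0 < \<sigma> \<Longrightarrow> \<sigma> \<le> \<sigma>\<^sub>0 / 2 \<Longrightarrow> \<exists>v. unweight (bbm_inv_weight \<sigma>) v = mk g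
        \<and> norm v \<le> ?M * gevrey_norm \<sigma>\<^sub>0 u0"
      using initial_data[OF assms u0(1,2)] by blast
    let ?p = "\<lambda>T. bbm_inv_weight (\<sigma> T)"
    have "\<exists>y. unweight (?p T) (y 0) = mk g
        \<and> (\<forall>t\<in>{0..T}. (y has_vector_derivative bbm_field (?p T) (y t)) (at t within {0..T}))"
      if T: "T \<ge> 0" for T
    proof -
      interpret W: bbm_weight "?p T" "bbm_kernel_bound (\<sigma> T)" by (rule bbm_weight_inv_weight[OF \<sigma>0])
      obtain v where v: "unweight (?p T) v = mk g" "norm v \<le> ?M * r"
        using init[OF \<sigma>0 \<sigma>_le] u0(3) by blast
      have "?M * r \<le> ?M * \<bar>r\<bar>" by (intro mult_left_mono) auto
      with v(2) have "norm v \<le> ?M * \<bar>r\<bar> + 1" by (intro add_increasing2) auto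
      then have vR: "3 * norm v \<le> R" unfolding R_def by (rule mult_left_mono) simp
      have "energy_const * (\<sigma> T * sqrt (\<sigma> T)) \<ge> 0" using energy_const_nonneg \<sigma>0[of T] by (simp add: less_imp_le)
      then obtain y where "y 0 = v"
        "\<And>t. t \<in> {0..T} \<Longrightarrow> (y has_vector_derivative bbm_field (?p T) (y t)) (at t within {0..T})"
        using ODE_exists[OF W.bbm_field_lipschitz energy_estimate[OF \<sigma>0] _ Rp vR T \<sigma>K[OF T]] by blast
      then show ?thesis using v(1) by blast
    qed
    \<comment> \<open>One solution for each end time \<open>T\<close>, in the weight of width
      \<sigma> T. Curves for different \<open>T\<close> become comparable only after multiplication
      by their own \<open>p\<close>.\<close>
    then obtain Y where Y0: "\<And>T. T \<ge> 0 \<Longrightarrow> unweight (?p T) (Y T 0) = mk g"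
      and Y: "\<And>T t. t \<in> {0..T} \<Longrightarrow> (Y T has_vector_derivative bbm_field (?p T) (Y T t)) (at t within {0..T})"
      by (metis atLeastAtMost_iff order_trans)
    \<comment> \<open>The diagonal choice: at time t the solution with end time t is used, which has
      the largest width among those defined at t. Fact \<open>z\<close> below shows by uniqueness
      that every later end time gives the same value.\<close>
    define z where "z t = unweight (?p t) (Y t t)" for t
    have emb_deriv: "((\<lambda>t. unweight (?p T) (Y T t)) has_vector_derivative bbm_field (\<lambda>_. 1) (unweight (?p T) (Y T t))) (at t within {0..S})"
      if "S \<le> T" "t \<in> {0..S}" for S T t
    proof -
      interpret W: bbm_weight "?p T" "bbm_kernel_bound (\<sigma> T)" by (rule bbm_weight_inv_weight[OF \<sigma>0])
      have "(Y T has_vector_derivative bbm_field (?p T) (Y T t)) (at t within {0..S})"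
        by (rule has_vector_derivative_within_subset[OF Y]) (use that in auto)
      from bounded_linear.has_vector_derivative[OF W.bounded_linear_unweight this]
      show ?thesis by (simp add: W.unweight_bbm_field)
    qed
    have z: "z t = unweight (?p T) (Y T t)" if "t \<in> {0..T}" for t T
      unfolding z_def
      by (rule ODE_unique[of t "\<lambda>s. unweight (?p t) (Y t s)" "bbm_field (\<lambda>_. 1)" "\<lambda>s. unweight (?p T) (Y T s)"])
         (use that emb_deriv unweighted.bbm_field_lipschitz Y0 in auto)
    have zint: "integrable lborel (rep (z t))" if "t \<ge> 0" for t
      unfolding z_def by (rule unweight_gevrey(1)[OF \<sigma>0])
    define u where "u t = physical (z t)" for t
    have gev: "u t \<in> gevrey (\<sigma> T)" if "t \<in> {0..T}" for t T
      unfolding u_def z[OF that] by (rule unweight_gevrey(2)[OF \<sigma>0])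
    \<comment> \<open>On all of [0, T] the solution is represented by the one curve
      \<open>Y T\<close>, so continuity in \<open>hl2\<close> passes to the Gevrey norm through the
      bound in \<open>unweight_gevrey\<close>. The derivative is treated in the same way.\<close>
    have lim: "((\<lambda>s. gevrey_norm (\<sigma> T) (\<lambda>x. u s x - u t x)) \<longlongrightarrow> 0) (at t within {0..T})"
      if t: "t \<in> {0..T}" for t T
    proof -
      interpret W: bbm_weight "?p T" "bbm_kernel_bound (\<sigma> T)" by (rule bbm_weight_inv_weight[OF \<sigma>0])
      let ?C = "sqrt (2 * (1 + 2 * \<sigma> T))"
      have "(Y T \<longlongrightarrow> Y T t) (at t within {0..T})"
        using has_vector_derivative_continuous[OF Y[OF t]] by (simp add: continuous_within)
      then have "((\<lambda>s. ?C * norm (Y T s - Y T t)) \<longlongrightarrow> ?C * norm (Y T t - Y T t)) (at t within {0..T})"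
        by (intro tendsto_intros)
      then have l: "((\<lambda>s. ?C * norm (Y T s - Y T t)) \<longlongrightarrow> 0) (at t within {0..T})" by simp
      have le: "\<forall>\<^sub>F s in at t within {0..T}. gevrey_norm (\<sigma> T) (\<lambda>x. u s x - u t x) \<le> ?C * norm (Y T s - Y T t)"
        unfolding eventually_at_filter
      proof (intro always_eventually allI impI)
        fix s assume s: "s \<in> {0..T}"
        have "(\<lambda>x. u s x - u t x) = physical (z s - z t)"
          unfolding u_def using s t by (simp add: physical_diff zint fun_eq_iff)
        also have "z s - z t = unweight (?p T) (Y T s - Y T t)"
          unfolding z[OF s] z[OF t] by (rule linear_diff[OF bounded_linear.linear[OF W.bounded_linear_unweight], symmetric])
        finally show "gevrey_norm (\<sigma> T) (\<lambda>x. u s x - u t x) \<le> ?C * norm (Y T s - Y T t)"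
          using unweight_gevrey(3)[OF \<sigma>0] by simp
      qed
      show ?thesis
        by (rule tendsto_sandwich[OF _ le tendsto_const l]) (simp add: gevrey_norm_def)
    qed
    have deriv: "has_gevrey_derivative (\<sigma> T) u (physical (bbm_field (\<lambda>_. 1) (z t))) t {0..T}"
      if t: "t \<in> {0..T}" for t T
      unfolding has_gevrey_derivative_def
    proof (intro conjI ballI)
      interpret W: bbm_weight "?p T" "bbm_kernel_bound (\<sigma> T)" by (rule bbm_weight_inv_weight[OF \<sigma>0])
      have lin: "linear (unweight (?p T))" by (rule bounded_linear.linear[OF W.bounded_linear_unweight])
      define D where "D = bbm_field (?p T) (Y T t)"
      have D: "bbm_field (\<lambda>_. 1) (z t) = unweight (?p T) D"
        unfolding D_def z[OF t] by (rule W.unweight_bbm_field[symmetric])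
      show "physical (bbm_field (\<lambda>_. 1) (z t)) \<in> gevrey (\<sigma> T)"
        unfolding D by (rule unweight_gevrey(2)[OF \<sigma>0])
      show "u s \<in> gevrey (\<sigma> T)" if "s \<in> {0..T}" for s by (rule gev[OF that])
      let ?C = "sqrt (2 * (1 + 2 * \<sigma> T))" and ?q = "\<lambda>s. inverse (s - t) *\<^sub>R (Y T s - Y T t)"
      let ?N = "\<lambda>s. gevrey_norm (\<sigma> T) (\<lambda>x. (u s x - u t x) / complex_of_real (s - t) - physical (bbm_field (\<lambda>_. 1) (z t)) x)"
      have "((\<lambda>s. ?C * norm (?q s - D)) \<longlongrightarrow> ?C * 0) (at t within {0..T})"
        unfolding D_def by (intro tendsto_intros has_vector_derivative_difference_quotient Y t)
      then have l: "((\<lambda>s. ?C * norm (?q s - D)) \<longlongrightarrow> 0) (at t within {0..T})" by simp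
      have le: "\<forall>\<^sub>F s in at t within {0..T}. ?N s \<le> ?C * norm (?q s - D)"
        unfolding eventually_at_filter
      proof (intro always_eventually allI impI)
        fix s assume s: "s \<in> {0..T}"
        have i: "integrable lborel (rep (unweight (?p T) x))" for x by (rule unweight_gevrey(1)[OF \<sigma>0])
        have "(u s x - u t x) / complex_of_real (s - t) - physical (bbm_field (\<lambda>_. 1) (z t)) x = physical (unweight (?p T) (?q s - D)) x" for x
        proof -
          have "physical (unweight (?p T) (?q s - D)) x = physical (unweight (?p T) (?q s)) x - physical (unweight (?p T) D) x"
            unfolding linear_diff[OF lin] by (rule physical_diff[OF i i])
          also have "physical (unweight (?p T) (?q s)) x = complex_of_real (inverse (s - t)) * (physical (unweight (?p T) (Y T s)) x - physical (unweight (?p T) (Y T t)) x)"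
            unfolding linear_scale[OF lin] linear_diff[OF lin] physical_scaleR physical_diff[OF i i] ..
          finally show ?thesis
            by (simp add: u_def D[unfolded z[OF t]] z[OF s] z[OF t] divide_inverse mult.commute)
        qed
        then show "?N s \<le> ?C * norm (?q s - D)"
          using unweight_gevrey(3)[OF \<sigma>0[of T], of "?q s - D"] by (simp only:)
      qed
      show "(?N \<longlongrightarrow> 0) (at t within {0..T})"
        by (rule tendsto_sandwich[OF _ le tendsto_const l]) (simp add: gevrey_norm_def)
    qed
    show "\<exists>(\<sigma> :: real \<Rightarrow> real) (u :: real \<Rightarrow> real \<Rightarrow> complex).
      (\<forall>t\<ge>0. \<sigma> t > 0) \<and> antimono_on {0..} \<sigma> \<and>
      C_gevrey \<sigma> u \<and> (\<forall>t\<ge>0. real_valued (u t)) \<and> BBM_solution \<sigma> u0 u \<and>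
      (\<forall>\<^sub>F t in at_top. \<sigma> t \<ge> c * t powr (- (2 / 3)))"
    proof (intro exI[of _ \<sigma>] exI[of _ u] conjI allI impI)
      show "\<sigma> t > 0" for t by (rule \<sigma>0)
      show "antimono_on {0..} \<sigma>" by (intro monotone_onI \<sigma>_antimono)
      show "C_gevrey \<sigma> u"
        unfolding C_gevrey_def gevrey_continuous_on_def using gev lim by auto
      show "real_valued (u t)" for t unfolding u_def by (rule physical_real)
      show "BBM_solution \<sigma> u0 u"
        unfolding BBM_solution_def
      proof (intro conjI allI impI ballI)
        have "z 0 = mk g" unfolding z_def by (rule Y0) simp
        then show "AE x in lborel. u 0 x = u0 x" using g(2) by (simp add: u_def)
        fix T t :: real assume "T > 0" and t: "t \<in> {0..T}"
        show "\<exists>u\<^sub>t. has_gevrey_derivative (\<sigma> T) u u\<^sub>t t {0..T} \<and>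
          (AE x in lborel. u\<^sub>t x + phi_D (u t) x + 1 / 2 * phi_D (\<lambda>y. (u t y)\<^sup>2) x = 0)"
        proof (intro exI conjI)
          show "has_gevrey_derivative (\<sigma> T) u (physical (bbm_field (\<lambda>_. 1) (z t))) t {0..T}" by (rule deriv[OF t])
          show "AE x in lborel. physical (bbm_field (\<lambda>_. 1) (z t)) x + phi_D (u t) x + 1 / 2 * phi_D (\<lambda>y. (u t y)\<^sup>2) x = 0"
            unfolding u_def by (rule bbm_field_physical[OF zint]) (use t in simp)
        qed
      qed
      show "\<forall>\<^sub>F t in at_top. \<sigma> t \<ge> c * t powr (- (2 / 3))"
        using eventually_ge_at_top[of 1] by eventually_elim (simp add: \<sigma>_def max_def)
    qed
  qed
qed

end
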